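(* Let $\alpha>0$, let $X$ be a complex Banach space of finite cotype, and let $\Phi: \mathrm{H}^\infty(\mathrm{St}_\alpha)\to\mathcal L(X)$ be a bounded $\mathrm{H}^\infty$-calculus over the strip $\mathrm{St}_\alpha=\{z\in\mathbb C: |\operatorname{Im} z|<\alpha\}$. Let $\beta>\alpha$ and let $H$ be an arbitrary complex Hilbert space. Then for each $u\in \mathrm{H}^\infty(\mathrm{St}_\beta;H')$ the square function $\Phi_\gamma(u): X\to\gamma(H;X)$ is a bounded operator, and there is a constant $C\ge 0$ such that $$\|\Phi_\gamma(u)x\|_{\gamma}\le C\,\|u\|_{\mathrm{H}^\infty(\mathrm{St}_\beta)}\,\|x\|_X\qquad\text{for all } u\in \mathrm{H}^\infty(\mathrm{St}_\beta;H'),\ x\in X.$$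
   Context: $\gamma$-radonifying operators: for a Hilbert space $H$ and a Banach space $X$ (complex), and linear $T:H\to X$, put $\|T\|_\gamma=\sup_F\big(\mathbb E\|\sum_{e\in F}\gamma_e\,Te\|_X^2\big)^{1/2}$, the supremum over all finite orthonormal systems $F\subseteq H$, where $(\gamma_e)$ are independent complex standard Gaussians (i.e. $\gamma=\gamma_r+\mathrm i\gamma_i$ with $\gamma_r,\gamma_i$ independent real standard Gaussians). $\gamma_\infty(H;X)$ is the space of $T$ with $\|T\|_\gamma<\infty$, and $\gamma(H;X)$ is the closure in $\gamma_\infty(H;X)$ of the finite rank operators. $H'$ is the dual of $H$ (again a Hilbert space). Functional calculus: for an open set $O\subseteq\mathbb C$, $\mathrm H^\infty(O)$ is the algebra of bounded holomorphic functions on $O$ with the sup-norm, and $\mathrm H^\infty(O;H')$ denotes the bounded holomorphic $H'$-valued functions. A functional calculus $(\mathcal E,\mathrm H^\infty(O),\Phi)$ on $X$ consists of a subalgebra $\mathcal E\subseteq \mathrm H^\infty(O)$ and an algebra homomorphism $\Phi:\mathcal E\to\mathcal L(X)$, extended to $f\in\mathrm H^\infty(O)$ by $\Phi(f):=\Phi(e)^{-1}\Phi(ef)$ (natural domain), where $e\in\mathcal E$ is any function with $ef\in\mathcal E$ and $\Phi(e)$ injective (the result does not depend on $e$). It is a bounded $\mathrm H^\infty$-calculus on $O$ if there is $C\ge0$ with $\Phi(f)\in\mathcal L(X)$ and $\|\Phi(f)\|\le C\|f\|_{\mathrm H^\infty}$ for all $f\in \mathrm H^\infty(O)$. Standing assumption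 on the calculus: there is $e\in\mathcal E$ such that (1) $ef\in\mathcal E$ for all $f\in \mathrm H^\infty(O)$; (2) if $(f_n)$ is a bounded sequence in $\mathrm H^\infty(O)$ with $f_n\to f$ pointwise, then $\Phi(ef_n)\to\Phi(ef)$ in the weak operator topology on $X$; (3) $\Phi(e)$ is injective. (The standard holomorphic functional calculus on $\mathrm{St}_\alpha$ of an operator of strip type less than $\alpha$ has this property.) Here $O=\mathrm{St}_\alpha$. Vectorial calculus: for $f\in \mathrm H^\infty(O;H')$ and $h\in H$ let $(h\diamond f)(z):=\langle h,f(z)\rangle_{H,H'}$. $\Phi_\gamma(f)$ is the operator with domain the set of $x\in X$ such that $x\in\operatorname{dom}(\Phi(h\diamond f))$ for all $h\in H$ and the map $h\mapsto \Phi(h\diamond f)x$ belongs to $\gamma(H;X)$; for such $x$, $[\Phi_\gamma(f)x]h:=\Phi(h\diamond f)x$. It is bounded if its domain is $X$ and $\Phi_\gamma(f):X\to\gamma(H;X)$ is a bounded operator. Functions on $\mathrm{St}_\beta$ are restricted to $\mathrm{St}_\alpha$ when inserted into $\Phi_\gamma$. *)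

theory Defs
  imports "HOL-Probability.Probability"
begin

section \<open>Complex Banach and Hilbert spaces\<close>

class complex_normed_vector = real_normed_vector +
  fixes scaleC :: "complex \<Rightarrow> 'a \<Rightarrow> 'a"  (infixr \<open>*\<^sub>C\<close> 75)
  assumes scaleC_add_right: "a *\<^sub>C (x + y) = a *\<^sub>C x + a *\<^sub>C y"
    and scaleC_add_left: "(a + b) *\<^sub>C x = a *\<^sub>C x + b *\<^sub>C x"
    and scaleC_scaleC: "a *\<^sub>C (b *\<^sub>C x) = (a * b) *\<^sub>C x"
    and scaleR_scaleC: "r *\<^sub>R x = complex_of_real r *\<^sub>C x"
    and norm_scaleC: "norm (a *\<^sub>C x) = norm a * norm x"

class complex_banach = complex_normed_vector + banach

class complex_hilbert = complex_banach +
  fixes cinner :: "'a \<Rightarrow> 'a \<Rightarrow> complex"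
  assumes cinner_commute: "cinner x y = cnj (cinner y x)"
    and cinner_add_left: "cinner (x + y) z = cinner x z + cinner y z"
    and cinner_scaleC_left: "cinner (a *\<^sub>C x) y = a * cinner x y"
    and cinner_self: "cinner x x = complex_of_real ((norm x)\<^sup>2)"

lemma scaleC_one: "1 *\<^sub>C x = (x :: 'a :: complex_normed_vector)"
  using scaleR_scaleC[of 1 x] by simp

global_interpretation complex_vector:
  vector_space "scaleC :: complex \<Rightarrow> 'a \<Rightarrow> 'a :: complex_normed_vector"
  by unfold_locales (simp_all add: scaleC_add_right scaleC_add_left scaleC_scaleC scaleC_one)

abbreviation clinear :: "('a :: complex_normed_vector \<Rightarrow> 'b :: complex_normed_vector) \<Rightarrow> bool"
  where "clinear \<equiv> Vector_Spaces.linear scaleC scaleC"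

lemma bounded_linear_scaleC: "bounded_linear (\<lambda>x. c *\<^sub>C (x :: 'a :: complex_normed_vector))"
proof (rule bounded_linear_intro[where K = "norm c"])
  show "c *\<^sub>C (x + y) = c *\<^sub>C x + c *\<^sub>C y" for x y :: 'a
    by (rule scaleC_add_right)
  show "c *\<^sub>C (r *\<^sub>R x) = r *\<^sub>R (c *\<^sub>C x)" for r and x :: 'a
    by (simp add: scaleR_scaleC scaleC_scaleC mult.commute)
  show "norm (c *\<^sub>C x) \<le> norm x * norm c" for x :: 'a
    by (simp add: norm_scaleC mult.commute)
qed

instantiation complex :: complex_hilbert
begin

definition scaleC_complex :: "complex \<Rightarrow> complex \<Rightarrow> complex"
  where "scaleC_complex = (*)"

definition cinner_complex :: "complex \<Rightarrow> complex \<Rightarrow> complex"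
  where "cinner_complex x y = x * cnj y"

instance
proof
  fix a b :: complex and r :: real and x y z :: complex
  show "a *\<^sub>C (x + y) = a *\<^sub>C x + a *\<^sub>C y" "(a + b) *\<^sub>C x = a *\<^sub>C x + b *\<^sub>C x"
    "a *\<^sub>C (b *\<^sub>C x) = (a * b) *\<^sub>C x"
    by (simp_all add: scaleC_complex_def algebra_simps)
  show "r *\<^sub>R x = complex_of_real r *\<^sub>C x"
    by (simp add: scaleC_complex_def scaleR_conv_of_real)
  show "norm (a *\<^sub>C x) = norm a * norm x"
    by (simp add: scaleC_complex_def norm_mult)
  show "cinner x y = cnj (cinner y x)" "cinner (x + y) z = cinner x z + cinner y z"
    "cinner (a *\<^sub>C x) y = a * cinner x y"
    by (simp_all add: scaleC_complex_def cinner_complex_def algebra_simps)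
  show "cinner x x = complex_of_real ((norm x)\<^sup>2)"
    by (simp only: cinner_complex_def complex_norm_square)
qed

end

instantiation blinfun :: (real_normed_vector, complex_normed_vector) complex_normed_vector
begin

lift_definition scaleC_blinfun :: "complex \<Rightarrow> 'a \<Rightarrow>\<^sub>L 'b \<Rightarrow> 'a \<Rightarrow>\<^sub>L 'b"
  is "\<lambda>c f x. c *\<^sub>C f x"
  by (rule bounded_linear_compose[OF bounded_linear_scaleC])

instance
proof
  fix a b :: complex and r :: real and x y :: "'a \<Rightarrow>\<^sub>L 'b"
  show "a *\<^sub>C (x + y) = a *\<^sub>C x + a *\<^sub>C y"
    by transfer (simp add: scaleC_add_right)
  show "(a + b) *\<^sub>C x = a *\<^sub>C x + b *\<^sub>C x"
    by transfer (simp add: scaleC_add_left)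
  show "a *\<^sub>C (b *\<^sub>C x) = (a * b) *\<^sub>C x"
    by transfer (simp add: scaleC_scaleC)
  show "r *\<^sub>R x = complex_of_real r *\<^sub>C x"
    by transfer (simp add: scaleR_scaleC)
  show "norm (a *\<^sub>C x) = norm a * norm x"
  proof transfer
    fix a :: complex and f :: "'a \<Rightarrow> 'b"
    assume "bounded_linear f"
    have "onorm (\<lambda>x. a *\<^sub>C f x) = onorm (\<lambda>x. norm a *\<^sub>R f x)"
      unfolding onorm_def by (simp add: norm_scaleC)
    also have "\<dots> = norm a * onorm f"
      using onorm_scaleR[OF \<open>bounded_linear f\<close>] by simp
    finally show "onorm (\<lambda>x. a *\<^sub>C f x) = norm a * onorm f" .
  qed
qed

end

text \<open>
  The type \<open>'a \<Rightarrow>\<^sub>L 'b\<close> consists of the bounded \<^emph>\<open>real\<close>-linear maps; the space of bounded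
  complex-linear maps is the following closed complex subspace of it, with the operator norm.
\<close>

definition cblinfuns :: "('a :: complex_normed_vector \<Rightarrow>\<^sub>L 'b :: complex_normed_vector) set"
  where "cblinfuns = {A. clinear (blinfun_apply A)}"

abbreviation cdual :: "('a :: complex_normed_vector \<Rightarrow>\<^sub>L complex) set"
  where "cdual \<equiv> cblinfuns"


section \<open>Finite cotype\<close>

definition has_cotype :: "'x :: complex_banach itself \<Rightarrow> real \<Rightarrow> bool"
  where "has_cotype _ q \<longleftrightarrow>
    (\<exists>C. \<forall>n. \<forall>x :: nat \<Rightarrow> 'x.
      (\<Sum>i<n. norm (x i) powr q) powr (1 / q) \<le>
        C * sqrt (measure_pmf.expectation (pmf_of_set ({..<n} \<rightarrow>\<^sub>E {-1, 1 :: real}))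
              (\<lambda>r. (norm (\<Sum>i<n. r i *\<^sub>R x i))\<^sup>2)))"

definition finite_cotype :: "'x :: complex_banach itself \<Rightarrow> bool"
  where "finite_cotype X \<longleftrightarrow> (\<exists>q\<ge>2. has_cotype X q)"


section \<open>Radonifying operators\<close>

text \<open>The law of \<open>\<gamma>\<^sub>r + \<i> \<gamma>\<^sub>i\<close> for independent real standard Gaussians (so \<open>E |\<gamma>|\<^sup>2 = 2\<close>).\<close>

definition std_real_gaussian :: "real measure"
  where "std_real_gaussian = density lborel (\<lambda>x. ennreal (std_normal_density x))"

definition std_complex_gaussian :: "complex measure"
  where "std_complex_gaussian =
    distr (std_real_gaussian \<Otimes>\<^sub>M std_real_gaussian) borel (\<lambda>(a, b). Complex a b)"

definition orthonormal :: "'h :: complex_hilbert set \<Rightarrow> bool"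
  where "orthonormal F \<longleftrightarrow> (\<forall>e\<in>F. \<forall>f\<in>F. cinner e f = (if e = f then 1 else 0))"

text \<open>
  The coordinates of \<open>\<omega>\<close> under the product measure are the independent Gaussians; the integrand
  is always integrable, see \<open>integrable_gaussian_sum\<close> below.
\<close>

definition gaussian_sum_norm :: "('h :: complex_hilbert \<Rightarrow> 'x :: complex_banach) \<Rightarrow> 'h set \<Rightarrow> real"
  where "gaussian_sum_norm T F =
    sqrt (\<integral>\<omega>. (norm (\<Sum>e\<in>F. \<omega> e *\<^sub>C T e))\<^sup>2 \<partial>(\<Pi>\<^sub>M e\<in>F. std_complex_gaussian))"

definition gamma_norm :: "('h :: complex_hilbert \<Rightarrow> 'x :: complex_banach) \<Rightarrow> ennreal"
  where "gamma_norm T = (SUP F\<in>{F. finite F \<and> orthonormal F}. ennreal (gaussian_sum_norm T F))"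

definition gamma_infty :: "('h :: complex_hilbert \<Rightarrow> 'x :: complex_banach) set"
  where "gamma_infty = {T. clinear T \<and> gamma_norm T < \<infinity>}"

definition finite_rank :: "('h :: complex_hilbert \<Rightarrow> 'x :: complex_banach) \<Rightarrow> bool"
  where "finite_rank S \<longleftrightarrow> clinear S \<and> (\<exists>B. finite B \<and> range S \<subseteq> complex_vector.span B)"

definition gamma_radonifying :: "('h :: complex_hilbert \<Rightarrow> 'x :: complex_banach) set"
  where "gamma_radonifying = {T \<in> gamma_infty.
    \<forall>\<epsilon>>0. \<exists>S\<in>gamma_infty. finite_rank S \<and> gamma_norm (\<lambda>h. T h - S h) < ennreal \<epsilon>}"

lemma prob_space_std_real_gaussian: "prob_space std_real_gaussian"
  unfolding std_real_gaussian_def by (rule prob_space_normal_density) simp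

lemma sets_std_real_gaussian [simp, measurable_cong]: "sets std_real_gaussian = sets borel"
  by (simp add: std_real_gaussian_def)

lemma sets_std_complex_gaussian [simp, measurable_cong]: "sets std_complex_gaussian = sets borel"
  by (simp add: std_complex_gaussian_def)

lemma borel_measurable_Complex_pair:
  "(\<lambda>(a, b). Complex a b) \<in> borel_measurable (std_real_gaussian \<Otimes>\<^sub>M std_real_gaussian)"
  unfolding case_prod_beta Complex_eq by measurable

lemma prob_space_std_complex_gaussian: "prob_space std_complex_gaussian"
proof -
  interpret A: prob_space std_real_gaussian by (rule prob_space_std_real_gaussian)
  interpret P: pair_prob_space std_real_gaussian std_real_gaussian ..
  show ?thesis
    unfolding std_complex_gaussian_def by (rule P.prob_space_distr[OF borel_measurable_Complex_pair])
qed

lemma integrable_std_complex_gaussian: "integrable std_complex_gaussian (\<lambda>z. (norm z)\<^sup>2)"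
proof -
  let ?N = "std_real_gaussian"
  interpret A: prob_space ?N by (rule prob_space_std_real_gaussian)
  interpret P: pair_prob_space ?N ?N ..
  have sq: "integrable ?N (\<lambda>x. x\<^sup>2)"
    unfolding std_real_gaussian_def
    using integrable_std_normal_moment[of 2] by (subst integrable_density) auto
  have "integrable (?N \<Otimes>\<^sub>M ?N) (\<lambda>p. (fst p)\<^sup>2)"
    by (rule integrable_distr[of fst _ ?N "\<lambda>x. x\<^sup>2"]) (simp_all add: A.distr_pair_fst sq)
  moreover have "integrable (?N \<Otimes>\<^sub>M ?N) (\<lambda>p. (snd p)\<^sup>2)"
    using P.integrable_product_swap[of "\<lambda>p. (fst p)\<^sup>2"] calculation
    by (simp add: case_prod_unfold)
  ultimately have "integrable (?N \<Otimes>\<^sub>M ?N) (\<lambda>p. (fst p)\<^sup>2 + (snd p)\<^sup>2)"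
    by simp
  then show ?thesis
    unfolding std_complex_gaussian_def
    by (subst integrable_distr_eq[OF borel_measurable_Complex_pair])
      (simp_all add: case_prod_beta cmod_power2)
qed

lemma integrable_gaussian_sum:
  fixes T :: "'h :: complex_hilbert \<Rightarrow> 'x :: complex_banach"
  assumes "finite F"
  shows "integrable (\<Pi>\<^sub>M e\<in>F. std_complex_gaussian) (\<lambda>\<omega>. (norm (\<Sum>e\<in>F. \<omega> e *\<^sub>C T e))\<^sup>2)"
proof -
  let ?M = "\<Pi>\<^sub>M e\<in>F. std_complex_gaussian"
  obtain k :: "nat \<Rightarrow> 'h" and n where k: "bij_betw k {..<n} F"
    using ex_bij_betw_nat_finite[OF assms] by (auto simp: atLeast0LessThan)
  have cont: "continuous_on UNIV (\<lambda>v :: nat \<Rightarrow> complex. (norm (\<Sum>i<n. v i *\<^sub>C T (k i)))\<^sup>2)"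
  proof -
    have "bounded_linear (\<lambda>c :: complex. c *\<^sub>C x)" for x :: 'x
      by (rule bounded_linear_intro[where K = "norm x"])
        (simp_all add: scaleC_add_left scaleR_scaleC scaleC_scaleC scaleC_complex_def norm_scaleC)
    then have "continuous_on UNIV (\<lambda>v :: nat \<Rightarrow> complex. v i *\<^sub>C T (k i))" for i
      by (rule bounded_linear.continuous_on) (rule continuous_on_product_coordinates)
    then show ?thesis
      by (intro continuous_on_power continuous_on_norm continuous_on_sum)
  qed
  have coord: "(\<lambda>\<omega> i. if i < n then \<omega> (k i) else 0) \<in> borel_measurable ?M"
  proof (rule measurable_coordinatewise_then_product)
    fix i
    have "k i \<in> F" if "i < n" using bij_betwE[OF k] that by simp
    then show "(\<lambda>\<omega>. if i < n then \<omega> (k i) else 0) \<in> borel_measurable ?M"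
      by (cases "i < n") simp_all
  qed
  have meas: "(\<lambda>\<omega>. (norm (\<Sum>e\<in>F. \<omega> e *\<^sub>C T e))\<^sup>2) \<in> borel_measurable ?M"
    using measurable_compose[OF coord borel_measurable_continuous_onI[OF cont]]
    by (simp add: sum.reindex_bij_betw[OF k, symmetric])
  have int: "integrable ?M (\<lambda>\<omega>. (norm (\<omega> e))\<^sup>2)" if "e \<in> F" for e
  proof -
    have "distr ?M std_complex_gaussian (\<lambda>\<omega>. \<omega> e) = std_complex_gaussian"
      using that assms prob_space_std_complex_gaussian by (intro distr_PiM_component) auto
    then show ?thesis
      using that integrable_std_complex_gaussian
      by (intro integrable_distr[of "\<lambda>\<omega>. \<omega> e" _ std_complex_gaussian "\<lambda>z. (norm z)\<^sup>2"]) simp_all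
  qed
  show ?thesis
  proof (rule Bochner_Integration.integrable_bound[OF _ meas])
    show "integrable ?M (\<lambda>\<omega>. (\<Sum>e\<in>F. (norm (\<omega> e))\<^sup>2) * (\<Sum>e\<in>F. (norm (T e))\<^sup>2))"
      using int by (intro integrable_mult_left integrable_sum) auto
    have "(norm (\<Sum>e\<in>F. \<omega> e *\<^sub>C T e))\<^sup>2 \<le> (\<Sum>e\<in>F. (norm (\<omega> e))\<^sup>2) * (\<Sum>e\<in>F. (norm (T e))\<^sup>2)" for \<omega>
    proof -
      have "norm (\<Sum>e\<in>F. \<omega> e *\<^sub>C T e) \<le> (\<Sum>e\<in>F. norm (\<omega> e) * norm (T e))"
        by (rule order_trans[OF norm_sum]) (simp add: norm_scaleC)
      then have "(norm (\<Sum>e\<in>F. \<omega> e *\<^sub>C T e))\<^sup>2 \<le> (\<Sum>e\<in>F. norm (\<omega> e) * norm (T e))\<^sup>2"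
        by (rule power_mono) simp
      also have "\<dots> \<le> (\<Sum>e\<in>F. (norm (\<omega> e))\<^sup>2) * (\<Sum>e\<in>F. (norm (T e))\<^sup>2)"
        by (rule Cauchy_Schwarz_ineq_sum)
      finally show ?thesis .
    qed
    then show "AE \<omega> in ?M. norm ((norm (\<Sum>e\<in>F. \<omega> e *\<^sub>C T e))\<^sup>2)
        \<le> norm ((\<Sum>e\<in>F. (norm (\<omega> e))\<^sup>2) * (\<Sum>e\<in>F. (norm (T e))\<^sup>2))"
      by (intro AE_I2) (simp add: sum_nonneg)
  qed
qed


section \<open>Bounded holomorphic functions and functional calculi\<close>

definition strip :: "real \<Rightarrow> complex set"
  where "strip \<alpha> = {z. \<bar>Im z\<bar> < \<alpha>}"

text \<open>
  Functions on \<open>U\<close> are represented by total functions that vanish off \<open>U\<close>, so that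
  equality of functions is equality on \<open>U\<close> and the pointwise operations stay inside.
\<close>

definition Hinf :: "complex set \<Rightarrow> (complex \<Rightarrow> complex) set"
  where "Hinf U = {f. f holomorphic_on U \<and> bounded (f ` U) \<and> (\<forall>z. z \<notin> U \<longrightarrow> f z = 0)}"

definition Hinf_norm :: "complex set \<Rightarrow> (complex \<Rightarrow> 'b :: real_normed_vector) \<Rightarrow> real"
  where "Hinf_norm U f = (SUP z\<in>U. norm (f z))"

definition Hinf_subalgebra :: "complex set \<Rightarrow> (complex \<Rightarrow> complex) set \<Rightarrow> bool"
  where "Hinf_subalgebra U E \<longleftrightarrow>
    E \<subseteq> Hinf U \<and> (\<lambda>_. 0) \<in> E \<and>
    (\<forall>f\<in>E. \<forall>g\<in>E. (\<lambda>z. f z + g z) \<in> E \<and> (\<lambda>z. f z * g z) \<in> E) \<and>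
    (\<forall>c. \<forall>f\<in>E. (\<lambda>z. c * f z) \<in> E)"

definition functional_calculus ::
    "complex set \<Rightarrow> (complex \<Rightarrow> complex) set \<Rightarrow>
      ((complex \<Rightarrow> complex) \<Rightarrow> 'x :: complex_banach \<Rightarrow>\<^sub>L 'x) \<Rightarrow> bool"
  where "functional_calculus U E \<Phi> \<longleftrightarrow>
    Hinf_subalgebra U E \<and> \<Phi> ` E \<subseteq> cblinfuns \<and>
    (\<forall>f\<in>E. \<forall>g\<in>E. \<Phi> (\<lambda>z. f z + g z) = \<Phi> f + \<Phi> g \<and> \<Phi> (\<lambda>z. f z * g z) = \<Phi> f o\<^sub>L \<Phi> g) \<and>
    (\<forall>c. \<forall>f\<in>E. \<Phi> (\<lambda>z. c * f z) = c *\<^sub>C \<Phi> f)"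

definition regularizes ::
    "(complex \<Rightarrow> complex) set \<Rightarrow> ((complex \<Rightarrow> complex) \<Rightarrow> 'x :: complex_banach \<Rightarrow>\<^sub>L 'x) \<Rightarrow>
      (complex \<Rightarrow> complex) \<Rightarrow> (complex \<Rightarrow> complex) \<Rightarrow> bool"
  where "regularizes E \<Phi> e f \<longleftrightarrow>
    e \<in> E \<and> (\<lambda>z. e z * f z) \<in> E \<and> inj (blinfun_apply (\<Phi> e))"

text \<open>
  \<open>fc_graph E \<Phi> f\<close> is the graph of \<open>\<Phi>(f) = \<Phi>(e)\<inverse> \<Phi>(e f)\<close>; by \<open>fc_graph_iff\<close> below
  it may be computed with any regularizer \<open>e\<close>.
\<close>

definition fc_graph ::
    "(complex \<Rightarrow> complex) set \<Rightarrow> ((complex \<Rightarrow> complex) \<Rightarrow> 'x :: complex_banach \<Rightarrow>\<^sub>L 'x) \<Rightarrow>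
      (complex \<Rightarrow> complex) \<Rightarrow> ('x \<times> 'x) set"
  where "fc_graph E \<Phi> f =
    {(x, y). \<exists>e. regularizes E \<Phi> e f \<and> blinfun_apply (\<Phi> e) y = blinfun_apply (\<Phi> (\<lambda>z. e z * f z)) x}"

definition fc_dom ::
    "(complex \<Rightarrow> complex) set \<Rightarrow> ((complex \<Rightarrow> complex) \<Rightarrow> 'x :: complex_banach \<Rightarrow>\<^sub>L 'x) \<Rightarrow>
      (complex \<Rightarrow> complex) \<Rightarrow> 'x set"
  where "fc_dom E \<Phi> f = Domain (fc_graph E \<Phi> f)"

definition fc_apply ::
    "(complex \<Rightarrow> complex) set \<Rightarrow> ((complex \<Rightarrow> complex) \<Rightarrow> 'x :: complex_banach \<Rightarrow>\<^sub>L 'x) \<Rightarrow>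
      (complex \<Rightarrow> complex) \<Rightarrow> 'x \<Rightarrow> 'x"
  where "fc_apply E \<Phi> f x = (THE y. (x, y) \<in> fc_graph E \<Phi> f)"

lemma fc_graph_iff:
  assumes fc: "functional_calculus U E \<Phi>" and e: "regularizes E \<Phi> e f"
  shows "(x, y) \<in> fc_graph E \<Phi> f \<longleftrightarrow> blinfun_apply (\<Phi> e) y = blinfun_apply (\<Phi> (\<lambda>z. e z * f z)) x"
proof
  assume "(x, y) \<in> fc_graph E \<Phi> f"
  then obtain d where d: "regularizes E \<Phi> d f"
    and y: "blinfun_apply (\<Phi> d) y = blinfun_apply (\<Phi> (\<lambda>z. d z * f z)) x"
    by (auto simp: fc_graph_def)
  have mult: "blinfun_apply (\<Phi> (\<lambda>z. g z * h z)) v = blinfun_apply (\<Phi> g) (blinfun_apply (\<Phi> h) v)"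
    if "g \<in> E" "h \<in> E" for g h v
    using fc that by (simp add: functional_calculus_def)
  have mem: "d \<in> E" "e \<in> E" "(\<lambda>z. d z * f z) \<in> E" "(\<lambda>z. e z * f z) \<in> E"
    and inj: "inj (blinfun_apply (\<Phi> d))"
    using d e by (auto simp: regularizes_def)
  have "blinfun_apply (\<Phi> d) (blinfun_apply (\<Phi> e) y) = blinfun_apply (\<Phi> (\<lambda>z. e z * d z)) y"
    using mult[of d e y] mem by (simp add: mult.commute)
  also have "\<dots> = blinfun_apply (\<Phi> (\<lambda>z. e z * (d z * f z))) x"
    using mult[of e d y] mult[of e "\<lambda>z. d z * f z" x] mem y by simp
  also have "\<dots> = blinfun_apply (\<Phi> d) (blinfun_apply (\<Phi> (\<lambda>z. e z * f z)) x)"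
    using mult[of d "\<lambda>z. e z * f z" x] mem by (simp add: mult.left_commute)
  finally show "blinfun_apply (\<Phi> e) y = blinfun_apply (\<Phi> (\<lambda>z. e z * f z)) x"
    using inj by (simp add: inj_eq)
qed (use e in \<open>auto simp: fc_graph_def\<close>)

definition bounded_Hinf_calculus ::
    "complex set \<Rightarrow> (complex \<Rightarrow> complex) set \<Rightarrow>
      ((complex \<Rightarrow> complex) \<Rightarrow> 'x :: complex_banach \<Rightarrow>\<^sub>L 'x) \<Rightarrow> bool"
  where "bounded_Hinf_calculus U E \<Phi> \<longleftrightarrow>
    functional_calculus U E \<Phi> \<and>
    (\<exists>C\<ge>0. \<forall>f\<in>Hinf U. fc_dom E \<Phi> f = UNIV \<and>
      (\<exists>A\<in>cblinfuns. fc_apply E \<Phi> f = blinfun_apply A \<and> norm A \<le> C * Hinf_norm U f))"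

text \<open>
  The standing assumption: a universal regularizer that turns bounded pointwise convergence into
  convergence in the weak operator topology.
\<close>

definition has_continuous_regularizer ::
    "complex set \<Rightarrow> (complex \<Rightarrow> complex) set \<Rightarrow>
      ((complex \<Rightarrow> complex) \<Rightarrow> 'x :: complex_banach \<Rightarrow>\<^sub>L 'x) \<Rightarrow> bool"
  where "has_continuous_regularizer U E \<Phi> \<longleftrightarrow>
    (\<exists>e\<in>E.
      (\<forall>f\<in>Hinf U. (\<lambda>z. e z * f z) \<in> E) \<and>
      (\<forall>fs f. (\<forall>n :: nat. fs n \<in> Hinf U) \<and> (\<exists>K. \<forall>n. Hinf_norm U (fs n) \<le> K) \<and>
          f \<in> Hinf U \<and> (\<forall>z\<in>U. (\<lambda>n. fs n z) \<longlonglongrightarrow> f z) \<longrightarrow>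
        (\<forall>x. \<forall>\<xi>\<in>cdual.
          (\<lambda>n. blinfun_apply \<xi> (blinfun_apply (\<Phi> (\<lambda>z. e z * fs n z)) x))
            \<longlonglongrightarrow> blinfun_apply \<xi> (blinfun_apply (\<Phi> (\<lambda>z. e z * f z)) x))) \<and>
      inj (blinfun_apply (\<Phi> e)))"


section \<open>Square functions\<close>

definition Hinf_dual :: "complex set \<Rightarrow> (complex \<Rightarrow> 'h :: complex_hilbert \<Rightarrow>\<^sub>L complex) set"
  where "Hinf_dual U = {u. u ` U \<subseteq> cdual \<and> bounded (u ` U) \<and>
    (\<forall>z\<in>U. \<exists>u'. (u has_derivative (\<lambda>w. w *\<^sub>C u')) (at z within U))}"

text \<open>
  \<open>h \<diamond> u\<close> as an element of \<open>Hinf U\<close>; cutting off outside \<open>U\<close> also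
  restricts a function \<open>u\<close> given on a larger set to \<open>U\<close>.
\<close>

definition diamond ::
    "complex set \<Rightarrow> 'h :: complex_hilbert \<Rightarrow> (complex \<Rightarrow> 'h \<Rightarrow>\<^sub>L complex) \<Rightarrow> complex \<Rightarrow> complex"
  where "diamond U h u = (\<lambda>z. if z \<in> U then blinfun_apply (u z) h else 0)"

definition sqfun_apply ::
    "complex set \<Rightarrow> (complex \<Rightarrow> complex) set \<Rightarrow>
      ((complex \<Rightarrow> complex) \<Rightarrow> 'x :: complex_banach \<Rightarrow>\<^sub>L 'x) \<Rightarrow>
      (complex \<Rightarrow> 'h :: complex_hilbert \<Rightarrow>\<^sub>L complex) \<Rightarrow> 'x \<Rightarrow> 'h \<Rightarrow> 'x"
  where "sqfun_apply U E \<Phi> u x = (\<lambda>h. fc_apply E \<Phi> (diamond U h u) x)"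

definition sqfun_dom ::
    "complex set \<Rightarrow> (complex \<Rightarrow> complex) set \<Rightarrow>
      ((complex \<Rightarrow> complex) \<Rightarrow> 'x :: complex_banach \<Rightarrow>\<^sub>L 'x) \<Rightarrow>
      (complex \<Rightarrow> 'h :: complex_hilbert \<Rightarrow>\<^sub>L complex) \<Rightarrow> 'x set"
  where "sqfun_dom U E \<Phi> u =
    {x. (\<forall>h. x \<in> fc_dom E \<Phi> (diamond U h u)) \<and> sqfun_apply U E \<Phi> u x \<in> gamma_radonifying}"

definition bounded_sqfun ::
    "complex set \<Rightarrow> (complex \<Rightarrow> complex) set \<Rightarrow>
      ((complex \<Rightarrow> complex) \<Rightarrow> 'x :: complex_banach \<Rightarrow>\<^sub>L 'x) \<Rightarrow>
      (complex \<Rightarrow> 'h :: complex_hilbert \<Rightarrow>\<^sub>L complex) \<Rightarrow> bool"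
  where "bounded_sqfun U E \<Phi> u \<longleftrightarrow>
    sqfun_dom U E \<Phi> u = UNIV \<and>
    (\<forall>h. clinear (\<lambda>x. sqfun_apply U E \<Phi> u x h)) \<and>
    (\<exists>K\<ge>0. \<forall>x. gamma_norm (sqfun_apply U E \<Phi> u x) \<le> ennreal (K * norm x))"

end

theory Submission
  imports Defs "HOL-Complex_Analysis.Complex_Analysis" "HOL-Real_Asymp.Real_Asymp"
begin

text \<open>
  The Cauchy formula on the two lines \<open>Im w = \<plusminus> b\<close>, \<open>\<alpha> < b < \<beta>\<close>, with a Gaussian factor that makes
  it absolutely convergent, expands every bounded holomorphic \<open>u\<close> on the large strip into a series
  \<open>u = (\<Sum>i. c i u * f i)\<close> on the small one. The functions \<open>f i\<close> are fixed and scalar, with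
  \<open>\<Sum>i. \<bar>f i\<bar>\<close> bounded on the small strip, and the coefficients are merely bounded:
  \<open>\<bar>c i u\<bar> \<le> C sup \<bar>u\<bar>\<close> (\<open>strip_decomposition\<close>). Hence the square function of \<open>u\<close> at \<open>x\<close> is the series
  of rank one operators \<open>c i u \<otimes> y i\<close> with \<open>y i = \<Phi> (f i) x\<close>, and the bounded calculus gives
  \<open>norm (\<Sum>i. v i * y i) \<le> K * norm x\<close> for all scalars with \<open>\<bar>v i\<bar> \<le> 1\<close>, since \<open>\<Sum>i. v i * f i\<close> is bounded.

  The \<open>\<gamma>\<close>-norm tests such a series against independent Gaussians. The multipliers of the \<open>y i\<close> then
  become Gaussian variables \<open>G i\<close> of bounded variance, with arbitrary correlations; no orthogonality
  of the \<open>c i u\<close> is available. The heart of the proof is that finite cotype tolerates this: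
  \<open>E (norm (\<Sum>i. G i * y i))\<^sup>2\<close> is bounded by the square of \<open>sup (norm (\<Sum>i. v i * y i))\<close> over \<open>\<bar>v i\<bar> \<le> 1\<close>, up to
  a constant (\<open>finite_gaussian_sum_bound\<close>).

  To see this, cut the sum into the layers \<open>k \<le> \<bar>G i\<bar> < k + 1\<close>. The indices of layer \<open>k\<close> form a random set
  that contains each single index with a probability exponentially small in \<open>k\<close>. If a random set
  contains every index with probability at most \<open>\<delta>\<close>, then the part of the series that it selects has
  a \<open>q\<close>-th moment of order \<open>\<delta>\<close>, uniformly over all bounded multipliers (\<open>random_set_envelope\<close>): draw about
  \<open>1 / (2 \<delta>)\<close> independent copies of the set, and delete from each one what earlier copies have
  occupied. The remaining pieces are disjoint, so cotype bounds the sum of their \<open>q\<close>-th powers by a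
  constant; and each index survives with probability at least one half, so by Jensen's inequality
  the deletion costs only a constant factor. Summing over the layers gives the claim.

  Finite cotype moreover makes the tails \<open>sup (norm (\<Sum>i \<notin> J. v i * y i))\<close> small (\<open>unconditional_tails\<close>),
  because otherwise there would be infinitely many disjoint blocks of norm at least \<open>\<epsilon>\<close>. The same
  Gaussian estimate for tails shows that the finite rank partial sums converge in the \<open>\<gamma>\<close>-norm
  (\<open>gamma_series\<close>), so the limit lies in the closure of the finite rank operators. The limit is the
  square function because the regularized calculus is continuous for bounded pointwise convergence
  in the weak operator topology, and because continuous functionals separate points.
\<close>

section \<open>Cotype and random sets of indices\<close>

text \<open>
  The random signs in the definition of cotype are replaced by a bound \<open>K\<close> that is uniform in the
  signs, and the real exponent by a natural number, so that the power function is a polynomial.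
\<close>

definition sign_cotype :: "'x :: complex_normed_vector itself \<Rightarrow> nat \<Rightarrow> real \<Rightarrow> bool" where
  "sign_cotype _ q D \<longleftrightarrow> (\<forall>n K. \<forall>x :: nat \<Rightarrow> 'x.
    (\<forall>r. (\<forall>i<n. r i \<in> {-1, 1 :: real}) \<longrightarrow> norm (\<Sum>i<n. r i *\<^sub>R x i) \<le> K) \<longrightarrow>
    (\<Sum>i<n. norm (x i) ^ q) \<le> D * K ^ q)"

lemma sign_cotypeD:
  fixes x :: "nat \<Rightarrow> 'x :: complex_normed_vector"
  assumes "sign_cotype TYPE('x) q D"
    and "\<And>r :: nat \<Rightarrow> real. (\<And>i. i < n \<Longrightarrow> r i \<in> {-1, 1}) \<Longrightarrow> norm (\<Sum>i<n. r i *\<^sub>R x i) \<le> K"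
  shows "(\<Sum>i<n. norm (x i) ^ q) \<le> D * K ^ q"
  using assms unfolding sign_cotype_def by blast

text \<open>
  A cotype may be enlarged: once all \<open>norm (x i)\<close> are at most the right-hand side, raising the ratio to
  a larger exponent only decreases it. So the exponent can be rounded up to an even number, whose
  power function is convex on the whole line.
\<close>

lemma finite_cotype_even_power:
  assumes "finite_cotype TYPE('x :: complex_banach)"
  obtains m :: nat and D :: real where "m \<ge> 1" "D \<ge> 0"
    "sign_cotype TYPE('x) (2 * m) D"
proof -
  obtain q C where q: "q \<ge> 2" and cot: "\<And>n (x :: nat \<Rightarrow> 'x).
      (\<Sum>i<n. norm (x i) powr q) powr (1 / q) \<le>
        C * sqrt (measure_pmf.expectation (pmf_of_set ({..<n} \<rightarrow>\<^sub>E {-1, 1 :: real}))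
              (\<lambda>r. (norm (\<Sum>i<n. r i *\<^sub>R x i))\<^sup>2))"
    using assms unfolding finite_cotype_def has_cotype_def by blast
  define m where "m = nat \<lceil>q\<rceil>"
  have m: "m \<ge> 1" "q \<le> real (2 * m)"
    using q unfolding m_def by linarith+
  define B where "B = max C 1"
  have B: "B \<ge> 1" "C \<le> B" by (auto simp: B_def)
  have main: "(\<Sum>i<n. norm (x i) ^ (2 * m)) \<le> B ^ (2 * m) * K ^ (2 * m)"
    if K: "\<And>r. (\<And>i. i < n \<Longrightarrow> r i \<in> {-1, 1}) \<Longrightarrow> norm (\<Sum>i<n. r i *\<^sub>R x i) \<le> K" for n K and x :: "nat \<Rightarrow> 'x"
  proof -
    have "norm (\<Sum>i<n. (1 :: real) *\<^sub>R x i) \<le> K" by (rule K) simp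
    then have K0: "K \<ge> 0" by (rule order_trans[OF norm_ge_zero])
    let ?A = "{..<n} \<rightarrow>\<^sub>E {-1, 1 :: real}"
    have fin: "finite ?A" "?A \<noteq> {}" by (auto intro!: finite_PiE simp: PiE_eq_empty_iff)
    have "measure_pmf.expectation (pmf_of_set ?A) (\<lambda>r. (norm (\<Sum>i<n. r i *\<^sub>R x i))\<^sup>2) =
        (\<Sum>r\<in>?A. (norm (\<Sum>i<n. r i *\<^sub>R x i))\<^sup>2) / card ?A"
      using fin by (intro integral_pmf_of_set) auto
    also have "\<dots> \<le> (\<Sum>r\<in>?A. K\<^sup>2) / card ?A"
      by (intro divide_right_mono sum_mono power_mono K) (auto simp: PiE_iff)
    also have "\<dots> = K\<^sup>2" using fin by simp
    finally have "sqrt (measure_pmf.expectation (pmf_of_set ?A) (\<lambda>r. (norm (\<Sum>i<n. r i *\<^sub>R x i))\<^sup>2)) \<le> K"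
      using K0 by (intro real_le_lsqrt) auto
    moreover have "0 \<le> sqrt (measure_pmf.expectation (pmf_of_set ?A) (\<lambda>r. (norm (\<Sum>i<n. r i *\<^sub>R x i))\<^sup>2))"
      by (simp add: integral_nonneg_AE)
    ultimately have "C * sqrt (measure_pmf.expectation (pmf_of_set ?A) (\<lambda>r. (norm (\<Sum>i<n. r i *\<^sub>R x i))\<^sup>2)) \<le> B * K"
      using B by (intro mult_mono) simp_all
    with cot[where n = n and x = x] have 1: "(\<Sum>i<n. norm (x i) powr q) powr (1 / q) \<le> B * K"
      by (rule order_trans)
    have 2: "(\<Sum>i<n. norm (x i) powr q) \<le> (B * K) powr q"
    proof -
      have "((\<Sum>i<n. norm (x i) powr q) powr (1 / q)) powr q \<le> (B * K) powr q"
        using 1 q by (intro powr_mono2) auto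
      then show ?thesis using q by (simp add: powr_powr sum_nonneg)
    qed
    show ?thesis
    proof (cases "B * K = 0")
      case True
      then have "norm (x i) powr q \<le> 0" if "i < n" for i
        using 2 that member_le_sum[of i "{..<n}" "\<lambda>i. norm (x i) powr q"]
        by (metis True finite_lessThan lessThan_iff order_trans powr_0 powr_ge_zero)
      then have "norm (x i) = 0" if "i < n" for i using that powr_ge_zero[of "norm (x i)" q] by (metis antisym powr_eq_0_iff)
      then show ?thesis using m K0 B by (simp add: power_0_left)
    next
      case False
      then have BK: "B * K > 0" using B K0 by (simp add: order_less_le)
      have le: "norm (x i) powr q \<le> (B * K) powr q" if "i < n" for i
        using 2 member_le_sum[of i "{..<n}" "\<lambda>i. norm (x i) powr q"] that by auto
      have "norm (x i) ^ (2 * m) \<le> (B * K) ^ (2 * m) * (norm (x i) powr q / (B * K) powr q)" if "i < n" for i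
      proof (cases "x i = 0")
        case True then show ?thesis using m by (simp add: power_0_left)
      next
        case False
        define t where "t = norm (x i) / (B * K)"
        have "norm (x i) \<le> B * K"
          using le[OF that] q BK powr_less_mono2[of q "B * K" "norm (x i)"] by linarith
        then have t: "0 < t" "t \<le> 1" using BK False by (auto simp: t_def divide_simps)
        have "t powr real (2 * m) \<le> t powr q" using t m by (intro powr_mono') auto
        then have "t ^ (2 * m) \<le> t powr q" using t by (subst (asm) powr_realpow) auto
        moreover have "norm (x i) ^ (2 * m) = (B * K) ^ (2 * m) * t ^ (2 * m)"
          using BK by (auto simp: t_def simp flip: power_mult_distrib)
        moreover have "norm (x i) powr q / (B * K) powr q = t powr q"
          unfolding t_def by (rule powr_divide[symmetric])
        ultimately show ?thesis
          using BK mult_left_mono[of "t ^ (2 * m)" "t powr q" "(B * K) ^ (2 * m)"] by simp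
      qed
      then have "(\<Sum>i<n. norm (x i) ^ (2 * m)) \<le> (\<Sum>i<n. (B * K) ^ (2 * m) * (norm (x i) powr q / (B * K) powr q))"
        by (intro sum_mono) auto
      also have "\<dots> = (B * K) ^ (2 * m) * ((\<Sum>i<n. norm (x i) powr q) / (B * K) powr q)"
        by (simp only: sum_distrib_left sum_divide_distrib)
      also have "\<dots> \<le> (B * K) ^ (2 * m) * 1"
        using 2 BK by (intro mult_left_mono) (auto simp: divide_simps)
      finally show ?thesis by (simp add: power_mult_distrib)
    qed
  qed
  have "sign_cotype TYPE('x) (2 * m) (B ^ (2 * m))"
    unfolding sign_cotype_def using main by blast
  then show ?thesis using that[of m "B ^ (2 * m)"] m B by simp
qed

text \<open>
  The norm of the operator from \<open>\<ell>\<^sup>\<infinity>\<close> to \<open>'x\<close> with values \<open>y i\<close> at the unit vectors, restricted to the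
  coordinates in \<open>S\<close>. It depends on the set \<open>S\<close> only, which turns random multipliers into random sets.
\<close>

definition envelope :: "('i \<Rightarrow> 'x :: complex_normed_vector) \<Rightarrow> 'i set \<Rightarrow> real" where
  "envelope y S = (SUP v\<in>{v. \<forall>i. norm (v i) \<le> 1}. norm (\<Sum>i\<in>S. v i *\<^sub>C y i))"

lemma norm_sum_scaleC_le:
  assumes "\<And>i. i \<in> S \<Longrightarrow> norm (v i) \<le> t"
  shows "norm (\<Sum>i\<in>S. v i *\<^sub>C y i) \<le> t * (\<Sum>i\<in>S. norm (y i :: 'x :: complex_normed_vector))"
proof -
  have "norm (\<Sum>i\<in>S. v i *\<^sub>C y i) \<le> (\<Sum>i\<in>S. t * norm (y i))"
    using assms by (intro order_trans[OF norm_sum] sum_mono) (auto simp: norm_scaleC intro!: mult_right_mono)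
  then show ?thesis by (simp add: sum_distrib_left)
qed

lemma envelope_upper:
  assumes "\<And>i. norm (v i) \<le> 1"
  shows "norm (\<Sum>i\<in>S. v i *\<^sub>C y i) \<le> envelope y S"
  unfolding envelope_def
proof (rule cSUP_upper)
  show "bdd_above ((\<lambda>v. norm (\<Sum>i\<in>S. v i *\<^sub>C y i)) ` {v. \<forall>i. norm (v i) \<le> 1})"
  proof (rule bdd_aboveI2)
    show "norm (\<Sum>i\<in>S. v i *\<^sub>C y i) \<le> 1 * (\<Sum>i\<in>S. norm (y i))" if "v \<in> {v. \<forall>i. norm (v i) \<le> 1}" for v
      using that by (intro norm_sum_scaleC_le) auto
  qed
qed (use assms in auto)

lemma envelope_least:
  assumes "\<And>v. (\<And>i. norm (v i) \<le> 1) \<Longrightarrow> norm (\<Sum>i\<in>S. v i *\<^sub>C y i) \<le> B"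
  shows "envelope y S \<le> B"
  unfolding envelope_def by (rule cSUP_least) (use assms in \<open>auto intro!: exI[of _ "\<lambda>_. 0"]\<close>)

lemma envelope_nonneg: "envelope y S \<ge> 0"
  using envelope_upper[where v = "\<lambda>_. 0" and S = S and y = y] by simp

lemma envelope_scaled_upper:
  assumes "\<And>i. i \<in> S \<Longrightarrow> norm (c i) \<le> t"
  shows "norm (\<Sum>i\<in>S. c i *\<^sub>C y i) \<le> t * envelope y S"
proof (cases "t > 0")
  case True
  define v where "v = (\<lambda>i. if i \<in> S then c i / of_real t else 0)"
  have "norm (\<Sum>i\<in>S. v i *\<^sub>C y i) \<le> envelope y S"
    by (rule envelope_upper) (use True assms in \<open>auto simp: v_def norm_divide\<close>)
  moreover have "(\<Sum>i\<in>S. c i *\<^sub>C y i) = of_real t *\<^sub>C (\<Sum>i\<in>S. v i *\<^sub>C y i)"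
    unfolding complex_vector.scale_sum_right
    using True by (intro sum.cong) (auto simp: v_def scaleC_scaleC)
  ultimately show ?thesis using True by (simp add: norm_scaleC)
next
  case False
  then have "c i = 0" if "i \<in> S" for i
    using order_trans[OF assms[OF that], of 0] by simp
  moreover have "t = 0 \<or> S = {}" using False order_trans[OF norm_ge_zero assms] by fastforce
  moreover have "envelope y {} = 0"
    by (rule antisym[OF envelope_least envelope_nonneg]) simp
  ultimately show ?thesis by auto
qed

lemma envelope_power_least:
  assumes "q > 0" and "\<And>v. (\<And>i. norm (v i) \<le> 1) \<Longrightarrow> norm (\<Sum>i\<in>S. v i *\<^sub>C y i) ^ q \<le> B"
  shows "envelope y S ^ q \<le> B"
proof -
  have B0: "B \<ge> 0" using assms(2)[of "\<lambda>_. 0"] assms(1) by (simp add: power_0_left)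
  have "envelope y S \<le> root q B"
  proof (rule envelope_least)
    fix v :: "'a \<Rightarrow> complex" assume "\<And>i. norm (v i) \<le> 1"
    then have "root q (norm (\<Sum>i\<in>S. v i *\<^sub>C y i) ^ q) \<le> root q B"
      using assms by (intro real_root_le_mono) auto
    then show "norm (\<Sum>i\<in>S. v i *\<^sub>C y i) \<le> root q B"
      using assms(1) by (simp add: real_root_power_cancel)
  qed
  then have "envelope y S ^ q \<le> root q B ^ q" by (intro power_mono envelope_nonneg)
  then show ?thesis using B0 assms(1) by simp
qed

text \<open>
  The factor \<open>1 / 2\<close> replaces the discussion whether the supremum is attained.
\<close>

lemma envelope_near:
  obtains v where "\<And>i. norm (v i) \<le> 1" "envelope y S / 2 \<le> norm (\<Sum>i\<in>S. v i *\<^sub>C y i)"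
proof (cases "envelope y S > 0")
  case True
  then have "\<not> envelope y S \<le> envelope y S / 2" by simp
  then show ?thesis using envelope_least[where S = S and y = y and B = "envelope y S / 2"] that by (metis linear)
next
  case False
  then show ?thesis using that[of "\<lambda>_. 0"] by simp
qed

lemma norm_convex_power:
  fixes z :: "'s \<Rightarrow> 'x :: real_normed_vector"
  assumes q: "even q" and "finite A" "\<And>s. s \<in> A \<Longrightarrow> p s \<ge> 0" "(\<Sum>s\<in>A. p s) = 1"
  shows "norm (\<Sum>s\<in>A. p s *\<^sub>R z s) ^ q \<le> (\<Sum>s\<in>A. p s * norm (z s) ^ q)"
proof -
  have "norm (\<Sum>s\<in>A. p s *\<^sub>R z s) \<le> (\<Sum>s\<in>A. p s * norm (z s))"
    using assms by (intro order_trans[OF norm_sum] sum_mono) auto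
  then have "norm (\<Sum>s\<in>A. p s *\<^sub>R z s) ^ q \<le> (\<Sum>s\<in>A. p s *\<^sub>R norm (z s)) ^ q"
    by (intro power_mono) auto
  also have "\<dots> \<le> (\<Sum>s\<in>A. p s * norm (z s) ^ q)"
  proof -
    have "convex_on {0..} (\<lambda>x :: real. x ^ q)"
      by (rule convex_on_subset[OF convex_power_even[OF q]]) (auto)
    moreover have "A \<noteq> {}" using assms by auto
    ultimately show ?thesis using assms by (intro convex_on_sum[of A "{0..}"]) auto
  qed
  finally show ?thesis .
qed

text \<open>
  Here \<open>p\<close> is the law of a random subset of \<open>I\<close>. \<open>thin p I\<close> is the transition operator of the Markov
  chain that removes from the current set of free indices \<open>U\<close> an independent copy of the random set.
\<close>

definition thin :: "('i set \<Rightarrow> real) \<Rightarrow> 'i set \<Rightarrow> ('i set \<Rightarrow> real) \<Rightarrow> 'i set \<Rightarrow> real" where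
  "thin p I g U = (\<Sum>S\<in>Pow I. p S * g (U - S))"

text \<open>
  The expected total of \<open>f\<close> over the disjoint pieces that \<open>L\<close> successive copies of the random set
  cut out of \<open>U\<close>: each copy takes those of its indices that are still free. Recursion on \<open>L\<close> with
  finite sums makes a product of \<open>L\<close> copies of the probability space superfluous.
\<close>

primrec greedy :: "('i set \<Rightarrow> real) \<Rightarrow> 'i set \<Rightarrow> ('i set \<Rightarrow> real) \<Rightarrow> nat \<Rightarrow> 'i set \<Rightarrow> real" where
  "greedy p I f 0 U = 0"
| "greedy p I f (Suc L) U = (\<Sum>S\<in>Pow I. p S * f (S \<inter> U)) + thin p I (greedy p I f L) U"

text \<open>
  Cotype applied to the pieces. For the induction, \<open>x 0, ..., x (n - 1)\<close> are the vectors already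
  obtained from pieces outside \<open>U\<close>; the hypothesis says that they together with \<open>U\<close> still have
  uniformly bounded sums. A new piece \<open>S \<inter> U\<close> contributes one more vector and leaves \<open>U - S\<close> free, and
  every choice of signs and multipliers for the new configuration is one for the old.
\<close>

lemma greedy_upper:
  fixes y :: "'i \<Rightarrow> 'x :: complex_banach" and K D :: real and n :: nat and x :: "nat \<Rightarrow> 'x"
  assumes cot: "sign_cotype TYPE('x) q D"
    and q: "q > 0" and I: "finite I"
    and p: "\<And>S. p S \<ge> 0" "(\<Sum>S\<in>Pow I. p S) = 1"
    and U: "U \<subseteq> I"
    and K: "\<And>r v. (\<And>i. i < n \<Longrightarrow> r i \<in> {-1, 1}) \<Longrightarrow> (\<And>i. norm (v i) \<le> 1) \<Longrightarrow>
        norm ((\<Sum>i<n. r i *\<^sub>R x i) + (\<Sum>i\<in>U. v i *\<^sub>C y i)) \<le> K"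
  shows "(\<Sum>i<n. norm (x i) ^ q) + greedy p I (\<lambda>S. envelope y S ^ q) L U \<le> D * K ^ q"
  using U K
proof (induction L arbitrary: U n x)
  case 0
  have "norm (\<Sum>i<n. r i *\<^sub>R x i) \<le> K" if "\<And>i. i < n \<Longrightarrow> r i \<in> {-1, 1}" for r
    using "0.prems"(2)[of r "\<lambda>_. 0"] that by simp
  then show ?case using sign_cotypeD[OF cot, of n x K] by simp
next
  case (Suc L)
  let ?f = "\<lambda>S. envelope y S ^ q" and ?s = "\<Sum>i<n. norm (x i) ^ q"
  \<comment> \<open>By the induction hypothesis for the family extended by the vector that the piece contributes.\<close>
  have step: "?f (S \<inter> U) \<le> D * K ^ q - ?s - greedy p I ?f L (U - S)" if "S \<subseteq> I" for S
  proof (rule envelope_power_least[OF q])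
    fix w :: "'i \<Rightarrow> complex" assume w: "\<And>i. norm (w i) \<le> 1"
    define z where "z = (\<Sum>i\<in>S \<inter> U. w i *\<^sub>C y i)"
    have "(\<Sum>i<Suc n. norm ((x(n := z)) i) ^ q) + greedy p I ?f L (U - S) \<le> D * K ^ q"
    proof (rule Suc.IH)
      fix r :: "nat \<Rightarrow> real" and v :: "'i \<Rightarrow> complex"
      assume r: "\<And>i. i < Suc n \<Longrightarrow> r i \<in> {-1, 1}" and v: "\<And>i. norm (v i) \<le> 1"
      define v' where "v' i = (if i \<in> S then of_real (r n) * w i else v i)" for i
      have "norm (r n) = 1" using r[of n] by auto
      then have v': "norm (v' i) \<le> 1" for i using v[of i] w[of i] by (simp add: v'_def norm_mult)
      have finU: "finite U" using Suc.prems(1) I finite_subset by auto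
      have "(\<Sum>i\<in>U. v' i *\<^sub>C y i) = (\<Sum>i\<in>S \<inter> U. v' i *\<^sub>C y i) + (\<Sum>i\<in>U - S. v' i *\<^sub>C y i)"
        using finU by (subst sum.union_disjoint[symmetric]) (auto intro!: sum.cong)
      also have "(\<Sum>i\<in>S \<inter> U. v' i *\<^sub>C y i) = r n *\<^sub>R z"
        unfolding z_def scaleR_scaleC complex_vector.scale_sum_right
        by (intro sum.cong) (auto simp: v'_def scaleC_scaleC)
      also have "(\<Sum>i\<in>U - S. v' i *\<^sub>C y i) = (\<Sum>i\<in>U - S. v i *\<^sub>C y i)"
        by (intro sum.cong) (auto simp: v'_def)
      finally have "(\<Sum>i<Suc n. r i *\<^sub>R (x(n := z)) i) + (\<Sum>i\<in>U - S. v i *\<^sub>C y i)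
          = (\<Sum>i<n. r i *\<^sub>R x i) + (\<Sum>i\<in>U. v' i *\<^sub>C y i)"
        by (simp add: add.assoc)
      then show "norm ((\<Sum>i<Suc n. r i *\<^sub>R (x(n := z)) i) + (\<Sum>i\<in>U - S. v i *\<^sub>C y i)) \<le> K"
        using Suc.prems(2)[of r v'] r v' by (metis less_Suc_eq)
    qed (use Suc.prems(1) in auto)
    then show "norm (\<Sum>i\<in>S \<inter> U. w i *\<^sub>C y i) ^ q \<le> D * K ^ q - ?s - greedy p I ?f L (U - S)"
      by (simp add: z_def)
  qed
  have "?s + greedy p I ?f (Suc L) U = (\<Sum>S\<in>Pow I. p S) * ?s + (\<Sum>S\<in>Pow I. p S * (?f (S \<inter> U) + greedy p I ?f L (U - S)))"
    by (simp add: p thin_def distrib_left sum.distrib)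
  also have "\<dots> = (\<Sum>S\<in>Pow I. p S * (?s + ?f (S \<inter> U) + greedy p I ?f L (U - S)))"
    by (simp add: sum_distrib_right distrib_left sum.distrib)
  also have "\<dots> \<le> (\<Sum>S\<in>Pow I. p S * (D * K ^ q))"
    using step by (intro sum_mono mult_left_mono p) (auto simp: algebra_simps)
  also have "\<dots> = D * K ^ q" by (simp add: p flip: sum_distrib_right)
  finally show ?case .
qed

text \<open>
  An index \<open>i\<close> survives \<open>j\<close> removals with probability \<open>(1 - P i) ^ j\<close>, \<open>P i\<close> being the probability that the
  random set contains \<open>i\<close>. Replacing the random survivors by these weights decreases the expected power of
  the norm, by Jensen's inequality. The test multipliers \<open>v j S\<close> may depend on the step \<open>j\<close>, which
  later allows to cancel the weights.
\<close>

lemma greedy_lower: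
  fixes y :: "'i \<Rightarrow> 'x :: complex_banach"
  assumes q: "even q" and I: "finite I"
    and p: "\<And>S. p S \<ge> 0" "(\<Sum>S\<in>Pow I. p S) = 1"
    and v: "\<And>j S i. norm (v j S i) \<le> 1"
  shows "(\<Sum>j<L. \<Sum>S\<in>Pow I. p S * norm (\<Sum>i\<in>S \<inter> U. (v j S i * of_real (1 - (\<Sum>R | R \<subseteq> I \<and> i \<in> R. p R)) ^ j) *\<^sub>C y i) ^ q)
      \<le> greedy p I (\<lambda>S. envelope y S ^ q) L U"
  using v
proof (induction L arbitrary: v U)
  case 0 then show ?case by simp
next
  case (Suc L)
  define \<pi> where "\<pi> i = 1 - (\<Sum>R | R \<subseteq> I \<and> i \<in> R. p R)" for i
  define G where "G u U = (\<Sum>S\<in>Pow I. p S * norm (\<Sum>i\<in>S \<inter> U. u S i *\<^sub>C y i) ^ q)" for u U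
  let ?f = "\<lambda>S. envelope y S ^ q"
  have \<pi>: "\<pi> i = (\<Sum>R | R \<subseteq> I \<and> i \<notin> R. p R)" for i
  proof -
    have "(\<Sum>R\<in>Pow I. p R) = (\<Sum>R | R \<subseteq> I \<and> i \<in> R. p R) + (\<Sum>R | R \<subseteq> I \<and> i \<notin> R. p R)"
      using I by (subst sum.union_disjoint[symmetric]) (auto intro!: sum.cong)
    then show ?thesis using p by (simp add: \<pi>_def)
  qed
  have jensen: "G (\<lambda>S i. u S i * of_real (\<pi> i)) U \<le> thin p I (G u) U" for u U
  proof -
    have "norm (\<Sum>i\<in>S \<inter> U. (u S i * of_real (\<pi> i)) *\<^sub>C y i) ^ q
        \<le> (\<Sum>R\<in>Pow I. p R * norm (\<Sum>i\<in>S \<inter> (U - R). u S i *\<^sub>C y i) ^ q)" if "S \<subseteq> I" for S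
    proof -
      have fS: "finite S" using that I finite_subset by auto
      have "(\<Sum>R\<in>Pow I. p R *\<^sub>R (\<Sum>i\<in>S \<inter> (U - R). u S i *\<^sub>C y i))
          = (\<Sum>R\<in>Pow I. \<Sum>i\<in>S \<inter> U. if i \<notin> R then p R *\<^sub>R u S i *\<^sub>C y i else 0)"
      proof (intro sum.cong refl)
        fix R
        have "(\<Sum>i\<in>S \<inter> U. if i \<notin> R then p R *\<^sub>R u S i *\<^sub>C y i else 0) = (\<Sum>i\<in>S \<inter> (U - R). p R *\<^sub>R u S i *\<^sub>C y i)"
          using fS by (intro sum.mono_neutral_cong_right) auto
        then show "p R *\<^sub>R (\<Sum>i\<in>S \<inter> (U - R). u S i *\<^sub>C y i) = (\<Sum>i\<in>S \<inter> U. if i \<notin> R then p R *\<^sub>R u S i *\<^sub>C y i else 0)"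
          by (simp add: scaleR_sum_right)
      qed
      also have "\<dots> = (\<Sum>i\<in>S \<inter> U. \<Sum>R\<in>Pow I. if i \<notin> R then p R *\<^sub>R u S i *\<^sub>C y i else 0)"
        by (rule sum.swap)
      also have "\<dots> = (\<Sum>i\<in>S \<inter> U. (u S i * of_real (\<pi> i)) *\<^sub>C y i)"
      proof (intro sum.cong refl)
        fix i
        have "(\<Sum>R\<in>Pow I. if i \<notin> R then p R *\<^sub>R u S i *\<^sub>C y i else 0) = (\<Sum>R | R \<subseteq> I \<and> i \<notin> R. p R *\<^sub>R u S i *\<^sub>C y i)"
          using I by (intro sum.mono_neutral_cong_right) auto
        also have "\<dots> = \<pi> i *\<^sub>R u S i *\<^sub>C y i" by (simp add: \<pi> scaleR_sum_left)
        finally show "(\<Sum>R\<in>Pow I. if i \<notin> R then p R *\<^sub>R u S i *\<^sub>C y i else 0) = (u S i * of_real (\<pi> i)) *\<^sub>C y i"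
          by (simp add: scaleR_scaleC scaleC_scaleC mult.commute)
      qed
      finally show ?thesis
        using norm_convex_power[OF q, of "Pow I" p "\<lambda>R. \<Sum>i\<in>S \<inter> (U - R). u S i *\<^sub>C y i"] I p by simp
    qed
    then have "G (\<lambda>S i. u S i * of_real (\<pi> i)) U \<le>
        (\<Sum>S\<in>Pow I. p S * (\<Sum>R\<in>Pow I. p R * norm (\<Sum>i\<in>S \<inter> (U - R). u S i *\<^sub>C y i) ^ q))"
      unfolding G_def by (intro sum_mono mult_left_mono p) auto
    also have "\<dots> = thin p I (G u) U"
      unfolding thin_def G_def sum_distrib_left by (subst sum.swap) (simp add: mult.left_commute)
    finally show ?thesis .
  qed
  have "(\<Sum>j<Suc L. G (\<lambda>S i. v j S i * of_real (\<pi> i) ^ j) U)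
      = G (v 0) U + (\<Sum>j<L. G (\<lambda>S i. (v (Suc j) S i * of_real (\<pi> i) ^ j) * of_real (\<pi> i)) U)"
    by (subst sum.lessThan_Suc_shift) (simp add: mult.assoc mult.left_commute mult.commute)
  also have "\<dots> \<le> G (v 0) U + (\<Sum>j<L. thin p I (G (\<lambda>S i. v (Suc j) S i * of_real (\<pi> i) ^ j)) U)"
    by (intro add_left_mono sum_mono jensen)
  also have "(\<Sum>j<L. thin p I (G (\<lambda>S i. v (Suc j) S i * of_real (\<pi> i) ^ j)) U)
      = thin p I (\<lambda>U. \<Sum>j<L. G (\<lambda>S i. v (Suc j) S i * of_real (\<pi> i) ^ j) U) U"
    unfolding thin_def sum_distrib_left by (rule sum.swap)
  also have "\<dots> \<le> thin p I (greedy p I ?f L) U"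
    unfolding thin_def using Suc.IH[of "\<lambda>j. v (Suc j)"] Suc.prems
    by (intro sum_mono mult_left_mono p) (simp add: G_def \<pi>_def)
  also have "G (v 0) U \<le> (\<Sum>S\<in>Pow I. p S * ?f (S \<inter> U))"
    unfolding G_def by (intro sum_mono mult_left_mono p power_mono envelope_upper Suc.prems) auto
  finally show ?case by (simp add: G_def \<pi>_def)
qed

text \<open>
  With \<open>L\<close> about \<open>1 / (2 \<delta>)\<close> copies of the random set, \<open>j * \<delta> \<le> 1 / 2\<close> for all \<open>j < L\<close>, so the survival
  probabilities are at least \<open>1 / 2\<close> by Bernoulli's inequality. Hence \<open>L\<close> times the expectation is at
  most a constant, by \<open>greedy_lower\<close> and \<open>greedy_upper\<close>. For \<open>\<delta> > 1 / 4\<close> the trivial estimate suffices.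
\<close>

proposition random_set_envelope:
  fixes y :: "'i \<Rightarrow> 'x :: complex_banach" and K D :: real
  assumes cot: "sign_cotype TYPE('x) q D"
    and q: "even q" "q > 0" and D: "D \<ge> 0" and I: "finite I"
    and p: "\<And>S. p S \<ge> 0" "(\<Sum>S\<in>Pow I. p S) = 1"
    and \<delta>: "\<delta> > 0" "\<And>i. i \<in> I \<Longrightarrow> (\<Sum>S | S \<subseteq> I \<and> i \<in> S. p S) \<le> \<delta>"
    and K: "\<And>v. (\<And>i. norm (v i) \<le> 1) \<Longrightarrow> norm (\<Sum>i\<in>I. v i *\<^sub>C y i) \<le> K"
  shows "(\<Sum>S\<in>Pow I. p S * envelope y S ^ q) \<le> 4 ^ Suc q * (D + 1) * \<delta> * K ^ q"
proof (cases "\<delta> \<le> 1 / 4")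
  case True
  define P where "P i = (\<Sum>R | R \<subseteq> I \<and> i \<in> R. p R)" for i
  define L where "L = nat \<lfloor>1 / (2 * \<delta>)\<rfloor>"
  have "real L \<ge> 1 / (2 * \<delta>) - 1" using \<delta>(1) unfolding L_def by linarith
  then have L1: "real L * (4 * \<delta>) \<ge> 1" using True \<delta>(1) by (simp add: field_simps)
  have "real L \<le> 1 / (2 * \<delta>)" using \<delta>(1) unfolding L_def by simp
  then have L2: "real L * \<delta> \<le> 1 / 2" using \<delta>(1) by (simp add: field_simps)
  have half: "1 / 2 \<le> (1 - P i) ^ j" if "i \<in> I" "j < L" for i j
  proof -
    have P: "0 \<le> P i" "P i \<le> \<delta>" using \<delta>(2)[OF that(1)] p(1) by (auto simp: P_def intro: sum_nonneg)
    have "real j * P i \<le> real L * \<delta>" using that P by (intro mult_mono) auto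
    then show ?thesis using Bernoulli_inequality[of "- P i" j] L2 P True by simp
  qed
  have "\<exists>w. (\<forall>i. norm (w i) \<le> 1) \<and> envelope y S / 2 \<le> norm (\<Sum>i\<in>S. w i *\<^sub>C y i)" for S
    using envelope_near[of y S] by metis
  then obtain w where w: "\<And>S i. norm (w S i :: complex) \<le> 1"
      "\<And>S. envelope y S / 2 \<le> norm (\<Sum>i\<in>S. w S i *\<^sub>C y i)" by metis
  \<comment> \<open>The denominators cancel the survival probabilities; they are at least 1, so the multipliers stay bounded.\<close>
  define v where "v j S i = (if i \<in> I \<and> j < L then w S i / of_real (2 * (1 - P i) ^ j) else 0)" for j S i
  have v: "norm (v j S i) \<le> 1" for j S i
  proof (cases "i \<in> I \<and> j < L")
    case True
    then have h: "1 \<le> 2 * (1 - P i) ^ j" using half[of i j] by simp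
    have "norm (w S i / of_real (2 * (1 - P i) ^ j)) = norm (w S i) / (2 * (1 - P i) ^ j)"
      unfolding norm_divide norm_of_real using h by simp
    also have "\<dots> \<le> 1 / 1" using w(1)[of S i] h by (intro frac_le) auto
    finally show ?thesis using True by (simp add: v_def)
  qed (auto simp: v_def)
  have "real L * ((\<Sum>S\<in>Pow I. p S * envelope y S ^ q) / 4 ^ q) = (\<Sum>j<L. \<Sum>S\<in>Pow I. p S * (envelope y S / 2 / 2) ^ q)"
    by (simp add: power_divide sum_divide_distrib)
  also have "\<dots> \<le> (\<Sum>j<L. \<Sum>S\<in>Pow I. p S * norm (\<Sum>i\<in>S \<inter> I. (v j S i * of_real (1 - P i) ^ j) *\<^sub>C y i) ^ q)"
  proof (intro sum_mono mult_left_mono power_mono p)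
    fix j S assume jS: "j \<in> {..<L}" "S \<in> Pow I"
    have "(\<Sum>i\<in>S \<inter> I. (v j S i * of_real (1 - P i) ^ j) *\<^sub>C y i) = (\<Sum>i\<in>S. (1 / 2) *\<^sub>C (w S i *\<^sub>C y i))"
    proof (intro sum.cong)
      fix i assume "i \<in> S"
      then have i: "i \<in> I" using jS by auto
      have "(1 - P i) ^ j \<noteq> 0" using half[OF i, of j] jS by (metis half_gt_zero_iff lessThan_iff less_le_not_le zero_less_one)
      then have "v j S i * of_real (1 - P i) ^ j = (1 / 2) * w S i"
        using i jS by (simp add: v_def)
      then show "(v j S i * of_real (1 - P i) ^ j) *\<^sub>C y i = (1 / 2) *\<^sub>C (w S i *\<^sub>C y i)"
        by (simp only: scaleC_scaleC)
    qed (use jS in auto)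
    also have "\<dots> = (1 / 2) *\<^sub>C (\<Sum>i\<in>S. w S i *\<^sub>C y i)" by (simp only: complex_vector.scale_sum_right)
    finally show "envelope y S / 2 / 2 \<le> norm (\<Sum>i\<in>S \<inter> I. (v j S i * of_real (1 - P i) ^ j) *\<^sub>C y i)"
      using w(2)[of S] by (simp add: norm_scaleC norm_divide)
  qed (simp add: envelope_nonneg)
  also have "\<dots> \<le> greedy p I (\<lambda>S. envelope y S ^ q) L I"
    unfolding P_def by (rule greedy_lower[OF q(1) I p v])
  also have "\<dots> \<le> D * K ^ q"
    using greedy_upper[OF cot q(2) I p order_refl, where n = 0 and y = y and K = K and L = L] K by simp
  finally have main: "real L * (\<Sum>S\<in>Pow I. p S * envelope y S ^ q) \<le> 4 ^ q * (D * K ^ q)"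
    by (simp add: field_simps)
  let ?E = "\<Sum>S\<in>Pow I. p S * envelope y S ^ q"
  have E0: "?E \<ge> 0" by (intro sum_nonneg mult_nonneg_nonneg p zero_le_power envelope_nonneg)
  have "?E \<le> (real L * (4 * \<delta>)) * ?E" using L1 E0 mult_right_mono[of 1 "real L * (4 * \<delta>)" ?E] by simp
  also have "\<dots> = (4 * \<delta>) * (real L * ?E)" by simp
  also have "\<dots> \<le> (4 * \<delta>) * (4 ^ q * (D * K ^ q))" using main \<delta>(1) by (intro mult_left_mono) auto
  also have "\<dots> \<le> (4 * \<delta>) * (4 ^ q * ((D + 1) * K ^ q))"
    using \<delta>(1) q by (intro mult_left_mono mult_right_mono) (auto simp: zero_le_even_power)
  finally show ?thesis by (simp add: mult_ac)
next
  case False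
  have "(\<Sum>S\<in>Pow I. p S * envelope y S ^ q) \<le> (\<Sum>S\<in>Pow I. p S * K ^ q)"
  proof (intro sum_mono mult_left_mono power_mono p envelope_nonneg envelope_least)
    fix S and v :: "'i \<Rightarrow> complex" assume S: "S \<in> Pow I" and v: "\<And>i. norm (v i) \<le> 1"
    have "(\<Sum>i\<in>I. (if i \<in> S then v i else 0) *\<^sub>C y i) = (\<Sum>i\<in>S. v i *\<^sub>C y i)"
      using S I by (intro sum.mono_neutral_cong_right) auto
    then show "norm (\<Sum>i\<in>S. v i *\<^sub>C y i) \<le> K" using K[of "\<lambda>i. if i \<in> S then v i else 0"] v by simp
  qed
  also have "\<dots> = 1 * K ^ q" by (simp add: p flip: sum_distrib_right)
  also have "\<dots> \<le> (4 ^ Suc q * (D + 1) * \<delta>) * K ^ q"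
  proof (rule mult_right_mono)
    have "1 \<le> (4 ^ q * (D + 1)) * (4 * \<delta>)"
      using False D mult_mono[of 1 "4 ^ q * (D + 1)" 1 "4 * \<delta>"] mult_mono[of 1 "4 ^ q :: real" 1 "D + 1"] by simp
    then show "1 \<le> 4 ^ Suc q * (D + 1) * \<delta>" by (simp add: mult_ac)
  qed (use q in \<open>auto simp: zero_le_even_power\<close>)
  finally show ?thesis .
qed

section \<open>Multipliers with exponential tails\<close>

lemma nn_integral_exp_std_real_gaussian:
  "(\<integral>\<^sup>+x. ennreal (exp (a * x)) \<partial>std_real_gaussian) = ennreal (exp (a\<^sup>2 / 2))"
proof -
  have "(\<integral>\<^sup>+x. ennreal (exp (a * x)) \<partial>std_real_gaussian)
      = (\<integral>\<^sup>+x. ennreal (std_normal_density x) * ennreal (exp (a * x)) \<partial>lborel)"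
    unfolding std_real_gaussian_def by (rule nn_integral_density) auto
  also have "\<dots> = (\<integral>\<^sup>+x. ennreal (exp (a\<^sup>2 / 2)) * ennreal (normal_density a 1 x) \<partial>lborel)"
  proof (rule nn_integral_cong)
    fix x :: real
    have "exp (- x\<^sup>2 / 2) * exp (a * x) = exp (a\<^sup>2 / 2) * exp (- (x - a)\<^sup>2 / 2)"
      by (simp add: exp_add[symmetric] power2_eq_square field_simps)
    then have "std_normal_density x * exp (a * x) = exp (a\<^sup>2 / 2) * normal_density a 1 x"
      by (simp add: normal_density_def field_simps)
    then show "ennreal (std_normal_density x) * ennreal (exp (a * x)) = ennreal (exp (a\<^sup>2 / 2)) * ennreal (normal_density a 1 x)"
      by (simp flip: ennreal_mult)
  qed
  also have "\<dots> = ennreal (exp (a\<^sup>2 / 2)) * (\<integral>\<^sup>+x. ennreal (normal_density a 1 x) \<partial>lborel)"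
    by (rule nn_integral_cmult) auto
  also have "(\<integral>\<^sup>+x. ennreal (normal_density a 1 x) \<partial>lborel) = 1"
    using prob_space.emeasure_space_1[OF prob_space_normal_density[of 1 a]] by (simp add: emeasure_density)
  finally show ?thesis by simp
qed

lemma nn_integral_exp_std_complex_gaussian:
  "(\<integral>\<^sup>+z. ennreal (exp (Re (z * c))) \<partial>std_complex_gaussian) = ennreal (exp ((norm c)\<^sup>2 / 2))"
proof -
  let ?N = "std_real_gaussian"
  interpret A: prob_space ?N by (rule prob_space_std_real_gaussian)
  interpret P: pair_prob_space ?N ?N ..
  have "(\<integral>\<^sup>+z. ennreal (exp (Re (z * c))) \<partial>std_complex_gaussian)
      = (\<integral>\<^sup>+p. ennreal (exp (Re ((case p of (a, b) \<Rightarrow> Complex a b) * c))) \<partial>(?N \<Otimes>\<^sub>M ?N))"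
    unfolding std_complex_gaussian_def
    by (rule nn_integral_distr[OF borel_measurable_Complex_pair]) measurable
  also have "\<dots> = (\<integral>\<^sup>+p. ennreal (exp (Re c * fst p)) * ennreal (exp (- Im c * snd p)) \<partial>(?N \<Otimes>\<^sub>M ?N))"
    by (intro nn_integral_cong) (auto simp: exp_add[symmetric] mult.commute simp flip: ennreal_mult)
  also have "\<dots> = (\<integral>\<^sup>+x. (\<integral>\<^sup>+y. ennreal (exp (Re c * x)) * ennreal (exp (- Im c * y)) \<partial>?N) \<partial>?N)"
    by (subst A.nn_integral_fst[symmetric]) (auto simp: )
  also have "\<dots> = ennreal (exp ((Re c)\<^sup>2 / 2)) * ennreal (exp ((- Im c)\<^sup>2 / 2))"
    by (simp add: nn_integral_cmult nn_integral_multc nn_integral_exp_std_real_gaussian[of "- Im c", simplified]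
        nn_integral_exp_std_real_gaussian[of "Re c"])
  also have "\<dots> = ennreal (exp ((norm c)\<^sup>2 / 2))"
    by (simp add: cmod_power2 add_divide_distrib exp_add flip: ennreal_mult)
  finally show ?thesis .
qed

lemma nn_integral_exp_gaussian_sum:
  assumes F: "finite F"
  shows "(\<integral>\<^sup>+\<omega>. ennreal (exp (Re (\<Sum>e\<in>F. \<omega> e * c e))) \<partial>(\<Pi>\<^sub>M e\<in>F. std_complex_gaussian))
    = ennreal (exp ((\<Sum>e\<in>F. (norm (c e))\<^sup>2) / 2))"
proof -
  interpret product_prob_space "\<lambda>_. std_complex_gaussian" F
    by (simp add: product_prob_space_def product_sigma_finite_def product_prob_space_axioms_def
        prob_space_std_complex_gaussian prob_space_imp_sigma_finite)
  have "(\<integral>\<^sup>+\<omega>. ennreal (exp (Re (\<Sum>e\<in>F. \<omega> e * c e))) \<partial>(\<Pi>\<^sub>M e\<in>F. std_complex_gaussian))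
      = (\<integral>\<^sup>+\<omega>. (\<Prod>e\<in>F. ennreal (exp (Re (\<omega> e * c e)))) \<partial>(\<Pi>\<^sub>M e\<in>F. std_complex_gaussian))"
    using F by (simp add: exp_sum Re_sum prod_ennreal del: times_complex.sel)
  also have "\<dots> = (\<Prod>e\<in>F. \<integral>\<^sup>+z. ennreal (exp (Re (z * c e))) \<partial>std_complex_gaussian)"
    by (rule product_nn_integral_prod[OF F]) measurable
  also have "\<dots> = (\<Prod>e\<in>F. ennreal (exp ((norm (c e))\<^sup>2 / 2)))"
    by (simp only: nn_integral_exp_std_complex_gaussian)
  also have "\<dots> = ennreal (exp ((\<Sum>e\<in>F. (norm (c e))\<^sup>2) / 2))"
    using F by (simp add: prod_ennreal exp_sum sum_divide_distrib)
  finally show ?thesis .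
qed

lemma prob_space_gaussian: "prob_space (\<Pi>\<^sub>M e\<in>F. std_complex_gaussian)"
  by (intro prob_space_PiM prob_space_std_complex_gaussian)

text \<open>
  The exponential moments of the real and the imaginary part are those of a Gaussian variable, and
  the modulus is at most the sum of their absolute values; Markov's inequality gives the tail.
\<close>

lemma gaussian_sum_tail:
  assumes F: "finite F" and c: "(\<Sum>e\<in>F. (norm (c e))\<^sup>2) \<le> 1"
  shows "measure (\<Pi>\<^sub>M e\<in>F. std_complex_gaussian)
      {\<omega> \<in> space (\<Pi>\<^sub>M e\<in>F. std_complex_gaussian). t \<le> norm (\<Sum>e\<in>F. \<omega> e * c e)} \<le> 4 * exp (- t / 2)"
proof -
  let ?M = "\<Pi>\<^sub>M e\<in>F. std_complex_gaussian"
  interpret prob_space ?M by (rule prob_space_gaussian)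
  define s where "s \<omega> = (\<Sum>e\<in>F. \<omega> e * c e)" for \<omega>
  have s [measurable]: "s \<in> borel_measurable ?M" unfolding s_def by measurable
  have E: "(\<integral>\<^sup>+\<omega>. ennreal (exp (Re (u * s \<omega>))) \<partial>?M) \<le> ennreal 2" if "norm u = 1" for u
  proof -
    have "(\<integral>\<^sup>+\<omega>. ennreal (exp (Re (u * s \<omega>))) \<partial>?M) = (\<integral>\<^sup>+\<omega>. ennreal (exp (Re (\<Sum>e\<in>F. \<omega> e * (u * c e)))) \<partial>?M)"
      by (simp add: s_def sum_distrib_left mult.left_commute del: times_complex.sel)
    also have "\<dots> = ennreal (exp ((\<Sum>e\<in>F. (norm (c e))\<^sup>2) / 2))"
      using nn_integral_exp_gaussian_sum[OF F, of "\<lambda>e. u * c e"] that by (simp add: norm_mult)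
    also have "\<dots> \<le> ennreal 2"
    proof (rule ennreal_leI)
      have "exp ((\<Sum>e\<in>F. (norm (c e))\<^sup>2) / 2) \<le> exp (1 / 2 :: real)" using c by simp
      also have "\<dots> \<le> 2"
        using exp_bound[of "1 / 2 :: real"] by (simp add: power2_eq_square)
      finally show "exp ((\<Sum>e\<in>F. (norm (c e))\<^sup>2) / 2) \<le> 2" .
    qed
    finally show ?thesis .
  qed
  \<comment> \<open>Convexity of the exponential, and \<open>exp \<bar>x\<bar> \<le> exp x + exp (- x)\<close>.\<close>
  have pt: "exp (norm z / 2) \<le> (exp (Re (1 * z)) + exp (Re (- 1 * z)) + exp (Re (\<i> * z)) + exp (Re (- \<i> * z))) / 2" for z
  proof -
    have amgm: "exp ((x + y) / 2) \<le> (exp x + exp y) / 2" for x y :: real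
    proof -
      have "exp ((x + y) / 2) = exp (x / 2) * exp (y / 2)" by (simp add: exp_add[symmetric] add_divide_distrib)
      also have "\<dots> \<le> ((exp (x / 2))\<^sup>2 + (exp (y / 2))\<^sup>2) / 2"
        using sum_squares_bound[of "exp (x / 2)" "exp (y / 2)"] by simp
      also have "\<dots> = (exp x + exp y) / 2" by (simp add: exp_double[symmetric])
      finally show ?thesis .
    qed
    have ab: "exp \<bar>x\<bar> \<le> exp x + exp (- x)" for x :: real by (cases "x \<ge> 0") (auto simp: abs_if)
    have "exp (norm z / 2) \<le> exp ((\<bar>Re z\<bar> + \<bar>Im z\<bar>) / 2)" using cmod_le[of z] by simp
    also have "\<dots> \<le> (exp \<bar>Re z\<bar> + exp \<bar>Im z\<bar>) / 2" by (rule amgm)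
    also have "\<dots> \<le> ((exp (Re z) + exp (- Re z)) + (exp (Im z) + exp (- Im z))) / 2"
      using ab[of "Re z"] ab[of "Im z"] by simp
    finally show ?thesis by (simp add: algebra_simps)
  qed
  have "ennreal (exp (t / 2)) * emeasure ?M {\<omega> \<in> space ?M. t \<le> norm (s \<omega>)}
      = (\<integral>\<^sup>+\<omega>. ennreal (exp (t / 2)) * indicator {\<omega> \<in> space ?M. t \<le> norm (s \<omega>)} \<omega> \<partial>?M)"
    by (subst nn_integral_cmult_indicator) auto
  also have "\<dots> \<le> (\<integral>\<^sup>+\<omega>. ennreal (1 / 2) * (ennreal (exp (Re (1 * s \<omega>))) + ennreal (exp (Re (- 1 * s \<omega>)))
      + ennreal (exp (Re (\<i> * s \<omega>))) + ennreal (exp (Re (- \<i> * s \<omega>)))) \<partial>?M)"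
  proof (rule nn_integral_mono)
    fix \<omega>
    have "exp (t / 2) \<le> (exp (Re (1 * s \<omega>)) + exp (Re (- 1 * s \<omega>)) + exp (Re (\<i> * s \<omega>)) + exp (Re (- \<i> * s \<omega>))) / 2"
      if "t \<le> norm (s \<omega>)"
      by (rule order_trans[OF _ pt]) (use that in simp)
    moreover have "ennreal ((a + b + c + d) / 2) = ennreal (1 / 2) * (ennreal a + ennreal b + ennreal c + ennreal d)"
      if "a \<ge> 0" "b \<ge> 0" "c \<ge> 0" "d \<ge> 0" for a b c d
    proof -
      have "ennreal (1 / 2 * (a + b + c + d)) = ennreal (1 / 2) * ennreal (a + b + c + d)"
        by (rule ennreal_mult') simp
      then show ?thesis using that by simp
    qed
    ultimately have "ennreal (exp (t / 2)) \<le> ennreal (1 / 2) * (ennreal (exp (Re (1 * s \<omega>))) + ennreal (exp (Re (- 1 * s \<omega>)))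
      + ennreal (exp (Re (\<i> * s \<omega>))) + ennreal (exp (Re (- \<i> * s \<omega>))))" if "t \<le> norm (s \<omega>)"
      using that ennreal_leI by (metis exp_ge_zero)
    then show "ennreal (exp (t / 2)) * indicator {\<omega> \<in> space ?M. t \<le> norm (s \<omega>)} \<omega>
       \<le> ennreal (1 / 2) * (ennreal (exp (Re (1 * s \<omega>))) + ennreal (exp (Re (- 1 * s \<omega>)))
      + ennreal (exp (Re (\<i> * s \<omega>))) + ennreal (exp (Re (- \<i> * s \<omega>))))"
      by (cases "\<omega> \<in> {\<omega> \<in> space ?M. t \<le> norm (s \<omega>)}") (simp_all only: indicator_simps mult_1_right mult_zero_right zero_le mem_Collect_eq simp_thms)
  qed
  also have "\<dots> = ennreal (1 / 2) * ((\<integral>\<^sup>+\<omega>. ennreal (exp (Re (1 * s \<omega>))) \<partial>?M) + (\<integral>\<^sup>+\<omega>. ennreal (exp (Re (- 1 * s \<omega>))) \<partial>?M)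
      + (\<integral>\<^sup>+\<omega>. ennreal (exp (Re (\<i> * s \<omega>))) \<partial>?M) + (\<integral>\<^sup>+\<omega>. ennreal (exp (Re (- \<i> * s \<omega>))) \<partial>?M))"
    by (subst nn_integral_cmult, measurable) (subst nn_integral_add, measurable)+
  also have "\<dots> \<le> ennreal (1 / 2) * (ennreal 2 + ennreal 2 + ennreal 2 + ennreal 2)"
    by (intro mult_left_mono add_mono E) auto
  also have "\<dots> = ennreal (1 / 2) * ennreal 8" by simp
  also have "\<dots> = ennreal (1 / 2 * 8)" by (rule ennreal_mult'[symmetric]) simp
  also have "\<dots> = ennreal 4" by simp
  finally have "ennreal (exp (t / 2) * prob {\<omega> \<in> space ?M. t \<le> norm (s \<omega>)}) \<le> ennreal 4"
    by (simp add: emeasure_eq_measure flip: ennreal_mult)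
  then have "exp (t / 2) * prob {\<omega> \<in> space ?M. t \<le> norm (s \<omega>)} \<le> 4"
    by (subst (asm) ennreal_le_iff) auto
  then show ?thesis by (simp add: s_def exp_minus field_simps)
qed

lemma random_set_law:
  assumes "prob_space M" and I: "finite I"
    and A: "\<And>S. {\<omega> \<in> space M. A \<omega> = S} \<in> sets M" "\<And>\<omega>. A \<omega> \<subseteq> I"
    and g: "\<And>S. (g S :: real) \<ge> 0"
  shows "(\<integral>\<^sup>+\<omega>. ennreal (g (A \<omega>)) \<partial>M) = ennreal (\<Sum>S\<in>Pow I. measure M {\<omega> \<in> space M. A \<omega> = S} * g S)"
proof -
  interpret prob_space M by fact
  have "(\<integral>\<^sup>+\<omega>. ennreal (g (A \<omega>)) \<partial>M)
      = (\<integral>\<^sup>+\<omega>. (\<Sum>S\<in>Pow I. ennreal (g S) * indicator {\<omega> \<in> space M. A \<omega> = S} \<omega>) \<partial>M)"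
  proof (rule nn_integral_cong)
    fix \<omega> assume \<omega>: "\<omega> \<in> space M"
    have "(\<Sum>S\<in>Pow I. ennreal (g S) * indicator {\<omega> \<in> space M. A \<omega> = S} \<omega>)
        = (\<Sum>S\<in>Pow I. if S = A \<omega> then ennreal (g (A \<omega>)) else 0)"
      using \<omega> by (intro sum.cong) auto
    also have "\<dots> = ennreal (g (A \<omega>))" using I A(2)[of \<omega>] by simp
    finally show "ennreal (g (A \<omega>)) = (\<Sum>S\<in>Pow I. ennreal (g S) * indicator {\<omega> \<in> space M. A \<omega> = S} \<omega>)" by simp
  qed
  also have "\<dots> = (\<Sum>S\<in>Pow I. ennreal (g S) * emeasure M {\<omega> \<in> space M. A \<omega> = S})"
    using A(1) by (subst nn_integral_sum) (auto simp: nn_integral_cmult_indicator intro!: borel_measurable_times)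
  also have "\<dots> = (\<Sum>S\<in>Pow I. ennreal (measure M {\<omega> \<in> space M. A \<omega> = S} * g S))"
    using g by (simp add: emeasure_eq_measure ennreal_mult mult.commute)
  also have "\<dots> = ennreal (\<Sum>S\<in>Pow I. measure M {\<omega> \<in> space M. A \<omega> = S} * g S)"
    using g by (intro sum_ennreal) auto
  finally show ?thesis .
qed

lemma summable_poly_geometric:
  fixes \<theta> :: real
  assumes "0 < \<theta>" "\<theta> < 1"
  shows "summable (\<lambda>k. (real k + 1) ^ 4 * \<theta> ^ k)"
proof (rule summable_comparison_test_bigo)
  have "(\<lambda>k. (real k + 1) ^ 4 * exp (real k * ln \<theta>)) \<in> O(\<lambda>k. 1 / real k ^ 2)"
    using assms by real_asymp
  then show "(\<lambda>k. (real k + 1) ^ 4 * \<theta> ^ k) \<in> O(\<lambda>k. 1 / real k ^ 2)"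
    using assms by (simp add: exp_of_nat_mult)
  show "summable (\<lambda>k. norm (1 / real k ^ 2))"
    using inverse_power_summable[of 2, where 'a = real] by (simp add: inverse_eq_divide power_one_over)
qed

text \<open>
  Turns a bound of order \<open>s ^ m\<close> for the moment of order \<open>2 * m\<close> into one of order \<open>s\<close> for the second
  moment, as Hoelder's inequality would: either \<open>z\<^sup>2 \<le> s\<close> or the higher power dominates (for \<open>K = 1\<close>).
\<close>

lemma square_le_split:
  fixes z s K :: real
  assumes "z \<ge> 0" "K > 0" "s > 0" "m \<ge> 1"
  shows "z\<^sup>2 \<le> K\<^sup>2 * (s + z ^ (2 * m) / (K ^ (2 * m) * s ^ (m - 1)))"
proof -
  define u where "u = (z / K)\<^sup>2"
  have u: "u \<ge> 0" by (simp add: u_def)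
  have "u \<le> s + u ^ m / s ^ (m - 1)"
  proof (cases "u \<le> s")
    case True then show ?thesis using u assms by (simp add: add_increasing2)
  next
    case False
    have "u * s ^ (m - 1) \<le> u * u ^ (m - 1)" using False u assms by (intro mult_left_mono power_mono) auto
    also have "\<dots> = u ^ m" using assms by (simp add: power_eq_if)
    finally have "u \<le> u ^ m / s ^ (m - 1)" using assms by (simp add: field_simps)
    then show ?thesis using assms by simp
  qed
  then have "K\<^sup>2 * u \<le> K\<^sup>2 * (s + u ^ m / s ^ (m - 1))" by (intro mult_left_mono) auto
  moreover have "K\<^sup>2 * u = z\<^sup>2" using assms by (simp add: u_def power_divide)
  moreover have "u ^ m = z ^ (2 * m) / K ^ (2 * m)" by (simp add: u_def power_divide flip: power_mult)
  ultimately show ?thesis by simp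
qed

text \<open>
  The factors come from the Cauchy-Schwarz inequality over the layers, from the moment of a
  single layer, and from the summation over the layers. The constant depends on the cotype data
  alone, so it can be fixed before the operator, the Hilbert space and the orthonormal system.
\<close>

definition multiplier_const :: "nat \<Rightarrow> real \<Rightarrow> real" where
  "multiplier_const m D = (\<Sum>k. 1 / (real k + 1)\<^sup>2) * (1 + 4 ^ Suc (2 * m) * (D + 1) * 4) *
    (\<Sum>k. (real k + 1) ^ 4 * exp (- (1 / (2 * real m))) ^ k)"

lemma summable_inverse_squares: "summable (\<lambda>k. 1 / (real k + 1)\<^sup>2)"
  using inverse_squares_sums by (simp add: add.commute sums_iff)

lemma multiplier_const_nonneg:
  assumes "m \<ge> 1" "D \<ge> 0"
  shows "multiplier_const m D \<ge> 0"
  unfolding multiplier_const_def using assms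
  by (intro mult_nonneg_nonneg suminf_nonneg summable_inverse_squares summable_poly_geometric) auto

text \<open>
  The multipliers may depend on each other in any way. In layer \<open>k\<close>, where \<open>\<bar>a i\<bar>\<close> lies in \<open>[k, k + 1)\<close>, the
  sum is at most \<open>k + 1\<close> times the envelope of the layer, whose second moment decays like \<open>\<theta> ^ k\<close> by
  \<open>random_set_envelope\<close> and \<open>square_le_split\<close>.
\<close>

proposition exponential_tail_multipliers:
  fixes a :: "'i \<Rightarrow> 'w \<Rightarrow> complex" and y :: "'i \<Rightarrow> 'x :: complex_banach" and K :: real
  assumes cot: "sign_cotype TYPE('x) (2 * m) D" and m: "m \<ge> 1" and D: "D \<ge> 0"
    and M: "prob_space M" and I: "finite I"
    and meas: "\<And>i. i \<in> I \<Longrightarrow> a i \<in> borel_measurable M"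
    and tail: "\<And>i t. i \<in> I \<Longrightarrow> measure M {\<omega> \<in> space M. t \<le> norm (a i \<omega>)} \<le> 4 * exp (- t / 2)"
    and K: "\<And>v. (\<And>i. norm (v i) \<le> 1) \<Longrightarrow> norm (\<Sum>i\<in>I. v i *\<^sub>C y i) \<le> K"
  shows "(\<integral>\<^sup>+\<omega>. ennreal ((norm (\<Sum>i\<in>I. a i \<omega> *\<^sub>C y i))\<^sup>2) \<partial>M) \<le> ennreal (multiplier_const m D * K\<^sup>2)"
proof -
  define D' where "D' = 4 ^ Suc (2 * m) * (D + 1) * 4"
  define \<theta> where "\<theta> = exp (- (1 / (2 * real m)))"
  define W where "W = (\<Sum>k. 1 / (real k + 1)\<^sup>2)"
  define C where "C = multiplier_const m D"
  have C_def': "C = W * (1 + D') * (\<Sum>k. (real k + 1) ^ 4 * \<theta> ^ k)"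
    by (simp only: C_def multiplier_const_def W_def D'_def \<theta>_def)
  have \<theta>: "0 < \<theta>" "\<theta> < 1" using m by (auto simp: \<theta>_def)
  note sum\<theta> = summable_poly_geometric[OF \<theta>] and sumW = summable_inverse_squares
  have W0: "W \<ge> 0" unfolding W_def by (rule suminf_nonneg[OF sumW]) simp
  have D'0: "D' \<ge> 0" using D by (simp add: D'_def)
  interpret prob_space M by fact
  have Kenv: "envelope y I \<le> K" by (rule envelope_least) (rule K)
  have "(\<integral>\<^sup>+\<omega>. ennreal ((norm (\<Sum>i\<in>I. a i \<omega> *\<^sub>C y i))\<^sup>2) \<partial>M) \<le> ennreal (C * K\<^sup>2)"
  proof (cases "K > 0")
    case False
    have "norm (\<Sum>i\<in>I. a i \<omega> *\<^sub>C y i) \<le> (\<Sum>i\<in>I. norm (a i \<omega>)) * envelope y I" for \<omega>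
      by (rule envelope_scaled_upper) (use I in \<open>auto intro: member_le_sum\<close>)
    moreover have "envelope y I = 0" using Kenv False envelope_nonneg[of y I] by linarith
    ultimately show ?thesis by simp
  next
    case K0: True
    define A where "A k \<omega> = {i \<in> I. nat \<lfloor>norm (a i \<omega>)\<rfloor> = k}" for k \<omega>
    have A_sub: "A k \<omega> \<subseteq> I" for k \<omega> by (auto simp: A_def)
    have A_meas: "{\<omega> \<in> space M. A k \<omega> = S} \<in> sets M" for k S
    proof (cases "S \<subseteq> I")
      case True
      have "{\<omega> \<in> space M. A k \<omega> = S} = {\<omega> \<in> space M. \<forall>i\<in>I. (nat \<lfloor>norm (a i \<omega>)\<rfloor> = k) = (i \<in> S)}"
        using True by (auto simp: A_def)
      also have "\<dots> \<in> sets M" using I meas by measurable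
      finally show ?thesis .
    next
      case False
      then have "{\<omega> \<in> space M. A k \<omega> = S} = {}" using A_sub by auto
      then show ?thesis by (simp only: sets.empty_sets)
    qed
    define p where "p k S = measure M {\<omega> \<in> space M. A k \<omega> = S}" for k S
    have law: "(\<integral>\<^sup>+\<omega>. ennreal (g (A k \<omega>)) \<partial>M) = ennreal (\<Sum>S\<in>Pow I. p k S * g S)" if "\<And>S. g S \<ge> 0" for k g
      unfolding p_def by (rule random_set_law[OF M I A_meas A_sub that])
    have p0: "p k S \<ge> 0" for k S by (simp add: p_def)
    have p1: "(\<Sum>S\<in>Pow I. p k S) = 1" for k
      using law[of "\<lambda>_. 1" k] emeasure_space_1 p0 by (simp add: sum_nonneg)
    have p\<delta>: "(\<Sum>S | S \<subseteq> I \<and> i \<in> S. p k S) \<le> 4 * exp (- real k / 2)" if "i \<in> I" for i k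
    proof -
      have "ennreal (\<Sum>S | S \<subseteq> I \<and> i \<in> S. p k S) = ennreal (\<Sum>S\<in>Pow I. p k S * indicator {S. i \<in> S} S)"
        using I by (intro arg_cong[where f = ennreal] sum.mono_neutral_cong_left) (auto simp: indicator_def)
      also have "\<dots> = (\<integral>\<^sup>+\<omega>. ennreal (indicator {S. i \<in> S} (A k \<omega>)) \<partial>M)"
        by (rule law[symmetric]) simp
      also have "\<dots> \<le> (\<integral>\<^sup>+\<omega>. indicator {\<omega> \<in> space M. real k \<le> norm (a i \<omega>)} \<omega> \<partial>M)"
        by (intro nn_integral_mono) (auto simp: indicator_def A_def)
      also have "\<dots> = ennreal (measure M {\<omega> \<in> space M. real k \<le> norm (a i \<omega>)})"
        using meas[OF that] by (simp add: emeasure_eq_measure)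
      finally show ?thesis using tail[OF that, of "real k"] by simp
    qed
    \<comment> \<open>\<open>square_le_split\<close> with \<open>s = \<theta> ^ k\<close>, chosen so that \<open>s ^ m\<close> is the decay of the probabilities.\<close>
    have E2: "(\<Sum>S\<in>Pow I. p k S * (envelope y S)\<^sup>2) \<le> K\<^sup>2 * (1 + D') * \<theta> ^ k" for k
    proof -
      let ?s = "\<theta> ^ k"
      have sm: "?s ^ m = exp (- real k / 2)"
        using m by (simp add: \<theta>_def flip: exp_of_nat_mult)
      have s0: "?s > 0" using \<theta> by simp
      have q: "(\<Sum>S\<in>Pow I. p k S * envelope y S ^ (2 * m)) \<le> 4 ^ Suc (2 * m) * (D + 1) * (4 * exp (- real k / 2)) * K ^ (2 * m)"
        by (rule random_set_envelope[OF cot _ _ D I p0 p1 _ p\<delta> K]) (use m in auto)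
      have "(\<Sum>S\<in>Pow I. p k S * (envelope y S)\<^sup>2)
          \<le> (\<Sum>S\<in>Pow I. p k S * (K\<^sup>2 * (?s + envelope y S ^ (2 * m) / (K ^ (2 * m) * ?s ^ (m - 1)))))"
        by (intro sum_mono mult_left_mono square_le_split p0 envelope_nonneg K0 s0 m)
      also have "\<dots> = K\<^sup>2 * ((\<Sum>S\<in>Pow I. p k S) * ?s + (\<Sum>S\<in>Pow I. p k S * envelope y S ^ (2 * m)) / (K ^ (2 * m) * ?s ^ (m - 1)))"
        by (simp add: sum_distrib_left sum_distrib_right sum_divide_distrib sum.distrib algebra_simps)
      also have "\<dots> \<le> K\<^sup>2 * (1 * ?s + (D' * exp (- real k / 2) * K ^ (2 * m)) / (K ^ (2 * m) * ?s ^ (m - 1)))"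
        unfolding p1 using q K0 s0 by (intro mult_left_mono add_left_mono divide_right_mono) (auto simp: D'_def mult_ac)
      also have "(D' * exp (- real k / 2) * K ^ (2 * m)) / (K ^ (2 * m) * ?s ^ (m - 1)) = D' * (?s ^ m / ?s ^ (m - 1))"
        using K0 by (simp add: sm)
      also have "?s ^ m / ?s ^ (m - 1) = ?s"
        using m s0 by (cases m) auto
      finally show ?thesis by (simp add: algebra_simps)
    qed
    have pt: "ennreal ((norm (\<Sum>i\<in>I. a i \<omega> *\<^sub>C y i))\<^sup>2) \<le> (\<Sum>k. ennreal (W * (real k + 1) ^ 4 * (envelope y (A k \<omega>))\<^sup>2))" for \<omega>
    proof -
      define N where "N = Suc (Max (insert 0 ((\<lambda>i. nat \<lfloor>norm (a i \<omega>)\<rfloor>) ` I)))"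
      have N: "nat \<lfloor>norm (a i \<omega>)\<rfloor> < N" if "i \<in> I" for i
        unfolding N_def less_Suc_eq_le using I that by (intro Max_ge) auto
      have "(\<Sum>i\<in>I. a i \<omega> *\<^sub>C y i) = (\<Sum>k<N. \<Sum>i\<in>A k \<omega>. a i \<omega> *\<^sub>C y i)"
        unfolding A_def using I N by (intro sum.group[symmetric]) auto
      then have "norm (\<Sum>i\<in>I. a i \<omega> *\<^sub>C y i) \<le> (\<Sum>k<N. norm (\<Sum>i\<in>A k \<omega>. a i \<omega> *\<^sub>C y i))"
        by (simp add: norm_sum)
      also have "\<dots> \<le> (\<Sum>k<N. (real k + 1) * envelope y (A k \<omega>))"
      proof (intro sum_mono envelope_scaled_upper)
        fix k i assume "i \<in> A k \<omega>"
        then show "norm (a i \<omega>) \<le> real k + 1" unfolding A_def mem_Collect_eq by linarith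
      qed
      also have "\<dots> = (\<Sum>k<N. (1 / (real k + 1)) * ((real k + 1)\<^sup>2 * envelope y (A k \<omega>)))"
      proof (intro sum.cong refl)
        fix k
        have "real k + 1 \<noteq> 0" by linarith
        then show "(real k + 1) * envelope y (A k \<omega>) = (1 / (real k + 1)) * ((real k + 1)\<^sup>2 * envelope y (A k \<omega>))"
          by (simp add: power2_eq_square)
      qed
      finally have "(norm (\<Sum>i\<in>I. a i \<omega> *\<^sub>C y i))\<^sup>2 \<le> (\<Sum>k<N. (1 / (real k + 1)) * ((real k + 1)\<^sup>2 * envelope y (A k \<omega>)))\<^sup>2"
        by (intro power_mono) auto
      also have "\<dots> \<le> (\<Sum>k<N. (1 / (real k + 1))\<^sup>2) * (\<Sum>k<N. ((real k + 1)\<^sup>2 * envelope y (A k \<omega>))\<^sup>2)"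
        by (rule Cauchy_Schwarz_ineq_sum)
      also have "\<dots> \<le> W * (\<Sum>k<N. ((real k + 1)\<^sup>2 * envelope y (A k \<omega>))\<^sup>2)"
        unfolding W_def using sum_le_suminf[OF sumW, of "{..<N}"]
        by (intro mult_right_mono sum_nonneg) (auto simp: power_divide)
      also have "\<dots> = (\<Sum>k<N. W * (real k + 1) ^ 4 * (envelope y (A k \<omega>))\<^sup>2)"
        by (simp add: sum_distrib_left power_mult_distrib mult.assoc)
      finally have "ennreal ((norm (\<Sum>i\<in>I. a i \<omega> *\<^sub>C y i))\<^sup>2) \<le> ennreal (\<Sum>k<N. W * (real k + 1) ^ 4 * (envelope y (A k \<omega>))\<^sup>2)"
        by (rule ennreal_leI)
      also have "\<dots> = (\<Sum>k<N. ennreal (W * (real k + 1) ^ 4 * (envelope y (A k \<omega>))\<^sup>2))"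
        using W0 by (intro sum_ennreal[symmetric]) auto
      also have "\<dots> \<le> (\<Sum>k. ennreal (W * (real k + 1) ^ 4 * (envelope y (A k \<omega>))\<^sup>2))"
        by (rule sum_le_suminf) auto
      finally show ?thesis .
    qed
    have mA: "(\<lambda>\<omega>. ennreal (g (A k \<omega>))) \<in> borel_measurable M" for g k
    proof -
      have "A k \<in> measurable M (count_space (Pow I))"
        using A_sub A_meas I by (subst measurable_count_space_eq_countable) (auto intro: countable_finite simp: vimage_def Int_def conj_commute)
      then show ?thesis by (rule measurable_compose) simp
    qed
    have "(\<integral>\<^sup>+\<omega>. ennreal ((norm (\<Sum>i\<in>I. a i \<omega> *\<^sub>C y i))\<^sup>2) \<partial>M)
        \<le> (\<integral>\<^sup>+\<omega>. (\<Sum>k. ennreal (W * (real k + 1) ^ 4 * (envelope y (A k \<omega>))\<^sup>2)) \<partial>M)"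
      by (intro nn_integral_mono pt)
    also have "\<dots> = (\<Sum>k. \<integral>\<^sup>+\<omega>. ennreal (W * (real k + 1) ^ 4 * (envelope y (A k \<omega>))\<^sup>2) \<partial>M)"
      by (rule nn_integral_suminf) (rule mA)
    also have "\<dots> = (\<Sum>k. ennreal (\<Sum>S\<in>Pow I. p k S * (W * (real k + 1) ^ 4 * (envelope y S)\<^sup>2)))"
      using W0 by (subst law) auto
    also have "\<dots> \<le> (\<Sum>k. ennreal (K\<^sup>2 * (W * (1 + D')) * ((real k + 1) ^ 4 * \<theta> ^ k)))"
    proof (intro suminf_le allI ennreal_leI)
      fix k
      have "(\<Sum>S\<in>Pow I. p k S * (W * (real k + 1) ^ 4 * (envelope y S)\<^sup>2))
          = W * (real k + 1) ^ 4 * (\<Sum>S\<in>Pow I. p k S * (envelope y S)\<^sup>2)"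
        by (simp add: sum_distrib_left mult_ac)
      also have "\<dots> \<le> W * (real k + 1) ^ 4 * (K\<^sup>2 * (1 + D') * \<theta> ^ k)"
        using W0 by (intro mult_left_mono E2) auto
      finally show "(\<Sum>S\<in>Pow I. p k S * (W * (real k + 1) ^ 4 * (envelope y S)\<^sup>2)) \<le> K\<^sup>2 * (W * (1 + D')) * ((real k + 1) ^ 4 * \<theta> ^ k)"
        by (simp add: mult_ac)
    qed auto
    also have "\<dots> = ennreal (\<Sum>k. K\<^sup>2 * (W * (1 + D')) * ((real k + 1) ^ 4 * \<theta> ^ k))"
      using W0 D'0 \<theta> by (intro suminf_ennreal2 summable_mult sum\<theta>) auto
    also have "(\<Sum>k. K\<^sup>2 * (W * (1 + D')) * ((real k + 1) ^ 4 * \<theta> ^ k)) = C * K\<^sup>2"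
      unfolding C_def' by (subst suminf_mult[OF sum\<theta>]) (simp add: mult_ac)
    finally show ?thesis .
  qed
  then show ?thesis by (simp add: C_def)
qed

section \<open>Continuous functionals separate points\<close>

lemma complex_linear_clinear_iff:
  "clinear f \<longleftrightarrow> (\<forall>x y. f (x + y) = f x + f y) \<and> (\<forall>c x. f (c *\<^sub>C x) = c *\<^sub>C f x)"
  by (auto simp: Vector_Spaces.linear_def module_hom_def module_hom_axioms_def
      complex_vector.module_axioms complex_vector.vector_space_axioms)

definition sublinear :: "('a :: real_vector \<Rightarrow> real) \<Rightarrow> bool" where
  "sublinear p \<longleftrightarrow> (\<forall>x y. p (x + y) \<le> p x + p y) \<and> (\<forall>t\<ge>0. \<forall>x. p (t *\<^sub>R x) = t * p x)"

text \<open>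
  The largest sublinear functional below \<open>p\<close> whose value at \<open>- y\<close> is at most \<open>- p y\<close>. A functional that
  is minimal among the sublinear ones is therefore odd, hence linear.
\<close>

definition tilt :: "('a :: real_vector \<Rightarrow> real) \<Rightarrow> 'a \<Rightarrow> 'a \<Rightarrow> real" where
  "tilt p y x = (INF t\<in>{0..}. p (x + t *\<^sub>R y) - t * p y)"

lemma sublinear_zero: "sublinear p \<Longrightarrow> p 0 = 0"
  unfolding sublinear_def by (metis mult_zero_left order_refl scaleR_zero_left)

lemma sublinear_minus_le:
  assumes "sublinear p"
  shows "- p (- x) \<le> p x"
proof -
  have "p (x + - x) \<le> p x + p (- x)" using assms unfolding sublinear_def by blast
  then show ?thesis using sublinear_zero[OF assms] by simp
qed

lemma tilt_le:
  assumes p: "sublinear p" and t: "t \<ge> 0"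
  shows "tilt p y x \<le> p (x + t *\<^sub>R y) - t * p y"
  unfolding tilt_def
proof (rule cINF_lower)
  show "bdd_below ((\<lambda>t. p (x + t *\<^sub>R y) - t * p y) ` {0..})"
  proof (rule bdd_belowI2)
    fix t :: real assume t: "t \<in> {0..}"
    have "p (t *\<^sub>R y) \<le> p (x + t *\<^sub>R y) + p (- x)"
      using p[unfolded sublinear_def, THEN conjunct1, rule_format, of "x + t *\<^sub>R y" "- x"] by simp
    then show "- p (- x) \<le> p (x + t *\<^sub>R y) - t * p y"
      using p t unfolding sublinear_def by auto
  qed
qed (use t in simp)

lemma tilt_greatest:
  assumes "\<And>t. t \<ge> 0 \<Longrightarrow> b \<le> p (x + t *\<^sub>R y) - t * p y"
  shows "b \<le> tilt p y x"
  unfolding tilt_def by (rule cINF_greatest) (use assms in auto)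

lemma sublinear_tilt:
  assumes p: "sublinear p"
  shows "sublinear (tilt p y)"
  unfolding sublinear_def
proof (intro conjI allI impI)
  fix x z
  have "tilt p y (x + z) - (p (x + s *\<^sub>R y) - s * p y) \<le> p (z + t *\<^sub>R y) - t * p y" if "s \<ge> 0" "t \<ge> 0" for s t
  proof -
    have "tilt p y (x + z) \<le> p ((x + z) + (s + t) *\<^sub>R y) - (s + t) * p y"
      using that by (intro tilt_le p) auto
    also have "(x + z) + (s + t) *\<^sub>R y = (x + s *\<^sub>R y) + (z + t *\<^sub>R y)" by (simp add: algebra_simps)
    also have "p \<dots> \<le> p (x + s *\<^sub>R y) + p (z + t *\<^sub>R y)" using p by (simp add: sublinear_def)
    finally show ?thesis by (simp add: algebra_simps)
  qed
  then have "tilt p y (x + z) - (p (x + s *\<^sub>R y) - s * p y) \<le> tilt p y z" if "s \<ge> 0" for s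
    using that by (intro tilt_greatest) auto
  then have "tilt p y (x + z) - tilt p y z \<le> tilt p y x"
    by (intro tilt_greatest) (simp add: algebra_simps)
  then show "tilt p y (x + z) \<le> tilt p y x + tilt p y z" by simp
next
  fix r :: real and x assume r: "r \<ge> 0"
  show "tilt p y (r *\<^sub>R x) = r * tilt p y x"
  proof (cases "r = 0")
    case True
    have "tilt p y 0 \<le> 0" using tilt_le[OF p, of 0 y 0] sublinear_zero[OF p] by simp
    moreover have "0 \<le> tilt p y 0" by (rule tilt_greatest) (use p in \<open>simp add: sublinear_def\<close>)
    ultimately show ?thesis using True by simp
  next
    case False
    then have r: "r > 0" using r by simp
    have hom: "p (r *\<^sub>R x + (r * t) *\<^sub>R y) - (r * t) * p y = r * (p (x + t *\<^sub>R y) - t * p y)" for t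
    proof -
      have "r *\<^sub>R x + (r * t) *\<^sub>R y = r *\<^sub>R (x + t *\<^sub>R y)" by (simp add: algebra_simps)
      moreover have "p (r *\<^sub>R (x + t *\<^sub>R y)) = r * p (x + t *\<^sub>R y)" using p r by (simp add: sublinear_def)
      ultimately show ?thesis by (simp add: algebra_simps)
    qed
    have "tilt p y (r *\<^sub>R x) / r \<le> tilt p y x"
    proof (rule tilt_greatest)
      fix t :: real assume "t \<ge> 0"
      then have "tilt p y (r *\<^sub>R x) \<le> r * (p (x + t *\<^sub>R y) - t * p y)"
        using tilt_le[OF p, of "r * t" y "r *\<^sub>R x"] r hom[of t] by simp
      then show "tilt p y (r *\<^sub>R x) / r \<le> p (x + t *\<^sub>R y) - t * p y"
        using r by (simp add: field_simps)
    qed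
    moreover have "r * tilt p y x \<le> tilt p y (r *\<^sub>R x)"
    proof (rule tilt_greatest)
      fix t :: real assume t: "t \<ge> 0"
      have "r * tilt p y x \<le> r * (p (x + (t / r) *\<^sub>R y) - (t / r) * p y)"
        using r t by (intro mult_left_mono tilt_le p) auto
      then show "r * tilt p y x \<le> p (r *\<^sub>R x + t *\<^sub>R y) - t * p y"
        using hom[of "t / r"] r by simp
    qed
    ultimately show ?thesis using r by (simp add: field_simps)
  qed
qed

lemma tilt_le_self: "sublinear p \<Longrightarrow> tilt p y x \<le> p x"
  using tilt_le[of p 0 y x] by simp

lemma tilt_minus: "sublinear p \<Longrightarrow> tilt p y (- y) \<le> - p y"
  using tilt_le[of p 1 y "- y"] sublinear_zero[of p] by simp

text \<open>
  Zorn's lemma: the infimum of a chain of sublinear functionals is finite, because \<open>f x \<ge> - f (- x) \<ge> - q (- x)\<close>.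
\<close>

lemma minimal_sublinear_exists:
  assumes q: "sublinear q"
  obtains p where "sublinear p" "\<And>x. p x \<le> q x"
    "\<And>p'. sublinear p' \<Longrightarrow> (\<And>x. p' x \<le> p x) \<Longrightarrow> p' = p"
proof -
  define A where "A = {p. sublinear p \<and> (\<forall>x. p x \<le> q x)}"
  define P where "P f g \<longleftrightarrow> (\<forall>x. (g :: 'a \<Rightarrow> real) x \<le> f x)" for f g
  have "\<exists>m\<in>A. \<forall>a\<in>A. P m a \<longrightarrow> a = m"
  proof (rule predicate_Zorn)
    show "partial_order_on A (relation_of P A)"
    proof (rule partial_order_on_relation_ofI)
      show "P a c" if "P a b" "P b c" for a b c
        using that unfolding P_def by (meson order_trans)
      show "a = b" if "P a b" "P b a" for a b
        using that unfolding P_def by (intro ext) (meson order_antisym)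
    qed (simp add: P_def)
  next
    fix C assume "C \<in> Chains (relation_of P A)"
    then have C: "C \<subseteq> A" and chain: "\<And>f g. f \<in> C \<Longrightarrow> g \<in> C \<Longrightarrow> P f g \<or> P g f"
      unfolding Chains_def relation_of_def by auto
    show "\<exists>u\<in>A. \<forall>a\<in>C. P a u"
    proof (cases "C = {}")
      case True
      then show ?thesis using q by (auto simp: A_def)
    next
      case False
      define u where "u x = (INF f\<in>C. f x)" for x
      have bdd: "bdd_below ((\<lambda>f. f x) ` C)" for x
      proof (rule bdd_belowI2)
        fix f assume f: "f \<in> C"
        then have "sublinear f" "f (- x) \<le> q (- x)" using C by (auto simp: A_def)
        then show "- q (- x) \<le> f x" using sublinear_minus_le[of f x] by linarith
      qed
      have lower: "u x \<le> f x" if "f \<in> C" for f x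
        unfolding u_def by (rule cINF_lower[OF bdd that])
      have greatest: "b \<le> u x" if "\<And>f. f \<in> C \<Longrightarrow> b \<le> f x" for b x
        unfolding u_def by (rule cINF_greatest[OF False that])
      have "sublinear u"
        unfolding sublinear_def
      proof (intro conjI allI impI)
        fix x y
        have "u (x + y) - f x \<le> g y" if fg: "f \<in> C" "g \<in> C" for f g
        proof -
          obtain h where h: "h \<in> C" "h x \<le> f x" "h y \<le> g y"
            using chain[OF fg] fg unfolding P_def by blast
          have "u (x + y) \<le> h (x + y)" by (rule lower[OF h(1)])
          also have "\<dots> \<le> h x + h y" using h(1) C by (auto simp: A_def sublinear_def)
          finally show ?thesis using h by linarith
        qed
        then have "u (x + y) - f x \<le> u y" if "f \<in> C" for f using that by (intro greatest) auto
        then have "u (x + y) - u y \<le> u x" by (intro greatest) (simp add: algebra_simps)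
        then show "u (x + y) \<le> u x + u y" by simp
      next
        fix t :: real and x assume t: "t \<ge> 0"
        have hom: "f (t *\<^sub>R x) = t * f x" if "f \<in> C" for f
          using that C t by (auto simp: A_def sublinear_def)
        show "u (t *\<^sub>R x) = t * u x"
        proof (cases "t = 0")
          case True
          have "(\<lambda>f. f (t *\<^sub>R x)) ` C = (\<lambda>_. 0) ` C"
            by (rule image_cong) (use hom True in auto)
          then have "(\<lambda>f. f (t *\<^sub>R x)) ` C = {0}" using False by auto
          then show ?thesis using True by (simp add: u_def)
        next
          case tne: False
          then have t: "t > 0" using t by simp
          have "t * u x \<le> u (t *\<^sub>R x)"
          proof (rule greatest)
            fix f assume f: "f \<in> C"
            show "t * u x \<le> f (t *\<^sub>R x)"
              using mult_left_mono[OF lower[OF f, of x], of t] t hom[OF f] by simp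
          qed
          moreover have "u (t *\<^sub>R x) / t \<le> u x"
          proof (rule greatest)
            fix f assume f: "f \<in> C"
            show "u (t *\<^sub>R x) / t \<le> f x"
              using lower[OF f, of "t *\<^sub>R x"] t hom[OF f] by (simp add: field_simps)
          qed
          ultimately show ?thesis using t by (simp add: field_simps)
        qed
      qed
      moreover have "u x \<le> q x" for x
      proof -
        obtain f where "f \<in> C" using False by blast
        then have "u x \<le> f x" "f x \<le> q x" using lower C by (auto simp: A_def)
        then show ?thesis by linarith
      qed
      ultimately show ?thesis using lower by (auto simp: A_def P_def)
    qed
  qed
  then obtain p where p: "p \<in> A" "\<And>a. a \<in> A \<Longrightarrow> P p a \<Longrightarrow> a = p" by blast
  show ?thesis
  proof (rule that[of p])
    show "sublinear p" "p x \<le> q x" for x using p(1) by (auto simp: A_def)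
    show "p' = p" if "sublinear p'" "\<And>x. p' x \<le> p x" for p'
    proof (rule p(2))
      have "p' x \<le> q x" for x using that(2)[of x] p(1) order_trans by (auto simp: A_def)
      then show "p' \<in> A" using that(1) by (simp add: A_def)
    qed (use that(2) in \<open>simp add: P_def\<close>)
  qed
qed

text \<open>
  Hahn-Banach: a minimal sublinear functional \<open>p\<close> below the tilt of the norm at \<open>x\<close> is real linear,
  bounded by the norm, and satisfies \<open>p (- x) \<le> - norm x\<close>. Its complexification
  \<open>p z - \<i> * p (\<i> z)\<close> is complex linear.
\<close>

proposition cdual_separates:
  fixes x :: "'x :: complex_normed_vector"
  assumes "x \<noteq> 0"
  obtains \<xi> :: "'x \<Rightarrow>\<^sub>L complex" where "\<xi> \<in> cdual" "blinfun_apply \<xi> x \<noteq> 0"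
proof -
  have N: "sublinear (norm :: 'x \<Rightarrow> real)"
    by (simp add: sublinear_def norm_triangle_ineq)
  obtain p where p: "sublinear p" "\<And>z. p z \<le> tilt norm x z"
      and min: "\<And>p'. sublinear p' \<Longrightarrow> (\<And>z. p' z \<le> p z) \<Longrightarrow> p' = p"
    using minimal_sublinear_exists[OF sublinear_tilt[OF N, of x]] by metis
  \<comment> \<open>Minimality: \<open>p\<close> coincides with all its tilts.\<close>
  have neg: "p (- z) = - p z" for z
  proof -
    have "tilt p z = p" by (intro min sublinear_tilt p tilt_le_self)
    then have "p (- z) \<le> - p z" using tilt_minus[OF p(1), of z] by simp
    then show ?thesis using sublinear_minus_le[OF p(1), of z] by linarith
  qed
  have add: "p (y + z) = p y + p z" for y z
  proof -
    have "p (y + z) \<le> p y + p z" "p (- y + - z) \<le> p (- y) + p (- z)"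
      using p(1) unfolding sublinear_def by blast+
    then show ?thesis using neg[of "y + z"] neg[of y] neg[of z] by simp
  qed
  have scale: "p (t *\<^sub>R z) = t * p z" for t z
  proof (cases "t \<ge> 0")
    case False
    then have "p ((- t) *\<^sub>R z) = - t * p z" using p(1) by (simp add: sublinear_def del: scaleR_minus_left)
    then show ?thesis using neg[of "t *\<^sub>R z"] by simp
  qed (use p(1) in \<open>simp add: sublinear_def\<close>)
  have le: "p z \<le> norm z" for z using p(2)[of z] tilt_le_self[OF N, of x z] by simp
  have abs: "\<bar>p z\<bar> \<le> norm z" for z using le[of z] le[of "- z"] neg[of z] by simp
  have "p x \<noteq> 0"
    using p(2)[of "- x"] tilt_minus[OF N, of x] neg[of x] assms by (smt (verit) zero_less_norm_iff)
  define f where "f z = Complex (p z) (- p (\<i> *\<^sub>C z))" for z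
  have fadd: "f (y + z) = f y + f z" for y z
    by (simp add: f_def scaleC_add_right add complex_eq_iff)
  have fscale: "f (c *\<^sub>C z) = c * f z" for c z
  proof -
    have c: "c *\<^sub>C w = Re c *\<^sub>R w + Im c *\<^sub>R (\<i> *\<^sub>C w)" for w :: 'x
    proof -
      have "c *\<^sub>C w = (of_real (Re c) + \<i> * of_real (Im c)) *\<^sub>C w" by (simp only: complex_eq[symmetric])
      then show ?thesis by (simp add: scaleR_scaleC scaleC_scaleC scaleC_add_left mult.commute)
    qed
    have "\<i> *\<^sub>C (c *\<^sub>C z) = Re c *\<^sub>R (\<i> *\<^sub>C z) + (- Im c) *\<^sub>R z"
    proof -
      have "\<i> *\<^sub>C (c *\<^sub>C z) = c *\<^sub>C (\<i> *\<^sub>C z)" by (simp add: scaleC_scaleC mult.commute)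
      also have "\<dots> = Re c *\<^sub>R (\<i> *\<^sub>C z) + Im c *\<^sub>R (\<i> *\<^sub>C (\<i> *\<^sub>C z))" by (rule c)
      also have "\<i> *\<^sub>C (\<i> *\<^sub>C z) = (- 1) *\<^sub>C z" by (simp add: scaleC_scaleC)
      finally show ?thesis by (simp add: scaleC_one)
    qed
    then have "p (\<i> *\<^sub>C (c *\<^sub>C z)) = Re c * p (\<i> *\<^sub>C z) + (- Im c) * p z" by (simp only: add scale)
    moreover have "p (c *\<^sub>C z) = Re c * p z + Im c * p (\<i> *\<^sub>C z)"
      using c[of z] by (simp only: add scale)
    ultimately show ?thesis by (simp add: f_def complex_eq_iff)
  qed
  have "bounded_linear f"
  proof (rule bounded_linear_intro)
    show "norm (f z) \<le> norm z * 2" for z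
      using abs[of z] abs[of "\<i> *\<^sub>C z"] cmod_le[of "f z"] by (simp add: f_def norm_scaleC)
  qed (auto simp: fadd fscale scaleR_scaleC scaleR_conv_of_real scaleC_complex_def)
  then have "blinfun_apply (Blinfun f) = f" by (rule bounded_linear_Blinfun_apply)
  moreover have "clinear f" unfolding complex_linear_clinear_iff by (simp add: fadd fscale scaleC_complex_def)
  moreover have "f x \<noteq> 0" using \<open>p x \<noteq> 0\<close> by (simp add: f_def complex_eq_iff)
  ultimately show ?thesis using that[of "Blinfun f"] by (simp add: cblinfuns_def)
qed

section \<open>Series expansion of bounded holomorphic functions on a strip\<close>

lemma sums_geometric_tail:
  fixes f :: "nat \<Rightarrow> 'a :: banach"
  assumes f: "f sums s" and le: "\<And>n. norm (f n) \<le> c * r ^ n" and r: "0 \<le> r" "r < 1"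
  shows "norm (s - (\<Sum>n<N. f n)) \<le> c * r ^ N / (1 - r)"
proof -
  have "(\<lambda>n. f (n + N)) sums (s - (\<Sum>n<N. f n))"
    using f by (rule sums_split_initial_segment)
  moreover have "(\<lambda>n. c * r ^ N * r ^ n) sums (c * r ^ N * (1 / (1 - r)))"
    using r by (intro sums_mult geometric_sums) auto
  ultimately have "norm (suminf (\<lambda>n. f (n + N))) \<le> (\<Sum>n. c * r ^ N * r ^ n)"
    using le[of "_ + N"] by (intro norm_suminf_le) (auto simp: sums_iff power_add mult_ac)
  then show ?thesis
    using \<open>(\<lambda>n. f (n + N)) sums _\<close> \<open>(\<lambda>n. c * r ^ N * r ^ n) sums _\<close> by (simp add: sums_iff)
qed

lemma sum_over_ints_bound:
  obtains S where "S \<ge> 0" "\<And>L :: int set. finite L \<Longrightarrow> (\<Sum>l\<in>L. 1 / (1 + (real_of_int l)\<^sup>2)) \<le> S"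
proof
  let ?f = "\<lambda>n :: nat. 1 / (1 + (real n)\<^sup>2)"
  have sm: "summable ?f"
  proof (rule summable_comparison_test)
    show "summable (\<lambda>n. 2 * (1 / (1 + real n)\<^sup>2))"
      using inverse_squares_sums by (intro summable_mult) (simp add: sums_iff add.commute)
    have "1 / (1 + (real n)\<^sup>2) \<le> 2 * (1 / (1 + real n)\<^sup>2)" for n
    proof -
      have "(1 + real n)\<^sup>2 \<le> 2 * (1 + (real n)\<^sup>2)"
        using sum_squares_bound[of 1 "real n"] by (simp add: power2_eq_square algebra_simps)
      moreover have "1 + (real n)\<^sup>2 > 0" by (simp add: add_pos_nonneg)
      ultimately show ?thesis by (simp add: divide_simps)
    qed
    then show "\<exists>N. \<forall>n\<ge>N. norm (?f n) \<le> 2 * (1 / (1 + real n)\<^sup>2)" by simp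
  qed
  show "2 * (\<Sum>n. ?f n) \<ge> 0" by (intro mult_nonneg_nonneg suminf_nonneg[OF sm]) auto
  fix L :: "int set" assume L: "finite L"
  let ?g = "\<lambda>l :: int. 1 / (1 + (real_of_int l)\<^sup>2)"
  define P where "P = L \<inter> {0..}"
  define Q where "Q = L \<inter> {..<0}"
  have "(\<Sum>l\<in>P. ?g l) = (\<Sum>n\<in>nat ` P. ?f n)"
    by (subst sum.reindex) (auto simp: inj_on_def P_def intro!: sum.cong)
  also have "\<dots> \<le> (\<Sum>n. ?f n)" using L by (intro sum_le_suminf[OF sm]) (auto simp: P_def)
  finally have 1: "(\<Sum>l\<in>P. ?g l) \<le> (\<Sum>n. ?f n)" .
  have "(\<Sum>l\<in>Q. ?g l) = (\<Sum>n\<in>(\<lambda>l. nat (- l)) ` Q. ?f n)"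
    by (subst sum.reindex) (auto simp: inj_on_def Q_def intro!: sum.cong)
  also have "\<dots> \<le> (\<Sum>n. ?f n)" using L by (intro sum_le_suminf[OF sm]) (auto simp: Q_def)
  finally have 2: "(\<Sum>l\<in>Q. ?g l) \<le> (\<Sum>n. ?f n)" .
  have "L = P \<union> Q" by (auto simp: P_def Q_def)
  then have "(\<Sum>l\<in>L. ?g l) = (\<Sum>l\<in>P. ?g l) + (\<Sum>l\<in>Q. ?g l)"
    using L by (simp only:) (intro sum.union_disjoint, auto simp: P_def Q_def)
  then show "(\<Sum>l\<in>L. ?g l) \<le> 2 * (\<Sum>n. ?f n)" using 1 2 by linarith
qed

text \<open>
  Shifting \<open>l\<close> by \<open>\<lfloor>x / d\<rfloor>\<close> moves \<open>x\<close> into a fixed cell of the lattice, where the terms are comparable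
  to \<open>1 / (1 + l\<^sup>2)\<close>; this makes the bound uniform in \<open>x\<close>.
\<close>

lemma lattice_sum_bound:
  fixes d :: real assumes "d > 0"
  obtains S where "S \<ge> 0" "\<And>(L :: int set) x. finite L \<Longrightarrow> (\<Sum>l\<in>L. 1 / (1 + (real_of_int l * d - x)\<^sup>2)) \<le> S"
proof -
  obtain S0 where S0: "S0 \<ge> 0" "\<And>L :: int set. finite L \<Longrightarrow> (\<Sum>l\<in>L. 1 / (1 + (real_of_int l)\<^sup>2)) \<le> S0"
    using sum_over_ints_bound by blast
  define c where "c = 3 * (1 + 1 / d\<^sup>2)"
  show ?thesis
  proof
    show "c * S0 \<ge> 0" using S0 by (simp add: c_def)
    fix L :: "int set" and x assume L: "finite L"
    define k where "k = \<lfloor>x / d\<rfloor>"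
    define h where "h = x / d - of_int k"
    have h: "0 \<le> h" "h \<le> 1" unfolding h_def k_def by linarith+
    have le: "1 / (1 + (real_of_int l * d - x)\<^sup>2) \<le> c * (1 / (1 + (real_of_int (l - k))\<^sup>2))" for l
    proof -
      define i where "i = real_of_int (l - k)"
      have x: "real_of_int l * d - x = (i - h) * d" using assms by (simp add: i_def h_def field_simps)
      have "0 \<le> (i - 2 * h)\<^sup>2" "h\<^sup>2 \<le> 1" using h by (simp_all add: power_le_one)
      then have i2: "i\<^sup>2 \<le> 2 * (i - h)\<^sup>2 + 2" by (simp add: power2_eq_square algebra_simps)
      have "1 + x \<le> 3 * (1 + y)" if "x \<le> 2 * y + 2" "y \<ge> 0" for x y :: real using that by simp
      from this[OF i2] have a: "1 + i\<^sup>2 \<le> 3 * (1 + (i - h)\<^sup>2)" by simp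
      have "(1 + 1 / d\<^sup>2) * (1 + X * d\<^sup>2) = 1 + X + (X * d\<^sup>2 + 1 / d\<^sup>2)" for X
        using assms by (simp add: field_simps)
      then have "1 + (i - h)\<^sup>2 \<le> (1 + 1 / d\<^sup>2) * (1 + ((i - h) * d)\<^sup>2)"
        by (simp add: power_mult_distrib)
      then have "3 * (1 + (i - h)\<^sup>2) \<le> 3 * ((1 + 1 / d\<^sup>2) * (1 + ((i - h) * d)\<^sup>2))"
        by (rule mult_left_mono) simp
      also have "\<dots> = c * (1 + ((i - h) * d)\<^sup>2)" unfolding c_def by (rule mult.assoc[symmetric])
      finally have "1 + i\<^sup>2 \<le> c * (1 + ((i - h) * d)\<^sup>2)" using a by (rule order_trans[rotated])
      moreover have "1 + i\<^sup>2 > 0" "1 + ((i - h) * d)\<^sup>2 > 0" by (simp_all add: add_pos_nonneg)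
      ultimately show ?thesis unfolding x i_def[symmetric] by (simp add: divide_simps mult.commute)
    qed
    have "(\<Sum>l\<in>L. 1 / (1 + (real_of_int l * d - x)\<^sup>2)) \<le> (\<Sum>l\<in>L. c * (1 / (1 + (real_of_int (l - k))\<^sup>2)))"
      by (intro sum_mono le)
    also have "\<dots> = c * (\<Sum>l\<in>(\<lambda>l. l - k) ` L. 1 / (1 + (real_of_int l)\<^sup>2))"
      by (subst sum.reindex) (auto simp: sum_distrib_left)
    also have "\<dots> \<le> c * S0" using L by (intro mult_left_mono S0) (auto simp: c_def)
    finally show "(\<Sum>l\<in>L. 1 / (1 + (real_of_int l * d - x)\<^sup>2)) \<le> c * S0" .
  qed
qed

text \<open>
  The Cauchy kernel times a Gaussian, which does not change the residue at \<open>0\<close> and gives decay along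
  horizontal lines.
\<close>

definition gauss_kernel :: "complex \<Rightarrow> complex" where
  "gauss_kernel s = exp (- s\<^sup>2) / s"

lemma gauss_kernel_holomorphic: "gauss_kernel holomorphic_on - {0}"
  unfolding gauss_kernel_def by (intro holomorphic_intros) auto

lemma norm_gauss_le: "norm (exp (- s\<^sup>2)) \<le> exp ((Im s)\<^sup>2) / (1 + (Re s)\<^sup>2)"
proof -
  have "norm (exp (- s\<^sup>2)) = exp ((Im s)\<^sup>2) * exp (- (Re s)\<^sup>2)"
    by (simp add: power2_eq_square exp_add[symmetric])
  also have "exp (- (Re s)\<^sup>2) \<le> 1 / (1 + (Re s)\<^sup>2)"
    using exp_ge_add_one_self[of "(Re s)\<^sup>2"] by (simp add: exp_minus divide_simps add_pos_nonneg)
  finally show ?thesis by simp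
qed

text \<open>
  The point with coordinate \<open>l\<close> on the line \<open>Im w = t\<close>, in units of \<open>d\<close>. The line is cut into the segments
  from \<open>mesh d t l\<close> to \<open>mesh d t (l + 1)\<close>, with midpoints \<open>mesh d t (l + 1 / 2)\<close>.
\<close>

definition mesh :: "real \<Rightarrow> real \<Rightarrow> real \<Rightarrow> complex" where
  "mesh d t l = Complex (l * d) t"

text \<open>
  On a segment the Cauchy kernel is expanded in powers of \<open>(w - m) / (d / 2)\<close>, \<open>m\<close> the midpoint, which have
  modulus at most \<open>1\<close> there. The moments of \<open>g\<close> are the coefficients of the expansion of \<open>g\<close>, and the
  functions \<open>kernel_coeff\<close> of \<open>z\<close> are the Taylor coefficients of the kernel.
\<close>

definition segment_moment :: "real \<Rightarrow> real \<Rightarrow> int \<Rightarrow> nat \<Rightarrow> (complex \<Rightarrow> complex) \<Rightarrow> complex" where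
  "segment_moment d t l j g = contour_integral (linepath (mesh d t l) (mesh d t (l + 1)))
     (\<lambda>w. g w * ((w - mesh d t (l + 1 / 2)) / of_real (d / 2)) ^ j)"

definition kernel_coeff :: "real \<Rightarrow> real \<Rightarrow> int \<Rightarrow> nat \<Rightarrow> complex \<Rightarrow> complex" where
  "kernel_coeff d t l j z = of_real (d / 2) ^ j * ((deriv ^^ j) gauss_kernel (mesh d t (l + 1 / 2) - z) / fact j)"

lemma mesh_segment:
  assumes "w \<in> closed_segment (mesh d t l) (mesh d t (l + 1))" "d > 0"
  shows "Im w = t" "norm (w - mesh d t (l + 1 / 2)) \<le> d / 2"
proof -
  obtain u where u: "0 \<le> u" "u \<le> 1" "w = (1 - u) *\<^sub>R mesh d t l + u *\<^sub>R mesh d t (l + 1)"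
    using assms(1) by (auto simp: in_segment)
  have w: "w = Complex ((l + u) * d) t" by (simp add: u complex_eq_iff mesh_def algebra_simps)
  then show "Im w = t" by simp
  have "w - mesh d t (l + 1 / 2) = of_real ((u - 1 / 2) * d)"
    by (simp add: w mesh_def complex_eq_iff algebra_simps)
  then have "norm (w - mesh d t (l + 1 / 2)) = \<bar>u - 1 / 2\<bar> * d"
    using assms(2) by (simp only: norm_of_real abs_mult)
  also have "\<bar>u - 1 / 2\<bar> \<le> 1 / 2" using u(1,2) by linarith
  finally show "norm (w - mesh d t (l + 1 / 2)) \<le> d / 2" using assms(2) by simp
qed

text \<open>
  The lines of integration have distance \<open>d\<close> from the smaller strip, and the segments have length \<open>d\<close>.
  So the Taylor series about a midpoint \<open>m\<close> is used at distance at most \<open>d / 2\<close> from \<open>m\<close>, while Cauchy's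
  estimates hold on the disc of radius \<open>3 d / 4\<close>; the ratio of the radii is \<open>2 / 3\<close>.
\<close>

locale nested_strips =
  fixes \<alpha> b d :: real
  assumes pos: "\<alpha> > 0" "d > 0" and b_def: "b = \<alpha> + d"
begin

text \<open>
  On the discs on which Cauchy's estimates are applied, \<open>norm s \<ge> d / 4\<close> and \<open>\<bar>Im s\<bar> \<le> 2 * b + d\<close>, and the last
  factor pays for replacing \<open>Re s\<close> by the real part of the centre.
\<close>

definition kernel_bound where "kernel_bound = (4 / d) * exp ((2 * b + d)\<^sup>2) * (2 + 2 * d\<^sup>2)"

lemma kernel_bound_pos: "kernel_bound > 0" using pos by (simp add: kernel_bound_def add_pos_nonneg)

lemma mesh_away:
  assumes "z \<in> strip \<alpha>" "\<bar>Im p\<bar> = b"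
  shows "d \<le> norm (p - z)" "\<bar>Im (p - z)\<bar> \<le> 2 * b"
proof -
  have z: "\<bar>Im z\<bar> < \<alpha>" using assms(1) by (simp add: strip_def)
  then have "d \<le> \<bar>Im (p - z)\<bar>" using assms(2) b_def by simp
  then show "d \<le> norm (p - z)" using abs_Im_le_cmod order_trans by blast
  show "\<bar>Im (p - z)\<bar> \<le> 2 * b" using z assms(2) b_def pos by simp
qed

lemma kernel_ball:
  assumes z: "z \<in> strip \<alpha>" and p: "\<bar>Im p\<bar> = b"
  shows "gauss_kernel holomorphic_on cball (p - z) (3 * d / 4)"
    and "s \<in> cball (p - z) (3 * d / 4) \<Longrightarrow> norm (gauss_kernel s) \<le> kernel_bound / (1 + (Re p - Re z)\<^sup>2)"
proof -
  have s4: "d / 4 \<le> norm s" if "s \<in> cball (p - z) (3 * d / 4)" for s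
    using mesh_away(1)[OF z p] norm_triangle_ineq2[of "p - z" s] norm_triangle_ineq2[of "p - z" "p - z - s"] that
    by (simp add: dist_norm)
  show "gauss_kernel holomorphic_on cball (p - z) (3 * d / 4)"
  proof (rule holomorphic_on_subset[OF gauss_kernel_holomorphic], intro subsetI ComplI)
    fix s assume "s \<in> cball (p - z) (3 * d / 4)" "s \<in> {0}"
    then show False using s4[of s] pos by simp
  qed
  assume s: "s \<in> cball (p - z) (3 * d / 4)"
  have n: "norm (p - z - s) \<le> d" using s pos by (simp add: dist_norm)
  have "\<bar>Im (p - z - s)\<bar> \<le> d" "\<bar>Re (p - z - s)\<bar> \<le> d"
    using n abs_Im_le_cmod abs_Re_le_cmod order_trans by blast+
  then have im: "\<bar>Im s\<bar> \<le> 2 * b + d" and re: "\<bar>(Re p - Re z) - Re s\<bar> \<le> d"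
    using mesh_away(2)[OF z p] by simp_all
  define x y where "x = Re s" and "y = Re p - Re z"
  have "(y - x)\<^sup>2 \<le> d\<^sup>2" using re by (simp add: x_def y_def abs_le_square_iff[symmetric])
  moreover have "0 \<le> (2 * x - y)\<^sup>2" by simp
  ultimately have "y\<^sup>2 \<le> 2 * x\<^sup>2 + 2 * d\<^sup>2" by (simp add: power2_eq_square algebra_simps)
  moreover have "0 \<le> d\<^sup>2 * x\<^sup>2" by simp
  moreover have "(2 + 2 * d\<^sup>2) * (1 + x\<^sup>2) = 2 + 2 * x\<^sup>2 + 2 * d\<^sup>2 + 2 * (d\<^sup>2 * x\<^sup>2)"
    by (simp add: algebra_simps)
  ultimately have xy: "1 + y\<^sup>2 \<le> (2 + 2 * d\<^sup>2) * (1 + x\<^sup>2)" by linarith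
  have "norm (gauss_kernel s) = norm (exp (- s\<^sup>2)) * (1 / norm s)" by (simp add: gauss_kernel_def norm_divide)
  also have "\<dots> \<le> (exp ((2 * b + d)\<^sup>2) / (1 + x\<^sup>2)) * (4 / d)"
  proof (rule mult_mono)
    have "exp ((Im s)\<^sup>2) \<le> exp ((2 * b + d)\<^sup>2)" using im by (simp add: abs_le_square_iff[symmetric])
    then have "exp ((Im s)\<^sup>2) / (1 + (Re s)\<^sup>2) \<le> exp ((2 * b + d)\<^sup>2) / (1 + (Re s)\<^sup>2)"
      by (intro divide_right_mono) auto
    then show "norm (exp (- s\<^sup>2)) \<le> exp ((2 * b + d)\<^sup>2) / (1 + x\<^sup>2)"
      using norm_gauss_le[of s] by (simp add: x_def)
    have "norm s > 0" using s4[OF s] pos by linarith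
    then have "1 / norm s \<le> 1 / (d / 4)" using s4[OF s] pos by (intro divide_left_mono mult_pos_pos) auto
    then show "1 / norm s \<le> 4 / d" by simp
  qed (auto intro: add_nonneg_nonneg)
  also have "\<dots> = (4 / d) * exp ((2 * b + d)\<^sup>2) * (1 / (1 + x\<^sup>2))" by (simp add: mult.commute)
  also have "\<dots> \<le> (4 / d) * exp ((2 * b + d)\<^sup>2) * ((2 + 2 * d\<^sup>2) / (1 + y\<^sup>2))"
    using xy pos by (intro mult_left_mono) (auto simp: divide_simps add_pos_nonneg mult.commute)
  finally show "norm (gauss_kernel s) \<le> kernel_bound / (1 + (Re p - Re z)\<^sup>2)" by (simp add: kernel_bound_def y_def)
qed

text \<open>
  The majorant of the kernel near the segment \<open>l\<close>; the shift by \<open>d / 2\<close> occurs because the midpoint has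
  real part \<open>(l + 1 / 2) * d\<close>.
\<close>

definition decay :: "int \<Rightarrow> complex \<Rightarrow> real" where
  "decay l z = kernel_bound / (1 + (real_of_int l * d - (Re z - d / 2))\<^sup>2)"

lemma decay_nonneg: "decay l z \<ge> 0"
  using kernel_bound_pos by (simp add: decay_def add_nonneg_nonneg)

lemma norm_kernel_coeff_le:
  assumes z: "z \<in> strip \<alpha>" and t: "\<bar>t\<bar> = b"
  shows "norm (kernel_coeff d t l j z) \<le> decay l z * (2 / 3) ^ j"
proof -
  let ?m = "mesh d t (l + 1 / 2)"
  have m: "\<bar>Im ?m\<bar> = b" using t by (simp add: mesh_def)
  have dc: "kernel_bound / (1 + (Re ?m - Re z)\<^sup>2) = decay l z" by (simp add: mesh_def decay_def algebra_simps)
  have "norm ((deriv ^^ j) gauss_kernel (?m - z)) \<le> fact j * decay l z / (3 * d / 4) ^ j"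
  proof (rule Cauchy_inequality)
    show "gauss_kernel holomorphic_on ball (?m - z) (3 * d / 4)"
      using kernel_ball(1)[OF z m] by (rule holomorphic_on_subset) auto
    show "continuous_on (cball (?m - z) (3 * d / 4)) gauss_kernel"
      by (rule holomorphic_on_imp_continuous_on[OF kernel_ball(1)[OF z m]])
    show "norm (gauss_kernel x) \<le> decay l z" if "norm (?m - z - x) = 3 * d / 4" for x
      using kernel_ball(2)[OF z m, of x] that unfolding dc by (simp add: dist_norm)
  qed (use pos in auto)
  then have "norm (kernel_coeff d t l j z) \<le> (d / 2) ^ j * (fact j * decay l z / (3 * d / 4) ^ j / fact j)"
    unfolding kernel_coeff_def norm_mult norm_divide norm_power norm_of_real norm_fact
    using pos by (intro mult_mono divide_right_mono) auto
  also have "\<dots> = decay l z * ((d / 2) / (3 * d / 4)) ^ j"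
    unfolding power_divide[of "d / 2"] by simp
  also have "(d / 2) / (3 * d / 4) = 2 / 3" using pos by (simp add: field_simps)
  finally show ?thesis .
qed

lemma kernel_coeff_sums:
  assumes z: "z \<in> strip \<alpha>" and t: "\<bar>t\<bar> = b" and w: "norm (w - mesh d t (l + 1 / 2)) \<le> d / 2"
  shows "(\<lambda>j. kernel_coeff d t l j z * ((w - mesh d t (l + 1 / 2)) / of_real (d / 2)) ^ j) sums gauss_kernel (w - z)"
proof -
  let ?m = "mesh d t (l + 1 / 2)"
  have m: "\<bar>Im ?m\<bar> = b" using t by (simp add: mesh_def)
  have "(\<lambda>n. (deriv ^^ n) gauss_kernel (?m - z) / fact n * (w - z - (?m - z)) ^ n) sums gauss_kernel (w - z)"
  proof (rule holomorphic_power_series)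
    show "gauss_kernel holomorphic_on ball (?m - z) (3 * d / 4)"
      using kernel_ball(1)[OF z m] by (rule holomorphic_on_subset) auto
    show "w - z \<in> ball (?m - z) (3 * d / 4)" using w pos by (simp add: dist_norm norm_minus_commute)
  qed
  moreover have "(deriv ^^ n) gauss_kernel (?m - z) / fact n * (w - z - (?m - z)) ^ n
      = kernel_coeff d t l n z * ((w - ?m) / of_real (d / 2)) ^ n" for n
  proof -
    have "c ^ n * ((w - ?m) / c) ^ n = (w - ?m) ^ n" if "c \<noteq> 0" for c :: complex
      using that by (simp flip: power_mult_distrib)
    from this[of "of_real (d / 2)"] show ?thesis using pos by (simp add: kernel_coeff_def field_simps)
  qed
  ultimately show ?thesis by simp
qed

lemma segment_expansion_error:
  assumes z: "z \<in> strip \<alpha>" and t: "\<bar>t\<bar> = b"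
    and g: "continuous_on {w. Im w = t} g" and M: "\<And>w. Im w = t \<Longrightarrow> norm (g w) \<le> M"
  shows "norm (contour_integral (linepath (mesh d t l) (mesh d t (real_of_int l + 1))) (\<lambda>w. g w * gauss_kernel (w - z))
      - (\<Sum>j<N. segment_moment d t l j g * kernel_coeff d t l j z)) \<le> 3 * d * M * decay l z * (2 / 3) ^ N"
proof -
  let ?m = "mesh d t (l + 1 / 2)" and ?I = "closed_segment (mesh d t l) (mesh d t (real_of_int l + 1))"
  let ?L = "linepath (mesh d t l) (mesh d t (real_of_int l + 1))"
  let ?q = "\<lambda>w j. ((w - ?m) / of_real (d / 2)) ^ j"
  have sub: "?I \<subseteq> {w. Im w = t}" by (auto dest: mesh_segment(1)[OF _ pos(2)])
  have gI: "continuous_on ?I g" by (rule continuous_on_subset[OF g sub])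
  have "norm (g ?m) \<le> M" by (rule M) (simp add: mesh_def)
  then have M0: "M \<ge> 0" by (rule order_trans[OF norm_ge_zero])
  have kI: "continuous_on ?I (\<lambda>w. gauss_kernel (w - z))"
  proof (rule continuous_on_compose2[OF holomorphic_on_imp_continuous_on[OF gauss_kernel_holomorphic]])
    show "(\<lambda>w. w - z) ` ?I \<subseteq> - {0}"
    proof (intro image_subsetI ComplI)
      fix w assume "w \<in> ?I" "w - z \<in> {0}"
      then show False using mesh_away(1)[OF z, of w] sub t pos by auto
    qed
  qed (intro continuous_intros)
  have int1: "(\<lambda>w. g w * gauss_kernel (w - z)) contour_integrable_on ?L"
    by (intro contour_integrable_continuous_linepath continuous_intros gI kI)
  have int2: "(\<lambda>w. g w * ?q w j) contour_integrable_on ?L" for j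
    using pos by (intro contour_integrable_continuous_linepath continuous_intros gI) auto
  have int3: "(\<lambda>w. (g w * ?q w j) * kernel_coeff d t l j z) contour_integrable_on ?L" for j
    by (rule contour_integrable_rmul[OF int2])
  have int4: "(\<lambda>w. \<Sum>j<N. (g w * ?q w j) * kernel_coeff d t l j z) contour_integrable_on ?L"
    by (rule contour_integrable_sum[OF finite_lessThan int3])
  have "contour_integral ?L (\<lambda>w. \<Sum>j<N. (g w * ?q w j) * kernel_coeff d t l j z)
      = (\<Sum>j<N. contour_integral ?L (\<lambda>w. (g w * ?q w j) * kernel_coeff d t l j z))"
    by (rule contour_integral_sum[OF finite_lessThan int3])
  also have "\<dots> = (\<Sum>j<N. segment_moment d t l j g * kernel_coeff d t l j z)"
    by (simp only: segment_moment_def contour_integral_rmul[OF int2])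
  finally have "contour_integral ?L (\<lambda>w. g w * gauss_kernel (w - z)) - (\<Sum>j<N. segment_moment d t l j g * kernel_coeff d t l j z)
      = contour_integral ?L (\<lambda>w. g w * gauss_kernel (w - z) - (\<Sum>j<N. (g w * ?q w j) * kernel_coeff d t l j z))"
    by (simp only: contour_integral_diff[OF int1 int4])
  also have "norm \<dots> \<le> (M * (decay l z * (2 / 3) ^ N / (1 - 2 / 3))) * norm (mesh d t (real_of_int l + 1) - mesh d t l)"
  proof (rule contour_integral_bound_linepath)
    show "(\<lambda>w. g w * gauss_kernel (w - z) - (\<Sum>j<N. (g w * ?q w j) * kernel_coeff d t l j z)) contour_integrable_on ?L"
      by (rule contour_integrable_diff[OF int1 int4])
    show "0 \<le> M * (decay l z * (2 / 3) ^ N / (1 - 2 / 3))"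
      using M0 decay_nonneg[of l z] by simp
    fix w assume w: "w \<in> ?I"
    have wm: "norm (w - ?m) \<le> d / 2" and Imw: "Im w = t" using mesh_segment[OF w] pos by auto
    have "norm (gauss_kernel (w - z) - (\<Sum>j<N. kernel_coeff d t l j z * ?q w j)) \<le> decay l z * (2 / 3) ^ N / (1 - 2 / 3)"
    proof (rule sums_geometric_tail[OF kernel_coeff_sums[OF z t wm]])
      fix n
      have "norm (?q w n) \<le> 1"
        unfolding norm_power norm_divide norm_of_real using wm pos by (intro power_le_one) auto
      then have "norm (kernel_coeff d t l n z) * norm (?q w n) \<le> norm (kernel_coeff d t l n z) * 1"
        by (intro mult_left_mono) auto
      then show "norm (kernel_coeff d t l n z * ?q w n) \<le> decay l z * (2 / 3) ^ n"
        using norm_kernel_coeff_le[OF z t, of l n] by (simp only: norm_mult)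
    qed auto
    then have "norm (g w) * norm (gauss_kernel (w - z) - (\<Sum>j<N. kernel_coeff d t l j z * ?q w j)) \<le> M * (decay l z * (2 / 3) ^ N / (1 - 2 / 3))"
      using M[OF Imw] M0 by (intro mult_mono) auto
    also have "norm (g w) * norm (gauss_kernel (w - z) - (\<Sum>j<N. kernel_coeff d t l j z * ?q w j))
        = norm (g w * gauss_kernel (w - z) - (\<Sum>j<N. (g w * ?q w j) * kernel_coeff d t l j z))"
      unfolding norm_mult[symmetric] by (simp add: right_diff_distrib sum_distrib_left mult_ac)
    finally show "norm (g w * gauss_kernel (w - z) - (\<Sum>j<N. (g w * ?q w j) * kernel_coeff d t l j z))
        \<le> M * (decay l z * (2 / 3) ^ N / (1 - 2 / 3))" .
  qed
  also have "norm (mesh d t (real_of_int l + 1) - mesh d t l) = d"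
  proof -
    have "mesh d t (real_of_int l + 1) - mesh d t l = of_real d" by (simp add: mesh_def complex_eq_iff algebra_simps)
    then show ?thesis using pos by simp
  qed
  finally show ?thesis by (simp add: mult_ac)
qed

lemma norm_segment_moment_le:
  assumes g: "continuous_on {w. Im w = t} g" and M: "\<And>w. Im w = t \<Longrightarrow> norm (g w) \<le> M"
  shows "norm (segment_moment d t l j g) \<le> M * d"
proof -
  let ?m = "mesh d t (l + 1 / 2)" and ?I = "closed_segment (mesh d t l) (mesh d t (real_of_int l + 1))"
  have sub: "?I \<subseteq> {w. Im w = t}" by (auto dest: mesh_segment(1)[OF _ pos(2)])
  have gI: "continuous_on ?I g" by (rule continuous_on_subset[OF g sub])
  have "norm (g ?m) \<le> M" by (rule M) (simp add: mesh_def)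
  then have M0: "M \<ge> 0" by (rule order_trans[OF norm_ge_zero])
  have "norm (segment_moment d t l j g) \<le> M * norm (mesh d t (real_of_int l + 1) - mesh d t l)"
    unfolding segment_moment_def
  proof (rule contour_integral_bound_linepath)
    show "(\<lambda>w. g w * ((w - ?m) / of_real (d / 2)) ^ j) contour_integrable_on linepath (mesh d t l) (mesh d t (real_of_int l + 1))"
      using pos by (intro contour_integrable_continuous_linepath continuous_intros gI) auto
    fix w assume w: "w \<in> ?I"
    have wm: "norm (w - ?m) \<le> d / 2" and Imw: "Im w = t" using mesh_segment[OF w] pos by auto
    have "norm (((w - ?m) / of_real (d / 2)) ^ j) \<le> 1"
      unfolding norm_power norm_divide norm_of_real using wm pos by (intro power_le_one) auto
    then have "norm (g w) * norm (((w - ?m) / of_real (d / 2)) ^ j) \<le> M * 1"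
      using M[OF Imw] M0 by (intro mult_mono) auto
    then show "norm (g w * ((w - ?m) / of_real (d / 2)) ^ j) \<le> M" by (simp only: norm_mult)
  qed (use M0 in auto)
  also have "norm (mesh d t (real_of_int l + 1) - mesh d t l) = d"
  proof -
    have "mesh d t (real_of_int l + 1) - mesh d t l = of_real d" by (simp add: mesh_def complex_eq_iff algebra_simps)
    then show ?thesis using pos by simp
  qed
  finally show ?thesis .
qed

lemma segment_moment_linear:
  assumes f: "continuous_on {w. Im w = t} f" and g: "continuous_on {w. Im w = t} g"
  shows "segment_moment d t l j (\<lambda>w. f w + g w) = segment_moment d t l j f + segment_moment d t l j g"
    and "segment_moment d t l j (\<lambda>w. c * f w) = c * segment_moment d t l j f"
proof -
  have sub: "closed_segment (mesh d t l) (mesh d t (real_of_int l + 1)) \<subseteq> {w. Im w = t}" by (auto dest: mesh_segment(1)[OF _ pos(2)])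
  have int: "(\<lambda>w. h w * ((w - mesh d t (l + 1 / 2)) / of_real (d / 2)) ^ j) contour_integrable_on
      linepath (mesh d t l) (mesh d t (real_of_int l + 1))" if "continuous_on {w. Im w = t} h" for h
    using pos by (intro contour_integrable_continuous_linepath continuous_intros continuous_on_subset[OF that sub]) auto
  show "segment_moment d t l j (\<lambda>w. f w + g w) = segment_moment d t l j f + segment_moment d t l j g"
    using contour_integral_add[OF int[OF f] int[OF g]] by (simp only: segment_moment_def distrib_right)
  show "segment_moment d t l j (\<lambda>w. c * f w) = c * segment_moment d t l j f"
    using contour_integral_lmul[OF int[OF f], of c] by (simp only: segment_moment_def mult.assoc)
qed

end

lemma contour_integral_mesh_sum:
  assumes d: "d > 0" and F: "continuous_on {w. Im w = t} F"
  shows "contour_integral (linepath (mesh d t (of_int a)) (mesh d t (of_int a + real n))) F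
    = (\<Sum>l\<in>{a..<a + int n}. contour_integral (linepath (mesh d t (of_int l)) (mesh d t (of_int l + 1))) F)"
proof (induction n)
  case 0 then show ?case
    by (simp only: of_nat_0 add_0_right contour_integral_trivial atLeastLessThan_empty order_refl sum.empty)
next
  case (Suc n)
  let ?p = "\<lambda>x :: real. mesh d t x"
  have seg: "closed_segment (?p x) (?p y) = {w. Im w = t \<and> Re w \<in> {x * d..y * d}}" if "x \<le> y" for x y
    using that d by (subst closed_segment_same_Im) (auto simp: mesh_def closed_segment_eq_real_ivl mult_right_mono)
  have "contour_integral (linepath (?p (of_int a)) (?p (of_int a + real (Suc n)))) F
      = contour_integral (linepath (?p (of_int a)) (?p (of_int a + real n))) F
        + contour_integral (linepath (?p (of_int a + real n)) (?p (of_int a + real (Suc n)))) F"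
  proof (rule contour_integral_split_linepath)
    show "continuous_on (closed_segment (?p (of_int a)) (?p (of_int a + real (Suc n)))) F"
      by (rule continuous_on_subset[OF F]) (auto simp: seg)
    show "?p (of_int a + real n) \<in> closed_segment (?p (of_int a)) (?p (of_int a + real (Suc n)))"
      using d by (subst seg) (auto simp: mesh_def mult_right_mono)
  qed
  moreover have "{a..<a + int (Suc n)} = insert (a + int n) {a..<a + int n}" by auto
  ultimately show ?case using Suc.IH by (simp add: algebra_simps)
qed

context nested_strips
begin

lemma norm_kernel_vertical:
  assumes z: "z \<in> strip \<alpha>" and w: "\<bar>Im w\<bar> \<le> b" and R: "1 \<le> R" "R \<le> \<bar>Re w - Re z\<bar>"
  shows "norm (gauss_kernel (w - z)) \<le> exp ((2 * b)\<^sup>2) / (1 + R\<^sup>2)"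
proof -
  have z': "\<bar>Im z\<bar> < \<alpha>" using z by (simp add: strip_def)
  have "norm (w - z) \<ge> 1" using R abs_Re_le_cmod[of "w - z"] by simp
  then have "norm (gauss_kernel (w - z)) \<le> norm (exp (- (w - z)\<^sup>2))"
    by (simp add: gauss_kernel_def norm_divide divide_le_eq mult_left_mono_neg mult_ge1_I)
  also have "\<dots> \<le> exp ((Im (w - z))\<^sup>2) / (1 + (Re (w - z))\<^sup>2)" by (rule norm_gauss_le)
  also have "\<dots> \<le> exp ((2 * b)\<^sup>2) / (1 + R\<^sup>2)"
  proof (rule frac_le)
    have "\<bar>Im (w - z)\<bar> \<le> \<bar>2 * b\<bar>" using z' w b_def pos by simp
    then show "exp ((Im (w - z))\<^sup>2) \<le> exp ((2 * b)\<^sup>2)" by (simp only: exp_le_cancel_iff abs_le_square_iff)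
    have "\<bar>R\<bar> \<le> \<bar>Re (w - z)\<bar>" using R by simp
    then show "1 + R\<^sup>2 \<le> 1 + (Re (w - z))\<^sup>2" by (simp only: add_le_cancel_left abs_le_square_iff)
  qed (auto intro: add_pos_nonneg)
  finally show ?thesis .
qed

lemma kernel_continuous_on_line:
  assumes z: "z \<in> strip \<alpha>" and t: "\<bar>t\<bar> = b" and g: "continuous_on {w. Im w = t} g"
  shows "continuous_on {w. Im w = t} (\<lambda>w. g w * gauss_kernel (w - z))"
proof (intro continuous_on_mult g continuous_on_compose2[OF holomorphic_on_imp_continuous_on[OF gauss_kernel_holomorphic]])
  show "(\<lambda>w. w - z) ` {w. Im w = t} \<subseteq> - {0}"
  proof (intro image_subsetI ComplI)
    fix w assume "w \<in> {w. Im w = t}" "w - z \<in> {0}"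
    then show False using mesh_away(1)[OF z, of w] t pos by auto
  qed
qed (intro continuous_intros)

text \<open>
  Cauchy's formula for a rectangle; the vertical sides contribute at most the bound on the right.
\<close>

lemma cauchy_rectangle:
  assumes z: "z \<in> strip \<alpha>" and \<beta>: "b < \<beta>" and g: "g holomorphic_on strip \<beta>"
    and M: "\<And>w. w \<in> strip \<beta> \<Longrightarrow> norm (g w) \<le> M" and N: "real N * d - \<bar>Re z\<bar> \<ge> 1"
  shows "norm (contour_integral (linepath (mesh d (- b) (- real N)) (mesh d (- b) (real N))) (\<lambda>w. g w * gauss_kernel (w - z))
      - contour_integral (linepath (mesh d b (- real N)) (mesh d b (real N))) (\<lambda>w. g w * gauss_kernel (w - z))
      - 2 * pi * \<i> * g z) \<le> 4 * b * M * exp ((2 * b)\<^sup>2) / (1 + (real N * d - \<bar>Re z\<bar>)\<^sup>2)"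
proof -
  define F where "F w = g w * gauss_kernel (w - z)" for w
  define R where "R = real N * d - \<bar>Re z\<bar>"
  let ?a = "mesh d (- b) (- real N)" and ?b = "mesh d (- b) (real N)"
  let ?c = "mesh d b (real N)" and ?e = "mesh d b (- real N)"
  have b0: "b > 0" using pos b_def by simp
  have Nd: "real N * d > 0" using N by linarith
  have zin: "\<bar>Im z\<bar> < b" using z pos b_def by (simp add: strip_def)
  have cs: "convex (strip \<beta>)"
  proof -
    have "strip \<beta> = {w. Im w < \<beta>} \<inter> {w. Im w > - \<beta>}" by (auto simp: strip_def)
    then show ?thesis by (simp add: convex_Int convex_halfspace_Im_lt convex_halfspace_Im_gt)
  qed
  have os: "open (strip \<beta>)"
  proof -
    have "strip \<beta> = {w. Im w < \<beta>} \<inter> {w. Im w > - \<beta>}" by (auto simp: strip_def)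
    then show ?thesis by (simp add: open_Int open_halfspace_Im_lt open_halfspace_Im_gt)
  qed
  have rp: "rectpath ?a ?c = linepath ?a ?b +++ linepath ?b ?c +++ linepath ?c ?e +++ linepath ?e ?a"
    by (simp add: rectpath_def Let_def mesh_def)
  have pim: "path_image (rectpath ?a ?c) = {w. Re w \<in> {- (real N * d), real N * d} \<and> Im w \<in> {- b..b}} \<union>
      {w. Im w \<in> {- b, b} \<and> Re w \<in> {- (real N * d)..real N * d}}"
    using b0 Nd by (subst path_image_rectpath) (auto simp: mesh_def)
  have sub: "path_image (rectpath ?a ?c) \<subseteq> strip \<beta> - {z}"
    unfolding pim using zin \<beta> b0 N by (auto simp: strip_def)
  have Fhol: "F holomorphic_on strip \<beta> - {z}"
    unfolding F_def gauss_kernel_def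
    by (intro holomorphic_intros holomorphic_on_subset[OF g]) auto
  have Fc: "continuous_on (path_image (rectpath ?a ?c)) F"
    by (rule continuous_on_subset[OF holomorphic_on_imp_continuous_on[OF Fhol] sub])
  have parts: "closed_segment ?a ?b \<subseteq> path_image (rectpath ?a ?c)" "closed_segment ?b ?c \<subseteq> path_image (rectpath ?a ?c)"
    "closed_segment ?c ?e \<subseteq> path_image (rectpath ?a ?c)" "closed_segment ?e ?a \<subseteq> path_image (rectpath ?a ?c)"
    unfolding rp by (auto simp: path_image_join)
  have ints: "F contour_integrable_on linepath ?a ?b" "F contour_integrable_on linepath ?b ?c"
    "F contour_integrable_on linepath ?c ?e" "F contour_integrable_on linepath ?e ?a"
    by (intro contour_integrable_continuous_linepath continuous_on_subset[OF Fc] parts)+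
  have "((\<lambda>w. g w * exp (- (w - z)\<^sup>2) / (w - z)) has_contour_integral
      2 * pi * \<i> * winding_number (rectpath ?a ?c) z * (g z * exp (- (z - z)\<^sup>2))) (rectpath ?a ?c)"
  proof (rule Cauchy_integral_formula_convex_simple[OF cs])
    show "(\<lambda>w. g w * exp (- (w - z)\<^sup>2)) holomorphic_on strip \<beta>" by (intro holomorphic_intros g)
    show "z \<in> interior (strip \<beta>)" using zin \<beta> os by (simp add: interior_open strip_def)
  qed (use sub in auto)
  moreover have "winding_number (rectpath ?a ?c) z = 1"
    by (rule winding_number_rectpath) (use zin N in \<open>auto simp: in_box_complex_iff mesh_def\<close>)
  ultimately have "(F has_contour_integral 2 * pi * \<i> * g z) (rectpath ?a ?c)"
    by (simp add: F_def[abs_def] gauss_kernel_def)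
  then have "contour_integral (rectpath ?a ?c) F = 2 * pi * \<i> * g z" by (rule contour_integral_unique)
  moreover have "contour_integral (rectpath ?a ?c) F = contour_integral (linepath ?a ?b) F + (contour_integral (linepath ?b ?c) F
      + (contour_integral (linepath ?c ?e) F + contour_integral (linepath ?e ?a) F))"
    unfolding rp using ints by (simp add: contour_integrable_join)
  moreover have "contour_integral (linepath ?c ?e) F = - contour_integral (linepath ?e ?c) F"
    using contour_integral_reversepath[of "linepath ?e ?c" F] by (simp add: reversepath_linepath)
  ultimately have eq: "contour_integral (linepath ?a ?b) F - contour_integral (linepath ?e ?c) F - 2 * pi * \<i> * g z
      = - (contour_integral (linepath ?b ?c) F + contour_integral (linepath ?e ?a) F)"
    by (simp add: algebra_simps)
  define V where "V = M * (exp ((2 * b)\<^sup>2) / (1 + R\<^sup>2))"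
  have z\<beta>: "z \<in> strip \<beta>" using zin \<beta> by (simp add: strip_def)
  have M0: "M \<ge> 0" by (rule order_trans[OF norm_ge_zero M[OF z\<beta>]])
  have V0: "V \<ge> 0" unfolding V_def using M0 by (intro mult_nonneg_nonneg divide_nonneg_nonneg) auto
  have vert: "norm (F w) \<le> V" if "w \<in> path_image (rectpath ?a ?c)" "\<bar>Re w\<bar> = real N * d" for w
  proof -
    have "w \<in> strip \<beta>" using that(1) sub by auto
    have "\<bar>Im w\<bar> \<le> b" using that(1) b0 unfolding pim by auto
    moreover have "R \<le> \<bar>Re w - Re z\<bar>" using that(2) by (simp add: R_def)
    ultimately have "norm (gauss_kernel (w - z)) \<le> exp ((2 * b)\<^sup>2) / (1 + R\<^sup>2)"
      using N by (intro norm_kernel_vertical[OF z]) (auto simp: R_def)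
    then show ?thesis unfolding F_def V_def norm_mult
      using M[OF \<open>w \<in> strip \<beta>\<close>] M0 by (intro mult_mono) auto
  qed
  have segRe: "\<bar>Re w\<bar> = real N * d" if "w \<in> closed_segment ?b ?c \<union> closed_segment ?e ?a" for w
  proof -
    have 1: "closed_segment ?b ?c = {w. Re w = real N * d \<and> Im w \<in> closed_segment (- b) b}"
      by (subst closed_segment_same_Re) (auto simp: mesh_def)
    have 2: "closed_segment ?e ?a = {w. Re w = - (real N * d) \<and> Im w \<in> closed_segment b (- b)}"
      by (subst closed_segment_same_Re) (auto simp: mesh_def)
    show ?thesis using that Nd unfolding 1 2 by auto
  qed
  have "norm (contour_integral (linepath ?b ?c) F) \<le> V * norm (?c - ?b)"
    using ints parts vert segRe V0 by (intro contour_integral_bound_linepath) auto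
  moreover have "norm (contour_integral (linepath ?e ?a) F) \<le> V * norm (?a - ?e)"
    using ints parts vert segRe V0 by (intro contour_integral_bound_linepath) auto
  moreover have "norm (?c - ?b) = 2 * b" "norm (?a - ?e) = 2 * b"
    using b0 by (simp_all add: mesh_def cmod_def real_sqrt_mult)
  ultimately have "norm (contour_integral (linepath ?b ?c) F + contour_integral (linepath ?e ?a) F) \<le> V * (2 * b) + V * (2 * b)"
    by (intro order_trans[OF norm_triangle_ineq add_mono]) auto
  then show ?thesis
    unfolding F_def[symmetric] eq norm_minus_cancel by (simp add: V_def R_def mult_ac)
qed

end

text \<open>
  The index \<open>(\<sigma>, l, j)\<close> stands for the lower or upper line (\<open>\<sigma>\<close>), the segment (\<open>l\<close>), and the order of the
  Taylor coefficient (\<open>j\<close>). The coefficients are scalar linear functionals of a scalar function; for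
  a function with values in a dual space they are applied to its evaluations at vectors.
\<close>

proposition strip_decomposition:
  assumes \<alpha>: "\<alpha> > 0" and \<beta>: "\<beta> > \<alpha>"
  obtains C :: real and f :: "bool \<times> int \<times> nat \<Rightarrow> complex \<Rightarrow> complex"
    and c :: "bool \<times> int \<times> nat \<Rightarrow> (complex \<Rightarrow> complex) \<Rightarrow> complex"
  where "C \<ge> 0"
    and "\<And>i. f i \<in> Hinf (strip \<alpha>)"
    and "\<And>J z. finite J \<Longrightarrow> z \<in> strip \<alpha> \<Longrightarrow> (\<Sum>i\<in>J. norm (f i z)) \<le> C"
    and "\<And>i g h. g holomorphic_on strip \<beta> \<Longrightarrow> h holomorphic_on strip \<beta> \<Longrightarrow> c i (\<lambda>z. g z + h z) = c i g + c i h"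
    and "\<And>i g a. g holomorphic_on strip \<beta> \<Longrightarrow> c i (\<lambda>z. a * g z) = a * c i g"
    and "\<And>i g M. g holomorphic_on strip \<beta> \<Longrightarrow> (\<And>z. z \<in> strip \<beta> \<Longrightarrow> norm (g z) \<le> M) \<Longrightarrow> norm (c i g) \<le> C * M"
    and "\<And>g M z. g holomorphic_on strip \<beta> \<Longrightarrow> (\<And>z. z \<in> strip \<beta> \<Longrightarrow> norm (g z) \<le> M) \<Longrightarrow> z \<in> strip \<alpha> \<Longrightarrow>
        (\<lambda>N. \<Sum>i\<in>UNIV \<times> {- int N..<int N} \<times> {..<N}. c i g * f i z) \<longlonglongrightarrow> g z"
proof -
  define d where "d = (\<beta> - \<alpha>) / 2"
  define b where "b = \<alpha> + d"
  interpret nested_strips \<alpha> b d by unfold_locales (use \<alpha> \<beta> in \<open>auto simp: d_def b_def\<close>)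
  have d0: "d > 0" and b\<beta>: "b < \<beta>" and b0: "b > 0" using \<alpha> \<beta> by (auto simp: d_def b_def field_simps)
  define t where "t \<sigma> = (if \<sigma> then - b else b)" for \<sigma>
  have t: "\<bar>t \<sigma>\<bar> = b" for \<sigma> using b0 by (simp add: t_def)
  define s :: "bool \<Rightarrow> complex" where "s \<sigma> = (if \<sigma> then 1 else - 1) / (2 * pi * \<i>)" for \<sigma>
  have s: "norm (s \<sigma>) \<le> 1" for \<sigma>
    using pi_gt3 by (auto simp: s_def norm_divide norm_mult divide_simps)
  define f where "f i z = (case i of (\<sigma>, l, j) \<Rightarrow> if z \<in> strip \<alpha> then s \<sigma> * kernel_coeff d (t \<sigma>) l j z else 0)" for i z
  define c where "c i g = (case i of (\<sigma>, l, j) \<Rightarrow> segment_moment d (t \<sigma>) l j g)" for i g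
  obtain S where S: "S \<ge> 0" "\<And>(L :: int set) x. finite L \<Longrightarrow> (\<Sum>l\<in>L. 1 / (1 + (real_of_int l * d - x)\<^sup>2)) \<le> S"
    by (rule lattice_sum_bound[OF d0], rule that)
  have decay_sum: "(\<Sum>l\<in>L. decay l z) \<le> kernel_bound * S" if "finite L" for L z
  proof -
    have "(\<Sum>l\<in>L. decay l z) = kernel_bound * (\<Sum>l\<in>L. 1 / (1 + (real_of_int l * d - (Re z - d / 2))\<^sup>2))"
      by (simp add: decay_def sum_distrib_left)
    then show ?thesis using mult_left_mono[OF S(2)[OF that], of kernel_bound] kernel_bound_pos by simp
  qed
  have line: "{w. Im w = t \<sigma>} \<subseteq> strip \<beta>" for \<sigma> using t[of \<sigma>] b\<beta> by (auto simp: strip_def)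
  have contl: "continuous_on {w. Im w = t \<sigma>} g" if "g holomorphic_on strip \<beta>" for g \<sigma>
    by (rule continuous_on_subset[OF holomorphic_on_imp_continuous_on[OF that] line])
  have fle: "norm (f (\<sigma>, l, j) z) \<le> decay l z * (2 / 3) ^ j" if "z \<in> strip \<alpha>" for \<sigma> l j z
  proof -
    have "norm (f (\<sigma>, l, j) z) \<le> 1 * norm (kernel_coeff d (t \<sigma>) l j z)"
      using s[of \<sigma>] that by (simp only: f_def prod.case if_True norm_mult) (intro mult_right_mono, auto)
    then show ?thesis using norm_kernel_coeff_le[OF that t, of \<sigma> l j] by simp
  qed
  have sumf: "(\<Sum>i\<in>J. norm (f i z)) \<le> 6 * kernel_bound * S" if J: "finite J" and z: "z \<in> strip \<alpha>" for J z
  proof -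
    define L where "L = (\<lambda>i. fst (snd i)) ` J"
    define K where "K = (\<lambda>i. snd (snd i)) ` J"
    have fin: "finite L" "finite K" using J by (auto simp: L_def K_def)
    have geo: "(\<Sum>j\<in>K. (2 / 3 :: real) ^ j) \<le> 3"
      using sum_le_suminf[OF summable_geometric[of "2 / 3 :: real"] fin(2)] suminf_geometric[of "2 / 3 :: real"] by simp
    have sub: "J \<subseteq> UNIV \<times> L \<times> K" by (force simp: L_def K_def)
    have "(\<Sum>i\<in>J. norm (f i z)) \<le> (\<Sum>i\<in>UNIV \<times> L \<times> K. norm (f i z))"
      using fin sub by (intro sum_mono2) auto
    also have "\<dots> = (\<Sum>\<sigma>\<in>UNIV. \<Sum>l\<in>L. \<Sum>j\<in>K. norm (f (\<sigma>, l, j) z))"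
      by (simp add: sum.cartesian_product)
    also have "\<dots> \<le> (\<Sum>\<sigma>\<in>(UNIV :: bool set). \<Sum>l\<in>L. \<Sum>j\<in>K. decay l z * (2 / 3) ^ j)"
      by (intro sum_mono fle z)
    also have "\<dots> = 2 * ((\<Sum>l\<in>L. decay l z) * (\<Sum>j\<in>K. (2 / 3) ^ j))"
      by (simp add: sum_product)
    also have "\<dots> \<le> 2 * ((kernel_bound * S) * 3)"
      using geo decay_sum[OF fin(1)] kernel_bound_pos S(1) by (intro mult_left_mono mult_mono) (auto intro!: sum_nonneg)
    finally show ?thesis by simp
  qed
  define C where "C = max (6 * kernel_bound * S) d"
  show ?thesis
  proof (rule that[of C f c])
    show "C \<ge> 0" using d0 by (simp add: C_def)
    show sC: "(\<Sum>i\<in>J. norm (f i z)) \<le> C" if "finite J" "z \<in> strip \<alpha>" for J z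
      using sumf[OF that] by (simp add: C_def)
    show "f i \<in> Hinf (strip \<alpha>)" for i
    proof -
      obtain \<sigma> l j where i: "i = (\<sigma>, l, j)" by (cases i) auto
      have "(\<lambda>z. s \<sigma> * kernel_coeff d (t \<sigma>) l j z) holomorphic_on strip \<alpha>"
      proof -
        have "(\<lambda>z. (deriv ^^ j) gauss_kernel (mesh d (t \<sigma>) (l + 1 / 2) - z)) holomorphic_on strip \<alpha>"
        proof (rule holomorphic_on_compose_gen[of "\<lambda>z. mesh d (t \<sigma>) (l + 1 / 2) - z" _ "(deriv ^^ j) gauss_kernel" "- {0}", unfolded comp_def])
          show "(deriv ^^ j) gauss_kernel holomorphic_on - {0}"
            by (intro holomorphic_higher_deriv gauss_kernel_holomorphic) auto
          show "(\<lambda>z. mesh d (t \<sigma>) (l + 1 / 2) - z) ` strip \<alpha> \<subseteq> - {0}"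
          proof (intro image_subsetI ComplI)
            fix z assume "z \<in> strip \<alpha>" "mesh d (t \<sigma>) (l + 1 / 2) - z \<in> {0}"
            then show False using mesh_away(1)[of z "mesh d (t \<sigma>) (l + 1 / 2)"] t[of \<sigma>] d0 by (auto simp: mesh_def)
          qed
        qed (intro holomorphic_intros)
        then show ?thesis unfolding kernel_coeff_def by (intro holomorphic_intros) auto
      qed
      then have "f i holomorphic_on strip \<alpha>"
        by (rule holomorphic_transform) (simp add: f_def i)
      moreover have "bounded (f i ` strip \<alpha>)"
        using sC[of "{i}"] by (auto simp: bounded_iff)
      ultimately show ?thesis by (simp add: Hinf_def f_def i)
    qed
    fix i :: "bool \<times> int \<times> nat"
    obtain \<sigma> l j where i: "i = (\<sigma>, l, j)" by (cases i) auto
    show "c i (\<lambda>z. g z + h z) = c i g + c i h" if "g holomorphic_on strip \<beta>" "h holomorphic_on strip \<beta>" for g h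
      using segment_moment_linear(1)[OF contl[OF that(1)] contl[OF that(2)]] by (simp add: c_def i)
    show "c i (\<lambda>z. a * g z) = a * c i g" if "g holomorphic_on strip \<beta>" for g a
      using segment_moment_linear(2)[OF contl[OF that] contl[OF that]] by (simp add: c_def i)
    show "norm (c i g) \<le> C * M" if g: "g holomorphic_on strip \<beta>" and M: "\<And>z. z \<in> strip \<beta> \<Longrightarrow> norm (g z) \<le> M" for g M
    proof -
      have M0: "M \<ge> 0" using order_trans[OF norm_ge_zero M[of 0]] \<alpha> \<beta> by (simp add: strip_def)
      have "norm (c i g) \<le> M * d"
        unfolding c_def i prod.case by (rule norm_segment_moment_le[OF contl[OF g]]) (use M line[of \<sigma>] in auto)
      also have "\<dots> \<le> M * C" using M0 by (intro mult_left_mono) (auto simp: C_def)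
      finally show ?thesis by (simp add: mult.commute)
    qed
  next
    fix g M z
    assume g: "g holomorphic_on strip \<beta>" and M: "\<And>z. z \<in> strip \<beta> \<Longrightarrow> norm (g z) \<le> M" and z: "z \<in> strip \<alpha>"
    define F where "F w = g w * gauss_kernel (w - z)" for w
    define P where "P N = (\<Sum>i\<in>UNIV \<times> {- int N..<int N} \<times> {..<N}. c i g * f i z)" for N
    define I where "I \<sigma> N = contour_integral (linepath (mesh d (t \<sigma>) (- real N)) (mesh d (t \<sigma>) (real N))) F" for \<sigma> N
    define Q where "Q \<sigma> l = contour_integral (linepath (mesh d (t \<sigma>) (real_of_int l)) (mesh d (t \<sigma>) (real_of_int l + 1))) F" for \<sigma> l
    define A where "A N \<sigma> l = (\<Sum>j<N. segment_moment d (t \<sigma>) l j g * kernel_coeff d (t \<sigma>) l j z)" for N \<sigma> l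
    have M0: "M \<ge> 0" using order_trans[OF norm_ge_zero M[of 0]] \<alpha> \<beta> by (simp add: strip_def)
    have I_sum: "I \<sigma> N = (\<Sum>l\<in>{- int N..<int N}. Q \<sigma> l)" for \<sigma> N
      using contour_integral_mesh_sum[OF d0 kernel_continuous_on_line[OF z t contl[OF g]], of \<sigma> "- int N" "2 * N"]
      by (simp add: I_def Q_def F_def[abs_def])
    have P_eq: "P N = (\<Sum>\<sigma>\<in>UNIV. s \<sigma> * (\<Sum>l\<in>{- int N..<int N}. A N \<sigma> l))" for N
    proof -
      have "P N = (\<Sum>\<sigma>\<in>UNIV. \<Sum>l\<in>{- int N..<int N}. \<Sum>j<N. c (\<sigma>, l, j) g * f (\<sigma>, l, j) z)"
        unfolding P_def by (simp add: sum.cartesian_product)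
      also have "\<dots> = (\<Sum>\<sigma>\<in>UNIV. s \<sigma> * (\<Sum>l\<in>{- int N..<int N}. A N \<sigma> l))"
        using z by (intro sum.cong refl) (simp add: A_def c_def f_def sum_distrib_left mult_ac)
      finally show ?thesis .
    qed
    \<comment> \<open>Truncation of the Taylor series, summed over all segments.\<close>
    have err1: "norm (P N - (\<Sum>\<sigma>\<in>UNIV. s \<sigma> * I \<sigma> N)) \<le> (6 * d * M * (kernel_bound * S)) * (2 / 3) ^ N" for N
    proof -
      have "norm (P N - (\<Sum>\<sigma>\<in>UNIV. s \<sigma> * I \<sigma> N)) = norm (\<Sum>\<sigma>\<in>UNIV. s \<sigma> * (\<Sum>l\<in>{- int N..<int N}. Q \<sigma> l - A N \<sigma> l))"
        unfolding P_eq I_sum by (subst norm_minus_commute) (simp only: sum_subtractf right_diff_distrib)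
      also have "\<dots> \<le> (\<Sum>\<sigma>\<in>(UNIV :: bool set). 1 * (\<Sum>l\<in>{- int N..<int N}. 3 * d * M * decay l z * (2 / 3) ^ N))"
      proof (intro order_trans[OF norm_sum] sum_mono)
        fix \<sigma>
        have "norm (\<Sum>l\<in>{- int N..<int N}. Q \<sigma> l - A N \<sigma> l) \<le> (\<Sum>l\<in>{- int N..<int N}. 3 * d * M * decay l z * (2 / 3) ^ N)"
        proof (intro order_trans[OF norm_sum] sum_mono)
          fix l
          show "norm (Q \<sigma> l - A N \<sigma> l) \<le> 3 * d * M * decay l z * (2 / 3) ^ N"
            unfolding Q_def A_def F_def
            by (rule segment_expansion_error[OF z t contl[OF g]]) (use M line[of \<sigma>] in auto)
        qed
        then show "norm (s \<sigma> * (\<Sum>l\<in>{- int N..<int N}. Q \<sigma> l - A N \<sigma> l)) \<le> 1 * (\<Sum>l\<in>{- int N..<int N}. 3 * d * M * decay l z * (2 / 3) ^ N)"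
          unfolding norm_mult using s[of \<sigma>] by (intro mult_mono) auto
      qed
      also have "\<dots> = 6 * d * M * (2 / 3) ^ N * (\<Sum>l\<in>{- int N..<int N}. decay l z)"
        by (simp add: sum_distrib_left mult_ac)
      also have "\<dots> \<le> 6 * d * M * (2 / 3) ^ N * (kernel_bound * S)"
        using d0 M0 by (intro mult_left_mono decay_sum) auto
      finally show ?thesis by (simp add: mult_ac)
    qed
    \<comment> \<open>Truncation of the lines of integration.\<close>
    have err2: "norm ((\<Sum>\<sigma>\<in>UNIV. s \<sigma> * I \<sigma> N) - g z) \<le> 4 * b * M * exp ((2 * b)\<^sup>2) / (1 + (real N * d - \<bar>Re z\<bar>)\<^sup>2)"
      if N: "real N * d - \<bar>Re z\<bar> \<ge> 1" for N
    proof -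
      have "(\<Sum>\<sigma>\<in>UNIV. s \<sigma> * I \<sigma> N) - g z = (I True N - I False N - 2 * pi * \<i> * g z) / (2 * pi * \<i>)"
        by (simp add: UNIV_bool s_def field_simps)
      then have "norm ((\<Sum>\<sigma>\<in>UNIV. s \<sigma> * I \<sigma> N) - g z) = norm (I True N - I False N - 2 * pi * \<i> * g z) / (2 * pi)"
        by (simp add: norm_divide norm_mult)
      also have "\<dots> \<le> norm (I True N - I False N - 2 * pi * \<i> * g z) / 1"
        using pi_gt3 by (intro divide_left_mono) auto
      also have "\<dots> \<le> 4 * b * M * exp ((2 * b)\<^sup>2) / (1 + (real N * d - \<bar>Re z\<bar>)\<^sup>2)"
        using cauchy_rectangle[OF z b\<beta> g M N] by (simp add: I_def t_def F_def[abs_def])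
      finally show ?thesis .
    qed
    have "(\<lambda>N. P N - (\<Sum>\<sigma>\<in>UNIV. s \<sigma> * I \<sigma> N)) \<longlonglongrightarrow> 0"
    proof (rule Lim_null_comparison[OF always_eventually])
      show "\<forall>N. norm (P N - (\<Sum>\<sigma>\<in>UNIV. s \<sigma> * I \<sigma> N)) \<le> (6 * d * M * (kernel_bound * S)) * (2 / 3) ^ N" using err1 by blast
      show "(\<lambda>N. (6 * d * M * (kernel_bound * S)) * (2 / 3) ^ N) \<longlonglongrightarrow> 0"
        by (intro tendsto_mult_right_zero LIMSEQ_power_zero) auto
    qed
    moreover have "(\<lambda>N. (\<Sum>\<sigma>\<in>UNIV. s \<sigma> * I \<sigma> N) - g z) \<longlonglongrightarrow> 0"
    proof (rule Lim_null_comparison)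
      have *: "filterlim (\<lambda>N. real N * d - \<bar>Re z\<bar>) at_top sequentially"
        using d0 by real_asymp
      then have "eventually (\<lambda>N. real N * d - \<bar>Re z\<bar> \<ge> 1) sequentially"
        by (simp add: filterlim_at_top)
      then show "eventually (\<lambda>N. norm ((\<Sum>\<sigma>\<in>UNIV. s \<sigma> * I \<sigma> N) - g z)
          \<le> 4 * b * M * exp ((2 * b)\<^sup>2) / (1 + (real N * d - \<bar>Re z\<bar>)\<^sup>2)) sequentially"
        by (rule eventually_mono) (rule err2)
      show "(\<lambda>N. 4 * b * M * exp ((2 * b)\<^sup>2) / (1 + (real N * d - \<bar>Re z\<bar>)\<^sup>2)) \<longlonglongrightarrow> 0"
        using d0 by real_asymp
    qed
    ultimately have "(\<lambda>N. (P N - (\<Sum>\<sigma>\<in>UNIV. s \<sigma> * I \<sigma> N)) + ((\<Sum>\<sigma>\<in>UNIV. s \<sigma> * I \<sigma> N) - g z)) \<longlonglongrightarrow> 0 + 0"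
      by (rule tendsto_add)
    then have "(\<lambda>N. P N - g z) \<longlonglongrightarrow> 0" by simp
    then show "(\<lambda>N. \<Sum>i\<in>UNIV \<times> {- int N..<int N} \<times> {..<N}. c i g * f i z) \<longlonglongrightarrow> g z"
      unfolding P_def by (simp only: LIM_zero_iff)
  qed
qed

section \<open>Gaussian sums and radonifying series\<close>

lemma clinear_sum_scaleC:
  assumes "clinear f" "finite A"
  shows "f (\<Sum>i\<in>A. c i *\<^sub>C x i) = (\<Sum>i\<in>A. c i *\<^sub>C f (x i))"
proof -
  have f: "f (x + y) = f x + f y" "f (a *\<^sub>C x) = a *\<^sub>C f x" for x y a
    using assms(1) by (auto simp: complex_linear_clinear_iff)
  have "f 0 = 0" using f(2)[of 0 0] by simp
  show ?thesis using assms(2) by (induction A rule: finite_induct) (auto simp: f \<open>f 0 = 0\<close>)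
qed

lemma cinner_sum_left: "finite A \<Longrightarrow> cinner (\<Sum>i\<in>A. f i) (y :: 'h :: complex_hilbert) = (\<Sum>i\<in>A. cinner (f i) y)"
proof (induction A rule: finite_induct)
  case empty
  have "cinner (0 + 0) y = cinner 0 y + cinner 0 y" by (rule cinner_add_left)
  then show ?case by simp
qed (simp add: cinner_add_left)

text \<open>
  Evaluate the functional at \<open>\<Sum>e\<in>F. cnj (a e) *\<^sub>C e\<close>.
\<close>

lemma bessel_functional:
  fixes a :: "'h :: complex_hilbert \<Rightarrow> complex"
  assumes a: "clinear a" "\<And>h. norm (a h) \<le> M * norm h" and F: "finite F" "orthonormal F"
  shows "(\<Sum>e\<in>F. (norm (a e))\<^sup>2) \<le> M\<^sup>2"
proof -
  define h where "h = (\<Sum>e\<in>F. cnj (a e) *\<^sub>C e)"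
  define s where "s = (\<Sum>e\<in>F. (norm (a e))\<^sup>2)"
  have "a h = (\<Sum>e\<in>F. cnj (a e) *\<^sub>C a e)" unfolding h_def by (rule clinear_sum_scaleC[OF a(1) F(1)])
  then have ah: "a h = of_real s"
    by (simp add: s_def scaleC_complex_def complex_norm_square mult.commute del: of_real_power)
  have ce: "cinner e h = a e" if "e \<in> F" for e
  proof -
    have "cinner h e = (\<Sum>f\<in>F. cnj (a f) * cinner f e)"
      using F(1) by (simp add: h_def cinner_sum_left cinner_scaleC_left)
    also have "\<dots> = (\<Sum>f\<in>F. if f = e then cnj (a e) else 0)"
      using F(2) that by (intro sum.cong) (auto simp: orthonormal_def)
    also have "\<dots> = cnj (a e)" using F(1) that by simp
    finally show ?thesis using cinner_commute[of e h] by simp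
  qed
  have "cinner h h = (\<Sum>f\<in>F. cnj (a f) * cinner f h)"
    using F(1) by (subst h_def) (simp add: cinner_sum_left cinner_scaleC_left)
  also have "\<dots> = of_real s"
    by (simp add: s_def ce complex_norm_square mult.commute del: of_real_power)
  finally have hs: "(norm h)\<^sup>2 = s"
    unfolding cinner_self of_real_eq_iff .
  have s0: "s \<ge> 0" by (simp add: s_def sum_nonneg)
  have "(norm (a h))\<^sup>2 \<le> (M * norm h)\<^sup>2" by (intro power_mono a) auto
  then have "s\<^sup>2 \<le> M\<^sup>2 * s" using s0 by (simp add: ah hs power_mult_distrib)
  then have "s * s \<le> M\<^sup>2 * s" by (simp only: power2_eq_square[of s])
  then show ?thesis unfolding s_def[symmetric] using s0
    by (cases "s = 0") (auto simp: mult_le_cancel_right)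
qed

text \<open>
  Interchanging the sums, the multiplier of \<open>y i\<close> is \<open>\<Sum>e\<in>F. \<omega> e * a i e\<close>, a Gaussian variable whose variance
  is controlled by Bessel's inequality. The bound depends neither on \<open>F\<close> nor on \<open>I\<close>.
\<close>

proposition finite_gaussian_sum_bound:
  fixes y :: "'i \<Rightarrow> 'x :: complex_banach" and a :: "'i \<Rightarrow> 'h :: complex_hilbert \<Rightarrow> complex" and K M :: real
  assumes cot: "sign_cotype TYPE('x) (2 * m) D" and m: "m \<ge> 1" and D: "D \<ge> 0"
    and F: "finite F" "orthonormal F" and I: "finite I"
    and a: "\<And>i. i \<in> I \<Longrightarrow> clinear (a i)" "\<And>i h. i \<in> I \<Longrightarrow> norm (a i h) \<le> M * norm h" and M: "M \<ge> 0"
    and K: "\<And>v. (\<And>i. norm (v i) \<le> 1) \<Longrightarrow> norm (\<Sum>i\<in>I. v i *\<^sub>C y i) \<le> K"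
  shows "(\<integral>\<^sup>+\<omega>. ennreal ((norm (\<Sum>e\<in>F. \<omega> e *\<^sub>C (\<Sum>i\<in>I. a i e *\<^sub>C y i)))\<^sup>2) \<partial>(\<Pi>\<^sub>M e\<in>F. std_complex_gaussian))
    \<le> ennreal (multiplier_const m D * (M * K)\<^sup>2)"
proof -
  let ?M = "\<Pi>\<^sub>M e\<in>F. std_complex_gaussian"
  define g where "g i \<omega> = (\<Sum>e\<in>F. \<omega> e * (a i e / of_real M))" for i \<omega>
  have eq: "(\<Sum>e\<in>F. \<omega> e *\<^sub>C (\<Sum>i\<in>I. a i e *\<^sub>C y i)) = of_real M *\<^sub>C (\<Sum>i\<in>I. g i \<omega> *\<^sub>C y i)" for \<omega>
  proof -
    have aM: "of_real M * (a i e / of_real M) = a i e" if "i \<in> I" for i e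
      using a(2)[OF that, of e] M by (cases "M = 0") auto
    have "(\<Sum>e\<in>F. \<omega> e *\<^sub>C (\<Sum>i\<in>I. a i e *\<^sub>C y i)) = (\<Sum>e\<in>F. \<Sum>i\<in>I. (\<omega> e * a i e) *\<^sub>C y i)"
      by (simp add: complex_vector.scale_sum_right scaleC_scaleC)
    also have "\<dots> = (\<Sum>i\<in>I. (\<Sum>e\<in>F. \<omega> e * a i e) *\<^sub>C y i)"
      by (subst sum.swap) (simp add: complex_vector.scale_sum_left)
    also have "\<dots> = (\<Sum>i\<in>I. (of_real M * g i \<omega>) *\<^sub>C y i)"
      by (intro sum.cong refl) (simp add: g_def sum_distrib_left mult.left_commute[of "of_real M"] aM del: times_divide_eq_right)
    also have "\<dots> = of_real M *\<^sub>C (\<Sum>i\<in>I. g i \<omega> *\<^sub>C y i)"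
      by (simp add: complex_vector.scale_sum_right scaleC_scaleC)
    finally show ?thesis .
  qed
  have bnd: "(\<integral>\<^sup>+\<omega>. ennreal ((norm (\<Sum>i\<in>I. g i \<omega> *\<^sub>C y i))\<^sup>2) \<partial>?M) \<le> ennreal (multiplier_const m D * K\<^sup>2)"
  proof (rule exponential_tail_multipliers[OF cot m D prob_space_gaussian I _ _ K])
    show "g i \<in> borel_measurable ?M" for i unfolding g_def by measurable
    show "measure ?M {\<omega> \<in> space ?M. t \<le> norm (g i \<omega>)} \<le> 4 * exp (- t / 2)" if "i \<in> I" for i t
      unfolding g_def
    proof (rule gaussian_sum_tail[OF F(1)])
      have "(\<Sum>e\<in>F. (norm (a i e / of_real M))\<^sup>2) = (\<Sum>e\<in>F. (norm (a i e))\<^sup>2) / M\<^sup>2"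
        by (simp add: norm_divide power_divide sum_divide_distrib)
      also have "\<dots> \<le> 1"
        using bessel_functional[OF a(1)[OF that] a(2)[OF that] F] by (auto simp: divide_le_eq)
      finally show "(\<Sum>e\<in>F. (norm (a i e / of_real M))\<^sup>2) \<le> 1" .
    qed
  qed
  have "(\<integral>\<^sup>+\<omega>. ennreal ((norm (\<Sum>e\<in>F. \<omega> e *\<^sub>C (\<Sum>i\<in>I. a i e *\<^sub>C y i)))\<^sup>2) \<partial>?M)
      = (\<integral>\<^sup>+\<omega>. ennreal (M\<^sup>2) * ennreal ((norm (\<Sum>i\<in>I. g i \<omega> *\<^sub>C y i))\<^sup>2) \<partial>?M)"
    unfolding eq by (simp add: norm_scaleC power_mult_distrib ennreal_mult)
  also have "\<dots> = ennreal (M\<^sup>2) * (\<integral>\<^sup>+\<omega>. ennreal ((norm (\<Sum>i\<in>I. g i \<omega> *\<^sub>C y i))\<^sup>2) \<partial>?M)"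
  proof (cases "M = 0")
    case False
    have "(\<lambda>\<omega>. (norm (\<Sum>e\<in>F. \<omega> e *\<^sub>C (\<Sum>i\<in>I. a i e *\<^sub>C y i)))\<^sup>2) \<in> borel_measurable ?M"
      by (rule borel_measurable_integrable[OF integrable_gaussian_sum[OF F(1)]])
    then have "(\<lambda>\<omega>. (norm (\<Sum>e\<in>F. \<omega> e *\<^sub>C (\<Sum>i\<in>I. a i e *\<^sub>C y i)))\<^sup>2 / M\<^sup>2) \<in> borel_measurable ?M"
      by measurable
    then show ?thesis unfolding eq using False by (intro nn_integral_cmult) (simp add: norm_scaleC power_mult_distrib)
  qed simp
  also have "\<dots> \<le> ennreal (M\<^sup>2) * ennreal (multiplier_const m D * K\<^sup>2)" by (intro mult_left_mono bnd) simp
  also have "\<dots> = ennreal (multiplier_const m D * (M * K)\<^sup>2)"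
    using multiplier_const_nonneg[OF m D] by (simp add: power_mult_distrib mult_ac flip: ennreal_mult)
  finally show "(\<integral>\<^sup>+\<omega>. ennreal ((norm (\<Sum>e\<in>F. \<omega> e *\<^sub>C (\<Sum>i\<in>I. a i e *\<^sub>C y i)))\<^sup>2) \<partial>?M) \<le> ennreal (multiplier_const m D * (M * K)\<^sup>2)" .
qed

lemma gaussian_sum_norm_le:
  assumes F: "finite F" and B: "B \<ge> 0"
    and le: "(\<integral>\<^sup>+\<omega>. ennreal ((norm (\<Sum>e\<in>F. \<omega> e *\<^sub>C T e))\<^sup>2) \<partial>(\<Pi>\<^sub>M e\<in>F. std_complex_gaussian)) \<le> ennreal (B\<^sup>2)"
  shows "gaussian_sum_norm T F \<le> B"
proof -
  have "ennreal (\<integral>\<omega>. (norm (\<Sum>e\<in>F. \<omega> e *\<^sub>C T e))\<^sup>2 \<partial>(\<Pi>\<^sub>M e\<in>F. std_complex_gaussian)) \<le> ennreal (B\<^sup>2)"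
    using le by (subst nn_integral_eq_integral[symmetric]) (auto intro: integrable_gaussian_sum F)
  then have "(\<integral>\<omega>. (norm (\<Sum>e\<in>F. \<omega> e *\<^sub>C T e))\<^sup>2 \<partial>(\<Pi>\<^sub>M e\<in>F. std_complex_gaussian)) \<le> B\<^sup>2"
    by (subst (asm) ennreal_le_iff) auto
  then show ?thesis unfolding gaussian_sum_norm_def using B by (intro real_le_lsqrt) auto
qed

text \<open>
  Fatou's lemma.
\<close>

lemma gaussian_integral_limit_le:
  fixes T :: "'h :: complex_hilbert \<Rightarrow> 'x :: complex_banach"
  assumes F: "finite F" and lim: "\<And>e. e \<in> F \<Longrightarrow> (\<lambda>n. S n e) \<longlonglongrightarrow> T e"
    and le: "\<And>n. n \<ge> N \<Longrightarrow> (\<integral>\<^sup>+\<omega>. ennreal ((norm (\<Sum>e\<in>F. \<omega> e *\<^sub>C S n e))\<^sup>2) \<partial>(\<Pi>\<^sub>M e\<in>F. std_complex_gaussian)) \<le> B"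
  shows "(\<integral>\<^sup>+\<omega>. ennreal ((norm (\<Sum>e\<in>F. \<omega> e *\<^sub>C T e))\<^sup>2) \<partial>(\<Pi>\<^sub>M e\<in>F. std_complex_gaussian)) \<le> B"
proof -
  let ?M = "\<Pi>\<^sub>M e\<in>F. std_complex_gaussian"
  have lim': "(\<lambda>n. ennreal ((norm (\<Sum>e\<in>F. \<omega> e *\<^sub>C S n e))\<^sup>2)) \<longlonglongrightarrow> ennreal ((norm (\<Sum>e\<in>F. \<omega> e *\<^sub>C T e))\<^sup>2)" for \<omega>
    by (intro tendsto_ennrealI tendsto_power tendsto_norm tendsto_sum bounded_linear.tendsto[OF bounded_linear_scaleC] lim)
  have "(\<integral>\<^sup>+\<omega>. ennreal ((norm (\<Sum>e\<in>F. \<omega> e *\<^sub>C T e))\<^sup>2) \<partial>?M)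
      = (\<integral>\<^sup>+\<omega>. liminf (\<lambda>n. ennreal ((norm (\<Sum>e\<in>F. \<omega> e *\<^sub>C S n e))\<^sup>2)) \<partial>?M)"
    by (simp only: lim_imp_Liminf[OF sequentially_bot lim'])
  also have "\<dots> \<le> liminf (\<lambda>n. \<integral>\<^sup>+\<omega>. ennreal ((norm (\<Sum>e\<in>F. \<omega> e *\<^sub>C S n e))\<^sup>2) \<partial>?M)"
    by (intro nn_integral_liminf measurable_compose[OF borel_measurable_integrable[OF integrable_gaussian_sum[OF F]] measurable_ennreal])
  also have "\<dots> \<le> B"
  proof -
    have "eventually (\<lambda>n. (\<integral>\<^sup>+\<omega>. ennreal ((norm (\<Sum>e\<in>F. \<omega> e *\<^sub>C S n e))\<^sup>2) \<partial>?M) \<le> B) sequentially"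
      using le unfolding eventually_sequentially by blast
    then have "liminf (\<lambda>n. \<integral>\<^sup>+\<omega>. ennreal ((norm (\<Sum>e\<in>F. \<omega> e *\<^sub>C S n e))\<^sup>2) \<partial>?M) \<le> liminf (\<lambda>n :: nat. B)"
      by (rule Liminf_mono)
    then show ?thesis by (simp add: Liminf_const)
  qed
  finally show ?thesis .
qed

text \<open>
  Otherwise one finds successively disjoint blocks with norms above \<open>\<epsilon>\<close>. Sums of such blocks with
  signs are again sums with multipliers bounded by \<open>1\<close>, so cotype bounds the number of blocks.
\<close>

lemma unconditional_tails:
  fixes y :: "'i \<Rightarrow> 'x :: complex_banach"
  assumes cot: "sign_cotype TYPE('x) (2 * m) D"
    and K: "\<And>A v. finite A \<Longrightarrow> (\<And>i. norm (v i) \<le> 1) \<Longrightarrow> norm (\<Sum>i\<in>A. v i *\<^sub>C y i) \<le> K"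
    and J: "\<And>n. finite (J n)" "\<And>A. finite A \<Longrightarrow> \<exists>n :: nat. A \<subseteq> J n" and \<epsilon>: "\<epsilon> > 0"
  shows "\<exists>n. \<forall>A v. finite A \<and> A \<inter> J n = {} \<and> (\<forall>i. norm (v i) \<le> 1) \<longrightarrow> norm (\<Sum>i\<in>A. v i *\<^sub>C y i) \<le> \<epsilon>"
proof (rule ccontr)
  assume "\<not> ?thesis"
  then have ex: "\<exists>A v. finite A \<and> A \<inter> J n = {} \<and> (\<forall>i. norm (v i) \<le> 1) \<and> \<epsilon> < norm (\<Sum>i\<in>A. v i *\<^sub>C y i)" for n
    by (auto simp: not_le)
  have blocks: "\<exists>(x :: nat \<Rightarrow> 'x) N. (\<forall>k<n. \<epsilon> < norm (x k)) \<and>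
      (\<forall>r. (\<forall>k<n. r k \<in> {-1, 1 :: real}) \<longrightarrow> (\<exists>v. (\<forall>i. norm (v i) \<le> 1) \<and> (\<Sum>k<n. r k *\<^sub>R x k) = (\<Sum>i\<in>J N. v i *\<^sub>C y i)))" for n
  proof (induction n)
    case 0
    show ?case by (rule exI[of _ "\<lambda>_. 0"], rule exI[of _ 0]) (auto intro!: exI[of _ "\<lambda>_. 0"])
  next
    case (Suc n)
    then obtain x :: "nat \<Rightarrow> 'x" and N where x: "\<And>k. k < n \<Longrightarrow> \<epsilon> < norm (x k)"
      and r: "\<And>r. (\<forall>k<n. r k \<in> {-1, 1 :: real}) \<Longrightarrow> \<exists>v. (\<forall>i. norm (v i) \<le> 1) \<and> (\<Sum>k<n. r k *\<^sub>R x k) = (\<Sum>i\<in>J N. v i *\<^sub>C y i)"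
      by blast
    obtain A w where A: "finite A" "A \<inter> J N = {}" and w: "\<And>i. norm (w i) \<le> 1" and big: "\<epsilon> < norm (\<Sum>i\<in>A. w i *\<^sub>C y i)"
      using ex[of N] by blast
    obtain N' where N': "A \<union> J N \<subseteq> J N'" using J(2)[of "A \<union> J N"] A J(1) by auto
    define z where "z = (\<Sum>i\<in>A. w i *\<^sub>C y i)"
    show ?case
    proof (rule exI[of _ "x(n := z)"], rule exI[of _ N'], intro conjI allI impI)
      show "\<epsilon> < norm ((x(n := z)) k)" if "k < Suc n" for k
        using that x[of k] big by (auto simp: z_def less_Suc_eq)
      fix \<rho> :: "nat \<Rightarrow> real" assume \<rho>: "\<forall>k<Suc n. \<rho> k \<in> {-1, 1}"
      then obtain v where v: "\<And>i. norm (v i) \<le> 1" "(\<Sum>k<n. \<rho> k *\<^sub>R x k) = (\<Sum>i\<in>J N. v i *\<^sub>C y i)"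
        using r[of \<rho>] by auto
      define v' where "v' i = (if i \<in> A then of_real (\<rho> n) * w i else if i \<in> J N then v i else 0)" for i
      have "norm (\<rho> n) = 1" using \<rho> by (auto dest: spec[of _ n])
      then have "norm (v' i) \<le> 1" for i using v(1)[of i] w[of i] by (simp add: v'_def norm_mult)
      moreover have "(\<Sum>i\<in>J N'. v' i *\<^sub>C y i) = (\<Sum>i\<in>J N \<union> A. v' i *\<^sub>C y i)"
        using N' J(1) by (intro sum.mono_neutral_right) (auto simp: v'_def)
      moreover have "\<dots> = (\<Sum>i\<in>J N. v' i *\<^sub>C y i) + (\<Sum>i\<in>A. v' i *\<^sub>C y i)"
        using A J(1) by (intro sum.union_disjoint) auto
      moreover have "(\<Sum>i\<in>J N. v' i *\<^sub>C y i) = (\<Sum>i\<in>J N. v i *\<^sub>C y i)"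
        using A by (intro sum.cong) (auto simp: v'_def)
      moreover have "(\<Sum>i\<in>A. v' i *\<^sub>C y i) = \<rho> n *\<^sub>R z"
        unfolding z_def scaleR_scaleC complex_vector.scale_sum_right
        by (intro sum.cong) (auto simp: v'_def scaleC_scaleC)
      ultimately show "\<exists>v. (\<forall>i. norm (v i) \<le> 1) \<and> (\<Sum>k<Suc n. \<rho> k *\<^sub>R (x(n := z)) k) = (\<Sum>i\<in>J N'. v i *\<^sub>C y i)"
        using v(2) by (intro exI[of _ v']) auto
    qed
  qed
  have "real n * \<epsilon> ^ (2 * m) \<le> D * K ^ (2 * m)" for n
  proof -
    obtain x :: "nat \<Rightarrow> 'x" and N where x: "\<And>k. k < n \<Longrightarrow> \<epsilon> < norm (x k)"
      and r: "\<And>r. (\<forall>k<n. r k \<in> {-1, 1 :: real}) \<Longrightarrow> \<exists>v. (\<forall>i. norm (v i) \<le> 1) \<and> (\<Sum>k<n. r k *\<^sub>R x k) = (\<Sum>i\<in>J N. v i *\<^sub>C y i)"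
      using blocks[of n] by blast
    have "real n * \<epsilon> ^ (2 * m) = (\<Sum>k<n. \<epsilon> ^ (2 * m))" by simp
    also have "\<dots> \<le> (\<Sum>k<n. norm (x k) ^ (2 * m))"
      using x \<epsilon> by (intro sum_mono power_mono) (auto intro: less_imp_le)
    also have "\<dots> \<le> D * K ^ (2 * m)"
    proof (rule sign_cotypeD[OF cot])
      fix \<rho> :: "nat \<Rightarrow> real" assume "\<And>i. i < n \<Longrightarrow> \<rho> i \<in> {-1, 1}"
      then obtain v where "\<forall>i. norm (v i) \<le> 1" "(\<Sum>k<n. \<rho> k *\<^sub>R x k) = (\<Sum>i\<in>J N. v i *\<^sub>C y i)"
        using r[of \<rho>] by blast
      then show "norm (\<Sum>k<n. \<rho> k *\<^sub>R x k) \<le> K" using K[OF J(1), of v N] by simp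
    qed
    finally show ?thesis .
  qed
  moreover obtain n :: nat where "D * K ^ (2 * m) < real n * \<epsilon> ^ (2 * m)"
    using reals_Archimedean3[of "\<epsilon> ^ (2 * m)"] \<epsilon> by auto
  ultimately show False by (meson not_le)
qed

lemma norm_series_tail_le:
  assumes \<kappa>: "\<And>A v. finite A \<Longrightarrow> A \<inter> B = {} \<Longrightarrow> (\<And>i. norm (v i) \<le> 1) \<Longrightarrow> norm (\<Sum>i\<in>A. v i *\<^sub>C y i) \<le> \<kappa>"
    and A: "finite A" "A \<inter> B = {}" and c: "\<And>i. i \<in> A \<Longrightarrow> norm (c i) \<le> t" and t: "t \<ge> 0"
  shows "norm (\<Sum>i\<in>A. c i *\<^sub>C y i) \<le> t * \<kappa>"
proof -
  have "envelope y A \<le> \<kappa>" by (rule envelope_least) (rule \<kappa>[OF A])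
  then show ?thesis using envelope_scaled_upper[of A c t y, OF c] mult_left_mono[OF _ t, of "envelope y A" \<kappa>] by linarith
qed

lemma unconditional_series_convergent:
  fixes y :: "'i \<Rightarrow> 'x :: complex_banach"
  assumes cot: "sign_cotype TYPE('x) (2 * m) D"
    and K: "\<And>A v. finite A \<Longrightarrow> (\<And>i. norm (v i) \<le> 1) \<Longrightarrow> norm (\<Sum>i\<in>A. v i *\<^sub>C y i) \<le> K"
    and J: "\<And>n. finite (J n)" "\<And>A. finite A \<Longrightarrow> \<exists>n :: nat. A \<subseteq> J n" "mono J"
    and c: "\<And>i. norm (c i) \<le> t"
  shows "convergent (\<lambda>n. \<Sum>i\<in>J n. c i *\<^sub>C y i)"
proof -
  have t: "t \<ge> 0" by (rule order_trans[OF norm_ge_zero c])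
  have "Cauchy (\<lambda>n. \<Sum>i\<in>J n. c i *\<^sub>C y i)"
  proof (rule CauchyI')
    fix \<epsilon> :: real assume \<epsilon>: "\<epsilon> > 0"
    define \<kappa> where "\<kappa> = \<epsilon> / (t + 1)"
    have \<kappa>: "\<kappa> > 0" "t * \<kappa> < \<epsilon>" using \<epsilon> t by (auto simp: \<kappa>_def field_simps)
    obtain N where "\<forall>A v. finite A \<and> A \<inter> J N = {} \<and> (\<forall>i. norm (v i) \<le> 1) \<longrightarrow> norm (\<Sum>i\<in>A. v i *\<^sub>C y i) \<le> \<kappa>"
      using unconditional_tails[OF cot K J(1,2) \<kappa>(1)] by (rule exE)
    then have N: "norm (\<Sum>i\<in>A. v i *\<^sub>C y i) \<le> \<kappa>" if "finite A" "A \<inter> J N = {}" "\<And>i. norm (v i) \<le> 1" for A v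
      using that by simp
    have "norm ((\<Sum>i\<in>J p. c i *\<^sub>C y i) - (\<Sum>i\<in>J q. c i *\<^sub>C y i)) < \<epsilon>" if "N \<le> p" "p < q" for p q
    proof -
      have sub: "J N \<subseteq> J p" "J p \<subseteq> J q" using J(3) that by (auto simp: mono_def)
      have "(\<Sum>i\<in>J q. c i *\<^sub>C y i) - (\<Sum>i\<in>J p. c i *\<^sub>C y i) = (\<Sum>i\<in>J q - J p. c i *\<^sub>C y i)"
        using sub J(1) by (simp add: sum_diff)
      then have "norm ((\<Sum>i\<in>J p. c i *\<^sub>C y i) - (\<Sum>i\<in>J q. c i *\<^sub>C y i)) = norm (\<Sum>i\<in>J q - J p. c i *\<^sub>C y i)"
        by (metis norm_minus_commute)
      also have "\<dots> \<le> t * \<kappa>"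
        by (rule norm_series_tail_le[where B = "J N"]) (use N J(1) sub c t in auto)
      finally show ?thesis using \<kappa>(2) by simp
    qed
    then show "\<exists>N. \<forall>p\<ge>N. \<forall>q>p. dist (\<Sum>i\<in>J p. c i *\<^sub>C y i) (\<Sum>i\<in>J q. c i *\<^sub>C y i) < \<epsilon>"
      unfolding dist_norm by (intro exI[of _ N] allI impI)
  qed
  then show ?thesis by (simp add: Cauchy_convergent_iff)
qed

lemma clinear_partial_sum:
  assumes "\<And>i. i \<in> A \<Longrightarrow> clinear (a i :: 'h :: complex_normed_vector \<Rightarrow> complex)"
  shows "clinear (\<lambda>h. \<Sum>i\<in>A. a i h *\<^sub>C (y i :: 'x :: complex_normed_vector))"
proof -
  have a: "a i (g + h) = a i g + a i h" "a i (c *\<^sub>C h) = c * a i h" if "i \<in> A" for i g h c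
    using assms[OF that, unfolded complex_linear_clinear_iff] by (auto simp: scaleC_complex_def)
  have "(\<Sum>i\<in>A. a i (g + h) *\<^sub>C y i) = (\<Sum>i\<in>A. a i g *\<^sub>C y i) + (\<Sum>i\<in>A. a i h *\<^sub>C y i)" for g h
    unfolding sum.distrib[symmetric] by (intro sum.cong refl) (simp add: a scaleC_add_left)
  moreover have "(\<Sum>i\<in>A. a i (c *\<^sub>C h) *\<^sub>C y i) = c *\<^sub>C (\<Sum>i\<in>A. a i h *\<^sub>C y i)" for c h
    unfolding complex_vector.scale_sum_right by (intro sum.cong refl) (simp add: a scaleC_scaleC)
  ultimately show ?thesis unfolding complex_linear_clinear_iff by blast
qed

text \<open>
  The tail beyond \<open>J N\<close> is estimated like the whole series, with the supremum \<open>\<kappa>\<close> over finite sets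
  disjoint from \<open>J N\<close> in place of \<open>K\<close>; \<open>J 0 = {}\<close> gives the bound for \<open>T\<close> itself.
\<close>

proposition gamma_series:
  fixes y :: "'i \<Rightarrow> 'x :: complex_banach" and a :: "'i \<Rightarrow> 'h :: complex_hilbert \<Rightarrow> complex"
  assumes cot: "sign_cotype TYPE('x) (2 * m) D" "m \<ge> 1" "D \<ge> 0"
    and a: "\<And>i. clinear (a i)" "\<And>i h. norm (a i h) \<le> M * norm h" and M: "M \<ge> 0"
    and K: "\<And>A v. finite A \<Longrightarrow> (\<And>i. norm (v i) \<le> 1) \<Longrightarrow> norm (\<Sum>i\<in>A. v i *\<^sub>C y i) \<le> K"
    and J: "\<And>n. finite (J n)" "\<And>A. finite A \<Longrightarrow> \<exists>n :: nat. A \<subseteq> J n" "mono J" "J 0 = {}"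
    and T: "\<And>h. (\<lambda>n. \<Sum>i\<in>J n. a i h *\<^sub>C y i) \<longlonglongrightarrow> T h"
  shows "T \<in> gamma_radonifying" "gamma_norm T \<le> ennreal (sqrt (multiplier_const m D) * (M * K))"
proof -
  define C where "C = sqrt (multiplier_const m D)"
  have C0: "C \<ge> 0" using multiplier_const_nonneg[OF cot(2,3)] by (simp add: C_def)
  have C2: "(C * (M * k))\<^sup>2 = multiplier_const m D * (M * k)\<^sup>2" for k
    using multiplier_const_nonneg[OF cot(2,3)] by (simp add: C_def power_mult_distrib)
  define P where "P n h = (\<Sum>i\<in>J n. a i h *\<^sub>C y i)" for n h
  have P_lin: "clinear (P n)" for n
    unfolding P_def by (rule clinear_partial_sum) (rule a)
  have K0: "K \<ge> 0" using K[of "{}" "\<lambda>_. 0"] by simp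
  have tail: "gamma_norm (\<lambda>h. T h - P N h) \<le> ennreal (C * (M * \<kappa>))"
    if \<kappa>: "\<And>A v. finite A \<Longrightarrow> A \<inter> J N = {} \<Longrightarrow> (\<And>i. norm (v i) \<le> 1) \<Longrightarrow> norm (\<Sum>i\<in>A. v i *\<^sub>C y i) \<le> \<kappa>" for N \<kappa>
    unfolding gamma_norm_def
  proof (intro SUP_least ennreal_leI)
    fix F :: "'h set" assume "F \<in> {F. finite F \<and> orthonormal F}"
    then have F: "finite F" "orthonormal F" by auto
    have \<kappa>0: "\<kappa> \<ge> 0" using \<kappa>[of "{}" "\<lambda>_. 0"] by simp
    show "gaussian_sum_norm (\<lambda>h. T h - P N h) F \<le> C * (M * \<kappa>)"
    proof (rule gaussian_sum_norm_le[OF F(1)])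
      show "0 \<le> C * (M * \<kappa>)" using C0 M \<kappa>0 by simp
      show "(\<integral>\<^sup>+\<omega>. ennreal ((norm (\<Sum>e\<in>F. \<omega> e *\<^sub>C (T e - P N e)))\<^sup>2) \<partial>(\<Pi>\<^sub>M e\<in>F. std_complex_gaussian))
          \<le> ennreal ((C * (M * \<kappa>))\<^sup>2)"
      proof (rule gaussian_integral_limit_le[OF F(1), where S = "\<lambda>n h. P n h - P N h" and N = N])
        show "(\<lambda>n. P n e - P N e) \<longlonglongrightarrow> T e - P N e" for e
          unfolding P_def by (intro tendsto_diff T tendsto_const)
        fix n assume n: "n \<ge> N"
        then have sub: "J N \<subseteq> J n" using J(3) by (auto simp: mono_def)
        have diff: "P n h - P N h = (\<Sum>i\<in>J n - J N. a i h *\<^sub>C y i)" for h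
          using sub J(1) by (simp add: P_def sum_diff)
        show "(\<integral>\<^sup>+\<omega>. ennreal ((norm (\<Sum>e\<in>F. \<omega> e *\<^sub>C (P n e - P N e)))\<^sup>2) \<partial>(\<Pi>\<^sub>M e\<in>F. std_complex_gaussian))
            \<le> ennreal ((C * (M * \<kappa>))\<^sup>2)"
          unfolding diff C2
        proof (rule finite_gaussian_sum_bound[OF cot F _ a M])
          show "finite (J n - J N)" using J(1) by simp
          show "norm (\<Sum>i\<in>J n - J N. v i *\<^sub>C y i) \<le> \<kappa>" if "\<And>i. norm (v i) \<le> 1" for v
            by (rule \<kappa>) (use J(1) that in auto)
        qed
      qed
    qed
  qed
  have T_le: "gamma_norm T \<le> ennreal (C * (M * K))"
    using tail[of 0 K] K by (simp add: P_def J(4))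
  then show "gamma_norm T \<le> ennreal (sqrt (multiplier_const m D) * (M * K))" by (simp add: C_def)
  have "clinear T"
  proof -
    have lim: "(\<lambda>n. P n h) \<longlonglongrightarrow> T h" for h unfolding P_def by (rule T)
    have P_add: "P n (g + h) = P n g + P n h" and P_scale: "P n (c *\<^sub>C h) = c *\<^sub>C P n h" for n g h c
      using P_lin[of n, unfolded complex_linear_clinear_iff] by blast+
    have "T (g + h) = T g + T h" for g h
    proof (rule LIMSEQ_unique[OF lim])
      show "(\<lambda>n. P n (g + h)) \<longlonglongrightarrow> T g + T h"
        unfolding P_add by (intro tendsto_add lim)
    qed
    moreover have "T (c *\<^sub>C h) = c *\<^sub>C T h" for c h
    proof (rule LIMSEQ_unique[OF lim])
      show "(\<lambda>n. P n (c *\<^sub>C h)) \<longlonglongrightarrow> c *\<^sub>C T h"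
        unfolding P_scale by (rule bounded_linear.tendsto[OF bounded_linear_scaleC lim])
    qed
    ultimately show ?thesis unfolding complex_linear_clinear_iff by blast
  qed
  then have T_inf: "T \<in> gamma_infty"
    using T_le by (auto simp: gamma_infty_def le_less_trans[OF _ ennreal_less_top])
  have P_inf: "P n \<in> gamma_infty" "finite_rank (P n)" for n
  proof -
    have "gamma_norm (P n) \<le> ennreal (C * (M * K))"
      unfolding gamma_norm_def
    proof (intro SUP_least ennreal_leI)
      fix F :: "'h set" assume "F \<in> {F. finite F \<and> orthonormal F}"
      then have F: "finite F" "orthonormal F" by auto
      show "gaussian_sum_norm (P n) F \<le> C * (M * K)"
      proof (rule gaussian_sum_norm_le[OF F(1)])
        show "0 \<le> C * (M * K)" using C0 M K0 by simp
        show "(\<integral>\<^sup>+\<omega>. ennreal ((norm (\<Sum>e\<in>F. \<omega> e *\<^sub>C P n e))\<^sup>2) \<partial>(\<Pi>\<^sub>M e\<in>F. std_complex_gaussian))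
            \<le> ennreal ((C * (M * K))\<^sup>2)"
          unfolding P_def C2 by (rule finite_gaussian_sum_bound[OF cot F J(1) a M K[OF J(1)]])
      qed
    qed
    then show "P n \<in> gamma_infty"
      using P_lin by (auto simp: gamma_infty_def le_less_trans[OF _ ennreal_less_top])
    have "range (P n) \<subseteq> complex_vector.span (y ` J n)"
    proof (rule image_subsetI)
      show "P n h \<in> complex_vector.span (y ` J n)" for h
        unfolding P_def
        by (rule complex_vector.span_sum, rule complex_vector.span_scale, rule complex_vector.span_base, rule imageI)
    qed
    then show "finite_rank (P n)"
      unfolding finite_rank_def by (intro conjI exI[of _ "y ` J n"] P_lin finite_imageI J(1))
  qed
  have "\<exists>S\<in>gamma_infty. finite_rank S \<and> gamma_norm (\<lambda>h. T h - S h) < ennreal \<epsilon>" if \<epsilon>: "\<epsilon> > 0" for \<epsilon>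
  proof -
    define \<kappa> where "\<kappa> = \<epsilon> / (C * M + 1)"
    have "C * M \<ge> 0" using C0 M by simp
    then have \<kappa>: "\<kappa> > 0" "C * (M * \<kappa>) < \<epsilon>" using \<epsilon> by (auto simp: \<kappa>_def field_simps)
    obtain N where "\<forall>A v. finite A \<and> A \<inter> J N = {} \<and> (\<forall>i. norm (v i) \<le> 1) \<longrightarrow> norm (\<Sum>i\<in>A. v i *\<^sub>C y i) \<le> \<kappa>"
      using unconditional_tails[OF cot(1) K J(1,2) \<kappa>(1)] by (rule exE)
    then have N: "norm (\<Sum>i\<in>A. v i *\<^sub>C y i) \<le> \<kappa>" if "finite A" "A \<inter> J N = {}" "\<And>i. norm (v i) \<le> 1" for A v
      using that by simp
    have "gamma_norm (\<lambda>h. T h - P N h) \<le> ennreal (C * (M * \<kappa>))" by (rule tail) (rule N)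
    also have "\<dots> < ennreal \<epsilon>" using \<kappa> \<epsilon> by (intro ennreal_lessI) auto
    finally show ?thesis by (intro bexI[of _ "P N"] conjI P_inf)
  qed
  then show "T \<in> gamma_radonifying" using T_inf by (simp add: gamma_radonifying_def)
qed

section \<open>Functional calculus with a universal regularizer\<close>

lemma HinfI:
  assumes "f holomorphic_on U" "\<And>z. z \<in> U \<Longrightarrow> norm (f z) \<le> B" "\<And>z. z \<notin> U \<Longrightarrow> f z = 0"
  shows "f \<in> Hinf U"
  using assms by (auto simp: Hinf_def bounded_iff)

lemma HinfD:
  assumes "f \<in> Hinf U"
  shows "f holomorphic_on U" "\<exists>B. \<forall>z\<in>U. norm (f z) \<le> B" "z \<notin> U \<Longrightarrow> f z = 0"
  using assms by (auto simp: Hinf_def bounded_iff)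

lemma Hinf_add:
  assumes f: "f \<in> Hinf U" and g: "g \<in> Hinf U"
  shows "(\<lambda>z. f z + g z) \<in> Hinf U"
proof -
  obtain B C where B: "\<And>z. z \<in> U \<Longrightarrow> norm (f z) \<le> B" and C: "\<And>z. z \<in> U \<Longrightarrow> norm (g z) \<le> C"
    using HinfD(2)[OF f] HinfD(2)[OF g] by blast
  show ?thesis
  proof (rule HinfI)
    show "norm (f z + g z) \<le> B + C" if "z \<in> U" for z
      using B[OF that] C[OF that] norm_triangle_ineq[of "f z" "g z"] by linarith
  qed (use HinfD[OF f] HinfD[OF g] in \<open>auto intro: holomorphic_intros\<close>)
qed

lemma Hinf_scale:
  assumes f: "f \<in> Hinf U"
  shows "(\<lambda>z. c * f z) \<in> Hinf U"
proof -
  obtain B where B: "\<And>z. z \<in> U \<Longrightarrow> norm (f z) \<le> B" using HinfD(2)[OF f] by blast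
  show ?thesis
  proof (rule HinfI)
    show "norm (c * f z) \<le> norm c * B" if "z \<in> U" for z
      unfolding norm_mult using B[OF that] by (intro mult_left_mono) auto
  qed (use HinfD[OF f] in \<open>auto intro: holomorphic_intros\<close>)
qed

lemma Hinf_sum:
  assumes "finite A" "\<And>i. i \<in> A \<Longrightarrow> f i \<in> Hinf U"
  shows "(\<lambda>z. \<Sum>i\<in>A. c i * f i z) \<in> Hinf U"
  using assms
proof (induction A rule: finite_induct)
  case empty
  show ?case by (rule HinfI[where B = 0]) auto
next
  case (insert i A)
  then have "(\<lambda>z. c i * f i z + (\<Sum>i\<in>A. c i * f i z)) \<in> Hinf U" by (intro Hinf_add Hinf_scale) auto
  then show ?case using insert by simp
qed

lemma Hinf_norm_le:
  assumes "U \<noteq> {}" "\<And>z. z \<in> U \<Longrightarrow> norm (f z) \<le> B"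
  shows "Hinf_norm U f \<le> B"
  unfolding Hinf_norm_def by (rule cSUP_least) (use assms in auto)

text \<open>
  All values of the calculus on bounded holomorphic functions are compared after applying the
  injective operator \<open>\<Phi> e\<close>, which turns them into values of \<open>\<Phi>\<close> on the algebra \<open>E\<close>.
\<close>

locale regularized_calculus =
  fixes U :: "complex set" and E :: "(complex \<Rightarrow> complex) set"
    and \<Phi> :: "(complex \<Rightarrow> complex) \<Rightarrow> 'x :: complex_banach \<Rightarrow>\<^sub>L 'x" and e :: "complex \<Rightarrow> complex"
  assumes calculus: "functional_calculus U E \<Phi>"
    and e_in: "e \<in> E" and e_mult: "\<And>f. f \<in> Hinf U \<Longrightarrow> (\<lambda>z. e z * f z) \<in> E"
    and e_inj: "inj (blinfun_apply (\<Phi> e))"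
    and dom: "\<And>f. f \<in> Hinf U \<Longrightarrow> fc_dom E \<Phi> f = UNIV"
begin

lemma regularized_apply:
  assumes f: "f \<in> Hinf U"
  shows "\<Phi> e (fc_apply E \<Phi> f x) = \<Phi> (\<lambda>z. e z * f z) x"
proof -
  have reg: "regularizes E \<Phi> e f" using e_in e_mult[OF f] e_inj by (simp add: regularizes_def)
  have gr: "(x, y) \<in> fc_graph E \<Phi> f \<longleftrightarrow> \<Phi> e y = \<Phi> (\<lambda>z. e z * f z) x" for y
    by (rule fc_graph_iff[OF calculus reg])
  have "x \<in> Domain (fc_graph E \<Phi> f)" using dom[OF f] by (simp add: fc_dom_def)
  then obtain y where y: "(x, y) \<in> fc_graph E \<Phi> f" by blast
  have "(x, fc_apply E \<Phi> f x) \<in> fc_graph E \<Phi> f"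
    unfolding fc_apply_def
  proof (rule theI[where P = "\<lambda>y. (x, y) \<in> fc_graph E \<Phi> f", OF y])
    fix y' assume "(x, y') \<in> fc_graph E \<Phi> f"
    then have "\<Phi> e y' = \<Phi> e y" using y by (simp add: gr)
    then show "y' = y" by (rule injD[OF e_inj])
  qed
  then show ?thesis by (simp add: gr)
qed

lemma fc_apply_eqI:
  assumes "f \<in> Hinf U" "\<Phi> e y = \<Phi> (\<lambda>z. e z * f z) x"
  shows "fc_apply E \<Phi> f x = y"
  by (rule injD[OF e_inj]) (simp add: regularized_apply assms)

lemma clinear_\<Phi>_e: "clinear (blinfun_apply (\<Phi> e))"
  using calculus e_in by (auto simp: functional_calculus_def cblinfuns_def)

lemma fc_apply_add:
  assumes f: "f \<in> Hinf U" and g: "g \<in> Hinf U"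
  shows "fc_apply E \<Phi> (\<lambda>z. f z + g z) x = fc_apply E \<Phi> f x + fc_apply E \<Phi> g x"
proof (rule fc_apply_eqI[OF Hinf_add[OF f g]])
  have "\<Phi> (\<lambda>z. e z * f z + e z * g z) = \<Phi> (\<lambda>z. e z * f z) + \<Phi> (\<lambda>z. e z * g z)"
    using calculus e_mult[OF f] e_mult[OF g] by (simp add: functional_calculus_def)
  then show "\<Phi> e (fc_apply E \<Phi> f x + fc_apply E \<Phi> g x) = \<Phi> (\<lambda>z. e z * (f z + g z)) x"
    by (simp add: blinfun.add_right blinfun.add_left regularized_apply f g distrib_left)
qed

lemma fc_apply_scale:
  assumes f: "f \<in> Hinf U"
  shows "fc_apply E \<Phi> (\<lambda>z. c * f z) x = c *\<^sub>C fc_apply E \<Phi> f x"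
proof (rule fc_apply_eqI[OF Hinf_scale[OF f]])
  have "\<Phi> (\<lambda>z. c * (e z * f z)) = c *\<^sub>C \<Phi> (\<lambda>z. e z * f z)"
    using calculus e_mult[OF f] by (simp add: functional_calculus_def)
  moreover have "\<Phi> e (c *\<^sub>C fc_apply E \<Phi> f x) = c *\<^sub>C \<Phi> e (fc_apply E \<Phi> f x)"
    using clinear_\<Phi>_e by (simp add: complex_linear_clinear_iff)
  ultimately show "\<Phi> e (c *\<^sub>C fc_apply E \<Phi> f x) = \<Phi> (\<lambda>z. e z * (c * f z)) x"
    by (simp add: regularized_apply f mult.left_commute scaleC_blinfun.rep_eq)
qed

lemma fc_apply_sum:
  assumes "finite A" "\<And>i. i \<in> A \<Longrightarrow> f i \<in> Hinf U"
  shows "fc_apply E \<Phi> (\<lambda>z. \<Sum>i\<in>A. c i * f i z) x = (\<Sum>i\<in>A. c i *\<^sub>C fc_apply E \<Phi> (f i) x)"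
  using assms
proof (induction A rule: finite_induct)
  case empty
  have "(\<lambda>z. 0 :: complex) \<in> Hinf U" by (rule HinfI[where B = 0]) auto
  from fc_apply_scale[OF this, of 0 x] show ?case by simp
next
  case (insert i A)
  then have "(\<lambda>z. c i * f i z) \<in> Hinf U" "(\<lambda>z. \<Sum>i\<in>A. c i * f i z) \<in> Hinf U"
    by (auto intro: Hinf_scale Hinf_sum)
  from fc_apply_add[OF this, of x] show ?case
    using insert by (simp add: fc_apply_scale)
qed

end

section \<open>Square functions on a strip\<close>

text \<open>
  Evaluation at a vector reduces functions with values in the dual space to scalar functions.
\<close>

lemma Hinf_dual_apply:
  assumes u: "u \<in> Hinf_dual S"
  shows "z \<in> S \<Longrightarrow> clinear (blinfun_apply (u z))"
    and "z \<in> S \<Longrightarrow> norm (blinfun_apply (u z) h) \<le> Hinf_norm S u * norm h"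
    and "(\<lambda>z. blinfun_apply (u z) h) holomorphic_on S"
proof -
  show "clinear (blinfun_apply (u z))" if "z \<in> S" using u that by (auto simp: Hinf_dual_def cblinfuns_def)
  show "norm (blinfun_apply (u z) h) \<le> Hinf_norm S u * norm h" if "z \<in> S"
  proof -
    have "bounded (u ` S)" using u by (simp add: Hinf_dual_def)
    then have "bdd_above ((\<lambda>z. norm (u z)) ` S)" by (auto simp: bounded_iff bdd_above_def)
    then have "norm (u z) \<le> Hinf_norm S u" unfolding Hinf_norm_def using that by (rule cSUP_upper2) simp
    then show ?thesis using norm_blinfun[of "u z" h] by (meson mult_right_mono norm_ge_zero order_trans)
  qed
  show "(\<lambda>z. blinfun_apply (u z) h) holomorphic_on S"
    unfolding holomorphic_on_def
  proof
    fix z assume "z \<in> S"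
    then obtain u' where u': "(u has_derivative (\<lambda>w. w *\<^sub>C u')) (at z within S)"
      using u by (auto simp: Hinf_dual_def)
    have "((\<lambda>w. blinfun_apply (u w) h) has_derivative (\<lambda>w. blinfun_apply (w *\<^sub>C u') h)) (at z within S)"
      using bounded_linear.has_derivative[OF blinfun.bounded_linear_left u'] .
    moreover have "(\<lambda>w. blinfun_apply (w *\<^sub>C u') h) = (*) (blinfun_apply u' h)"
      by (auto simp: scaleC_blinfun.rep_eq scaleC_complex_def)
    ultimately show "(\<lambda>w. blinfun_apply (u w) h) field_differentiable at z within S"
      unfolding field_differentiable_def has_field_derivative_def by auto
  qed
qed

lemma diamond_in_Hinf:
  assumes u: "u \<in> Hinf_dual V" and UV: "U \<subseteq> V"
  shows "diamond U h u \<in> Hinf U"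
proof (rule HinfI)
  show "diamond U h u holomorphic_on U"
    by (rule holomorphic_transform[OF holomorphic_on_subset[OF Hinf_dual_apply(3)[OF u, of h] UV]]) (simp add: diamond_def)
  show "norm (diamond U h u z) \<le> Hinf_norm V u * norm h" if "z \<in> U" for z
    using Hinf_dual_apply(2)[OF u, of z h] that UV by (auto simp: diamond_def)
qed (simp add: diamond_def)

definition index_box :: "nat \<Rightarrow> (bool \<times> int \<times> nat) set" where
  "index_box N = UNIV \<times> {- int N..<int N} \<times> {..<N}"

lemma index_box: "finite (index_box n)" "mono index_box" "index_box 0 = {}"
  by (auto simp: index_box_def mono_def)

lemma index_box_exhausts: "finite A \<Longrightarrow> \<exists>n. A \<subseteq> index_box n"
proof (induction A rule: finite_induct)
  case (insert i A)
  then obtain n where n: "A \<subseteq> index_box n" by blast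
  obtain \<sigma> l j where i: "i = (\<sigma>, l, j)" by (cases i) auto
  define k where "k = n + nat \<bar>l\<bar> + j + 1"
  have "i \<in> index_box k" by (auto simp: i index_box_def k_def)
  moreover have "index_box n \<subseteq> index_box k" using index_box(2) by (auto simp: mono_def k_def)
  ultimately show ?case using n by blast
qed simp

theorem theorem6p1:
  fixes \<alpha> \<beta> :: real
    and E :: "(complex \<Rightarrow> complex) set"
    and \<Phi> :: "(complex \<Rightarrow> complex) \<Rightarrow> 'x :: complex_banach \<Rightarrow>\<^sub>L 'x"
  assumes "\<alpha> > 0" and "\<beta> > \<alpha>"
    and "finite_cotype TYPE('x)"
    and "bounded_Hinf_calculus (strip \<alpha>) E \<Phi>"
    and "has_continuous_regularizer (strip \<alpha>) E \<Phi>"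
  shows "(\<forall>u \<in> (Hinf_dual (strip \<beta>) :: (complex \<Rightarrow> 'h :: complex_hilbert \<Rightarrow>\<^sub>L complex) set).
            bounded_sqfun (strip \<alpha>) E \<Phi> u) \<and>
         (\<exists>C\<ge>0. \<forall>u \<in> (Hinf_dual (strip \<beta>) :: (complex \<Rightarrow> 'h \<Rightarrow>\<^sub>L complex) set). \<forall>x.
            gamma_norm (sqfun_apply (strip \<alpha>) E \<Phi> u x)
              \<le> ennreal (C * Hinf_norm (strip \<beta>) u * norm x))"
proof -
  let ?U = "strip \<alpha>" and ?V = "strip \<beta>"
  obtain m :: nat and D :: real where cot: "m \<ge> 1" "D \<ge> 0" "sign_cotype TYPE('x) (2 * m) D"
    by (rule finite_cotype_even_power[OF assms(3)])
  obtain C\<Phi> where C\<Phi>: "C\<Phi> \<ge> 0" and calc: "\<And>f. f \<in> Hinf ?U \<Longrightarrow> fc_dom E \<Phi> f = UNIV \<and>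
      (\<exists>A\<in>cblinfuns. fc_apply E \<Phi> f = blinfun_apply A \<and> norm A \<le> C\<Phi> * Hinf_norm ?U f)"
    using assms(4) unfolding bounded_Hinf_calculus_def by auto
  have fcalc: "functional_calculus ?U E \<Phi>" using assms(4) by (simp add: bounded_Hinf_calculus_def)
  obtain e where e: "e \<in> E" "\<And>f. f \<in> Hinf ?U \<Longrightarrow> (\<lambda>z. e z * f z) \<in> E" "inj (blinfun_apply (\<Phi> e))"
    and wot: "\<And>fs f B x \<xi>. (\<And>n :: nat. fs n \<in> Hinf ?U) \<Longrightarrow> (\<And>n. Hinf_norm ?U (fs n) \<le> B) \<Longrightarrow> f \<in> Hinf ?U \<Longrightarrow>
        (\<And>z. z \<in> ?U \<Longrightarrow> (\<lambda>n. fs n z) \<longlonglongrightarrow> f z) \<Longrightarrow> \<xi> \<in> cdual \<Longrightarrow>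
        (\<lambda>n. blinfun_apply \<xi> (\<Phi> (\<lambda>z. e z * fs n z) x)) \<longlonglongrightarrow> blinfun_apply \<xi> (\<Phi> (\<lambda>z. e z * f z) x)"
    using assms(5) unfolding has_continuous_regularizer_def by blast
  interpret regularized_calculus ?U E \<Phi> e
    by unfold_locales (use fcalc e calc in auto)
  have U_ne: "?U \<noteq> {}" and UV: "?U \<subseteq> ?V" using assms(1,2) by (auto simp: strip_def intro: exI[of _ 0])
  have fc_norm: "norm (fc_apply E \<Phi> f x) \<le> C\<Phi> * B * norm x"
    if f: "f \<in> Hinf ?U" and B: "\<And>z. z \<in> ?U \<Longrightarrow> norm (f z) \<le> B" for f B x
  proof -
    obtain A where A: "fc_apply E \<Phi> f = blinfun_apply A" "norm A \<le> C\<Phi> * Hinf_norm ?U f"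
      using calc[OF f] by blast
    have "Hinf_norm ?U f \<le> B" by (rule Hinf_norm_le[OF U_ne]) (rule B)
    then have "norm A \<le> C\<Phi> * B"
      by (intro order_trans[OF A(2)] mult_left_mono C\<Phi>)
    then show ?thesis using norm_blinfun[of A x] mult_right_mono[of "norm A" "C\<Phi> * B" "norm x"] by (simp add: A(1))
  qed
  show ?thesis
  proof (rule strip_decomposition[OF assms(1,2)])
    fix C :: real and f :: "bool \<times> int \<times> nat \<Rightarrow> complex \<Rightarrow> complex"
      and c :: "bool \<times> int \<times> nat \<Rightarrow> (complex \<Rightarrow> complex) \<Rightarrow> complex"
    assume C: "C \<ge> 0" and f: "\<And>i. f i \<in> Hinf ?U"
      and f_sum: "\<And>J z. finite J \<Longrightarrow> z \<in> ?U \<Longrightarrow> (\<Sum>i\<in>J. norm (f i z)) \<le> C"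
      and c_add: "\<And>i g h. g holomorphic_on ?V \<Longrightarrow> h holomorphic_on ?V \<Longrightarrow> c i (\<lambda>z. g z + h z) = c i g + c i h"
      and c_scale: "\<And>i g a. g holomorphic_on ?V \<Longrightarrow> c i (\<lambda>z. a * g z) = a * c i g"
      and c_le: "\<And>i g M. g holomorphic_on ?V \<Longrightarrow> (\<And>z. z \<in> ?V \<Longrightarrow> norm (g z) \<le> M) \<Longrightarrow> norm (c i g) \<le> C * M"
      and lim: "\<And>g M z. g holomorphic_on ?V \<Longrightarrow> (\<And>z. z \<in> ?V \<Longrightarrow> norm (g z) \<le> M) \<Longrightarrow> z \<in> ?U \<Longrightarrow>
        (\<lambda>N. \<Sum>i\<in>UNIV \<times> {- int N..<int N} \<times> {..<N}. c i g * f i z) \<longlonglongrightarrow> g z"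
    have comb: "norm (\<Sum>i\<in>A. v i * f i z) \<le> t * C"
      if "finite A" "\<And>i. norm (v i) \<le> t" "t \<ge> 0" "z \<in> ?U" for A v t z
    proof -
      have "norm (\<Sum>i\<in>A. v i * f i z) \<le> (\<Sum>i\<in>A. t * norm (f i z))"
        using that by (intro order_trans[OF norm_sum] sum_mono) (auto simp: norm_mult intro!: mult_right_mono)
      also have "\<dots> \<le> t * C" unfolding sum_distrib_left[symmetric] using that f_sum by (intro mult_left_mono) auto
      finally show ?thesis .
    qed
    have key: "sqfun_apply ?U E \<Phi> u x \<in> gamma_radonifying \<and>
        gamma_norm (sqfun_apply ?U E \<Phi> u x) \<le> ennreal (sqrt (multiplier_const m D) * (C * Hinf_norm ?V u * (C\<Phi> * C * norm x)))"
      if u: "u \<in> Hinf_dual ?V" for u :: "complex \<Rightarrow> 'h \<Rightarrow>\<^sub>L complex" and x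
    proof -
      define M where "M = Hinf_norm ?V u"
      define g where "g h z = blinfun_apply (u z) h" for h z
      define y where "y i = fc_apply E \<Phi> (f i) x" for i
      define a where "a i h = c i (g h)" for i h
      have g_hol: "g h holomorphic_on ?V" for h unfolding g_def by (rule Hinf_dual_apply(3)[OF u])
      have g_le: "norm (g h z) \<le> M * norm h" if "z \<in> ?V" for h z
        unfolding g_def M_def by (rule Hinf_dual_apply(2)[OF u that])
      have M0: "M \<ge> 0"
      proof -
        obtain z where "z \<in> ?V" using U_ne UV by blast
        then have "norm (u z) \<le> M"
          unfolding M_def Hinf_norm_def using u
          by (intro cSUP_upper) (auto simp: Hinf_dual_def bounded_iff bdd_above_def)
        then show ?thesis using norm_ge_zero order_trans by blast
      qed
      have y_le: "norm (\<Sum>i\<in>A. v i *\<^sub>C y i) \<le> C\<Phi> * C * norm x" if "finite A" "\<And>i. norm (v i) \<le> 1" for A v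
      proof -
        have "(\<Sum>i\<in>A. v i *\<^sub>C y i) = fc_apply E \<Phi> (\<lambda>z. \<Sum>i\<in>A. v i * f i z) x"
          unfolding y_def by (rule fc_apply_sum[symmetric, OF that(1) f])
        also have "norm \<dots> \<le> C\<Phi> * C * norm x"
          by (rule fc_norm[OF Hinf_sum[OF that(1) f]]) (use comb[OF that(1), of v 1] that(2) in simp)
        finally show ?thesis .
      qed
      have a_le: "norm (a i h) \<le> (C * M) * norm h" for i h
        unfolding a_def using c_le[OF g_hol[of h] g_le[of _ h], of i] by (simp add: mult.assoc)
      have a_lin: "clinear (a i)" for i
      proof -
        \<comment> \<open>The coefficients only see the values on the strip, since they are bounded by the supremum over it.\<close>
        have c_cong: "c i g1 = c i g2" if "g1 holomorphic_on ?V" "g2 holomorphic_on ?V" "\<And>z. z \<in> ?V \<Longrightarrow> g1 z = g2 z" for g1 g2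
        proof -
          have "norm (c i (\<lambda>z. g1 z + (- 1) * g2 z)) \<le> C * 0"
            by (rule c_le) (use that in \<open>auto intro!: holomorphic_intros\<close>)
          moreover have "c i (\<lambda>z. g1 z + (- 1) * g2 z) = c i g1 + c i (\<lambda>z. (- 1) * g2 z)"
            by (rule c_add) (use that in \<open>auto intro!: holomorphic_intros\<close>)
          moreover have "c i (\<lambda>z. (- 1) * g2 z) = (- 1) * c i g2" by (rule c_scale[OF that(2)])
          ultimately show ?thesis by simp
        qed
        have "a i (h + k) = a i h + a i k" for h k
        proof -
          have "g (h + k) = (\<lambda>z. g h z + g k z)" by (intro ext) (simp add: g_def blinfun.add_right)
          then show ?thesis unfolding a_def using c_add[OF g_hol[of h] g_hol[of k]] by simp
        qed
        moreover have "a i (b *\<^sub>C h) = b *\<^sub>C a i h" for b h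
        proof -
          have "c i (g (b *\<^sub>C h)) = c i (\<lambda>z. b * g h z)"
          proof (rule c_cong)
            show "g (b *\<^sub>C h) z = b * g h z" if "z \<in> ?V" for z
              using Hinf_dual_apply(1)[OF u that, unfolded complex_linear_clinear_iff]
              by (simp add: g_def scaleC_complex_def)
          qed (auto intro!: holomorphic_intros g_hol)
          then show ?thesis unfolding a_def using c_scale[OF g_hol[of h], of i b] by (simp add: scaleC_complex_def)
        qed
        ultimately show ?thesis unfolding complex_linear_clinear_iff by blast
      qed
      have dia: "diamond ?U h u \<in> Hinf ?U" for h by (rule diamond_in_Hinf[OF u UV])
      \<comment> \<open>The partial sums converge in norm; continuity of the regularized calculus and injectivity of \<open>\<Phi> e\<close> identify the limit.\<close>
      have T: "(\<lambda>n. \<Sum>i\<in>index_box n. a i h *\<^sub>C y i) \<longlonglongrightarrow> fc_apply E \<Phi> (diamond ?U h u) x" for h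
      proof -
        define s where "s n z = (\<Sum>i\<in>index_box n. a i h * f i z)" for n z
        have s_H: "s n \<in> Hinf ?U" for n unfolding s_def by (rule Hinf_sum[OF index_box(1) f])
        have s_fc: "fc_apply E \<Phi> (s n) x = (\<Sum>i\<in>index_box n. a i h *\<^sub>C y i)" for n
          unfolding s_def y_def by (rule fc_apply_sum[OF index_box(1) f])
        have "convergent (\<lambda>n. \<Sum>i\<in>index_box n. a i h *\<^sub>C y i)"
          by (rule unconditional_series_convergent[OF cot(3) y_le index_box(1) index_box_exhausts index_box(2) a_le])
        then obtain L where L: "(\<lambda>n. \<Sum>i\<in>index_box n. a i h *\<^sub>C y i) \<longlonglongrightarrow> L" by (auto simp: convergent_def)
        have "\<Phi> e L = \<Phi> (\<lambda>z. e z * diamond ?U h u z) x"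
        proof (rule ccontr)
          assume "\<Phi> e L \<noteq> \<Phi> (\<lambda>z. e z * diamond ?U h u z) x"
          then have "\<Phi> e L - \<Phi> (\<lambda>z. e z * diamond ?U h u z) x \<noteq> 0" by simp
          then obtain \<xi> :: "'x \<Rightarrow>\<^sub>L complex" where \<xi>: "\<xi> \<in> cdual" "\<xi> (\<Phi> e L - \<Phi> (\<lambda>z. e z * diamond ?U h u z) x) \<noteq> 0"
            by (rule cdual_separates)
          have "(\<lambda>n. \<xi> (\<Phi> e (fc_apply E \<Phi> (s n) x))) \<longlonglongrightarrow> \<xi> (\<Phi> e L)"
            unfolding s_fc by (intro blinfun.tendsto tendsto_const L)
          moreover have "(\<lambda>n. \<xi> (\<Phi> e (fc_apply E \<Phi> (s n) x))) \<longlonglongrightarrow> \<xi> (\<Phi> (\<lambda>z. e z * diamond ?U h u z) x)"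
            unfolding regularized_apply[OF s_H]
          proof (rule wot[OF s_H _ dia _ \<xi>(1)])
            show "Hinf_norm ?U (s n) \<le> (C * M * norm h) * C" for n
            proof (rule Hinf_norm_le[OF U_ne])
              show "norm (s n z) \<le> (C * M * norm h) * C" if "z \<in> ?U" for z
                unfolding s_def by (rule comb[OF index_box(1) a_le _ that]) (use C M0 in simp)
            qed
            show "(\<lambda>n. s n z) \<longlonglongrightarrow> diamond ?U h u z" if "z \<in> ?U" for z
            proof -
              have "diamond ?U h u z = g h z" using that by (simp add: diamond_def g_def)
              then show ?thesis using lim[OF g_hol[of h] g_le[of _ h] that] by (simp only: s_def index_box_def a_def)
            qed
          qed
          ultimately have "\<xi> (\<Phi> e L) = \<xi> (\<Phi> (\<lambda>z. e z * diamond ?U h u z) x)" by (rule LIMSEQ_unique)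
          then show False using \<xi>(2) by (simp add: blinfun.diff_right)
        qed
        then have "fc_apply E \<Phi> (diamond ?U h u) x = L" by (rule fc_apply_eqI[OF dia])
        then show ?thesis using L by simp
      qed
      have CM: "C * M \<ge> 0" using C M0 by simp
      show ?thesis
        unfolding sqfun_apply_def M_def[symmetric]
        using gamma_series[OF cot(3,1,2) a_lin a_le CM y_le index_box(1) index_box_exhausts index_box(2,3) T] by simp
    qed
    define K where "K = sqrt (multiplier_const m D) * C * (C\<Phi> * C)"
    have K0: "K \<ge> 0" using C C\<Phi> multiplier_const_nonneg[OF cot(1,2)] by (simp add: K_def)
    have bound: "gamma_norm (sqfun_apply ?U E \<Phi> u x) \<le> ennreal (K * Hinf_norm ?V u * norm x)"
      if "u \<in> Hinf_dual ?V" for u :: "complex \<Rightarrow> 'h \<Rightarrow>\<^sub>L complex" and x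
      using key[OF that, of x] by (simp add: K_def mult_ac)
    have "bounded_sqfun ?U E \<Phi> u" if u: "u \<in> Hinf_dual ?V" for u :: "complex \<Rightarrow> 'h \<Rightarrow>\<^sub>L complex"
      unfolding bounded_sqfun_def
    proof (intro conjI allI)
      show "sqfun_dom ?U E \<Phi> u = UNIV"
        using key[OF u] calc[OF diamond_in_Hinf[OF u UV]] by (auto simp: sqfun_dom_def)
      show "clinear (\<lambda>x. sqfun_apply ?U E \<Phi> u x h)" for h
        using calc[OF diamond_in_Hinf[OF u UV, of h]] by (auto simp: sqfun_apply_def cblinfuns_def)
      have "gamma_norm (sqfun_apply ?U E \<Phi> u x) \<le> ennreal (\<bar>K * Hinf_norm ?V u\<bar> * norm x)" for x
        using bound[OF u, of x] by (rule order_trans) (intro ennreal_leI mult_right_mono, auto)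
      then show "\<exists>K\<ge>0. \<forall>x. gamma_norm (sqfun_apply ?U E \<Phi> u x) \<le> ennreal (K * norm x)"
        by (intro exI[of _ "\<bar>K * Hinf_norm ?V u\<bar>"]) auto
    qed
    then show ?thesis using K0 bound by blast
  qed
qed

end
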